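(* Let $n\ge2$. For $m=d=2$, the image $\mathbb B^2_2$ of the involutive cone incidence $\widetilde\rho_2:\mathbb P(\widetilde{\mathcal F}^2_2)\to\mathbb P(\operatorname{Sym}^2V^\vee)$ is the full projective space $\mathbb P(\operatorname{Sym}^2V^\vee)$ of quadrics in $\mathbb P^{2n-1}$, and the generic degree of the incidence map $\widetilde\rho_2$ is $2n$.
   Context: We work over $\mathbb C$; $(V,\omega)$ is a complex symplectic vector space of dimension $2n$ and $\mathbb P^{2n-1}=\mathbb P(V)$. For a hyperplane $H=V(\ell)$, the polar point is $\sigma(H)=[v_\ell]\in H$, where $\ell(u)=\omega(v_\ell,u)$ for all $u\in V$. For a vector bundle $E$ on a base $B$, $\pi:\mathbb P(E)\to B$ parametrizes one-dimensional subspaces of the fibers, with tautological line subbundle $\mathcal O_{\mathbb P(E)}(-1)=\mathcal O_E(-1)\subset\pi^*E$; $\operatorname{Sym}^kE=0$ for $k<0$; pullbacks of bundles are not written. Let $\check{\mathbb P}^{2n-1}$ be the space of hyperplanes of $\mathbb P(V)$ and $\mathcal F=V^\vee\otimes\mathcal O_{\check{\mathbb P}^{2n-1}}$. The tautological sequence $0\to\mathcal O_{\check{\mathbb P}^{2n-1}}(-1)\to\mathcal F\to\mathcal Q\to0$ defines $\mathcal Q$ (its fiber at $H$ is the space of linear forms on $H$). The bundle $\mathbb P(\mathcal Q^\vee)$ parametrizes pairs $(H,p)$ with $p\in H$; on it $0\to\mathcal G\to\mathcal Q\to\mathcal O_{\mathcal Q^\vee}(1)\to0$ defines $\mathcal G$,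 whose fiber at $(H,p)$ is the space of linear forms on $H$ vanishing at $p$. Let $s_\sigma:\check{\mathbb P}^{2n-1}\to\mathbb P(\mathcal Q^\vee)$, $H\mapsto(H,\sigma(H))$, and $\mathcal G_\sigma=s_\sigma^*\mathcal G$. For $d\ge m\ge 2$ set $\mathbb Y_m=\mathbb P(\operatorname{Sym}^m\mathcal G_\sigma)$: its points are pairs $(H,[q])$ with $H$ a hyperplane and $q\ne0$ a degree-$m$ form on $H$ that is a polynomial in the linear forms on $H$ vanishing at $\sigma(H)$ (the equation of a possibly nonreduced cone in $H$ whose vertex contains $\sigma(H)$). Over $\mathbb Y_m$, multiplication gives an inclusion $\mathcal O_{\operatorname{Sym}^m\mathcal G_\sigma}(-1)\otimes\operatorname{Sym}^{d-m}\mathcal Q\hookrightarrow\operatorname{Sym}^d\mathcal Q$, and $\widetilde{\mathcal F}^m_d\subset\operatorname{Sym}^d\mathcal F$ is the inverse image of this subbundle under $\operatorname{Sym}^d\mathcal F\to\operatorname{Sym}^d\mathcal Q$. Thus the fiber of $\widetilde{\mathcal F}^m_d$ over $(H,[q])$ consists of the degree-$d$ forms on $V$ whose restriction to $H$ is a multiple of $q$. The involutive cone incidence $\widetilde\rho_m:\mathbb P(\widetilde{\mathcal F}^m_d)\to\mathbb P(\operatorname{Sym}^dV^\vee)$ is the map induced by $\widetilde{\mathcal F}^m_d\subset\operatorname{Sym}^dV^\vee\otimes\mathcal O$, and $\mathbb B^m_d$ is its image. The generic degree of a generically finite map onto its image is the degree of the induced extension of function fields. *)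

theory Defs
  imports "HOL-Analysis.Abstract_Topology" "HOL-Algebra.Embedded_Algebras" Complex_Main
begin

section \<open>Varieties, regular functions, function fields\<close>

text \<open>
  A variety is given here the way projective space is given by its homogeneous coordinates:
  a set \<open>points\<close>, an ambient affine space \<open>ambient\<close> (a finite-dimensional complex vector
  space, or a product of such) whose polynomial functions are generated by \<open>coords\<close>, and a
  map \<open>quot\<close>.  The part of the ambient space lying over \<open>points\<close> (the ``cone'')
  carries its structure of (reduced) quasi-affine variety, and the points carry the quotient
  structure: a set of points is open, respectively a function is regular, iff its pullback to the
  cone is.
\<close>

record ('c, 'x) variety =
  ambient :: "'c set"
  coords :: "('c \<Rightarrow> complex) set"
  quot :: "'c \<Rightarrow> 'x"
  points :: "'x set"

definition cone_over :: "('c, 'x) variety \<Rightarrow> 'x set \<Rightarrow> 'c set" where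
  "cone_over X U = {c \<in> ambient X. quot X c \<in> points X \<and> quot X c \<in> U}"

inductive_set polynomial_functions :: "('c \<Rightarrow> complex) set \<Rightarrow> ('c \<Rightarrow> complex) set"
  for \<Gamma> :: "('c \<Rightarrow> complex) set" where
  const: "(\<lambda>_. a) \<in> polynomial_functions \<Gamma>"
| coord: "f \<in> \<Gamma> \<Longrightarrow> f \<in> polynomial_functions \<Gamma>"
| add: "f \<in> polynomial_functions \<Gamma> \<Longrightarrow> g \<in> polynomial_functions \<Gamma>
    \<Longrightarrow> (\<lambda>c. f c + g c) \<in> polynomial_functions \<Gamma>"
| mult: "f \<in> polynomial_functions \<Gamma> \<Longrightarrow> g \<in> polynomial_functions \<Gamma>
    \<Longrightarrow> (\<lambda>c. f c * g c) \<in> polynomial_functions \<Gamma>"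

definition cone_topology :: "('c, 'x) variety \<Rightarrow> 'c topology" where
  "cone_topology X = topology_generated_by
     {{c \<in> cone_over X UNIV. p c \<noteq> 0} |p. p \<in> polynomial_functions (coords X)}"

definition zariski :: "('c, 'x) variety \<Rightarrow> 'x topology" where
  "zariski X = topology (\<lambda>U. U \<subseteq> points X \<and> openin (cone_topology X) (cone_over X U))"

lemma openin_zariski:
  "openin (zariski X) U \<longleftrightarrow> U \<subseteq> points X \<and> openin (cone_topology X) (cone_over X U)"
proof -
  have int: "cone_over X (S \<inter> T) = cone_over X S \<inter> cone_over X T" for S T
    by (auto simp: cone_over_def)
  have un: "cone_over X (\<Union>K) = \<Union>(cone_over X ` K)" for K
    by (auto simp: cone_over_def)
  have "istopology (\<lambda>U. U \<subseteq> points X \<and> openin (cone_topology X) (cone_over X U))"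
    unfolding istopology_def int un by (auto intro!: openin_Union)
  then show ?thesis
    unfolding zariski_def by (simp add: topology_inverse')
qed

definition regular_on :: "('c, 'x) variety \<Rightarrow> 'x set \<Rightarrow> ('x \<Rightarrow> complex) \<Rightarrow> bool" where
  "regular_on X U g \<longleftrightarrow>
     (\<forall>c \<in> cone_over X U.
        \<exists>p \<in> polynomial_functions (coords X). \<exists>q \<in> polynomial_functions (coords X).
          q c \<noteq> 0 \<and> (\<forall>c' \<in> cone_over X U. q c' \<noteq> 0 \<longrightarrow> g (quot X c') = p c' / q c'))"

definition irreducible_variety :: "('c, 'x) variety \<Rightarrow> bool" where
  "irreducible_variety X \<longleftrightarrow> points X \<noteq> {} \<and>
     (\<forall>U V. openin (zariski X) U \<and> openin (zariski X) V \<and> U \<noteq> {} \<and> V \<noteq> {} \<longrightarrow> U \<inter> V \<noteq> {})"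

definition morphism :: "('c, 'x) variety \<Rightarrow> ('e, 'y) variety \<Rightarrow> ('x \<Rightarrow> 'y) \<Rightarrow> bool" where
  "morphism X Y \<phi> \<longleftrightarrow> continuous_map (zariski X) (zariski Y) \<phi> \<and>
     (\<forall>V h. openin (zariski Y) V \<and> regular_on Y V h
        \<longrightarrow> regular_on X {x \<in> points X. \<phi> x \<in> V} (h \<circ> \<phi>))"

text \<open>The function field: regular functions on nonempty open sets, two of them being
  identified when they agree on a nonempty open subset of their common domain.\<close>

type_synonym 'x rational_rep = "'x set \<times> ('x \<Rightarrow> complex)"

definition rational_reps :: "('c, 'x) variety \<Rightarrow> 'x rational_rep set" where
  "rational_reps X = {(U, g). openin (zariski X) U \<and> U \<noteq> {} \<and> regular_on X U g}"

definition rational_rel :: "('c, 'x) variety \<Rightarrow> ('x rational_rep \<times> 'x rational_rep) set" where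
  "rational_rel X = {((U, g), (V, h)). (U, g) \<in> rational_reps X \<and> (V, h) \<in> rational_reps X \<and>
     (\<exists>W. openin (zariski X) W \<and> W \<noteq> {} \<and> W \<subseteq> U \<inter> V \<and> (\<forall>x\<in>W. g x = h x))}"

definition rational_class ::
    "('c, 'x) variety \<Rightarrow> 'x set \<Rightarrow> ('x \<Rightarrow> complex) \<Rightarrow> 'x rational_rep set" where
  "rational_class X U g = rational_rel X `` {(U, g)}"

definition function_field :: "('c, 'x) variety \<Rightarrow> 'x rational_rep set ring" where
  "function_field X =
     \<lparr>carrier = rational_reps X // rational_rel X,
      mult = (\<lambda>a b. \<Union>(U, g)\<in>a. \<Union>(V, h)\<in>b. rational_class X (U \<inter> V) (\<lambda>x. g x * h x)),
      one = rational_class X (points X) (\<lambda>_. 1),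
      zero = rational_class X (points X) (\<lambda>_. 0),
      add = (\<lambda>a b. \<Union>(U, g)\<in>a. \<Union>(V, h)\<in>b. rational_class X (U \<inter> V) (\<lambda>x. g x + h x))\<rparr>"

definition pullback ::
    "('c, 'x) variety \<Rightarrow> ('x \<Rightarrow> 'y) \<Rightarrow> 'y rational_rep set \<Rightarrow> 'x rational_rep set" where
  "pullback X \<phi> a = (\<Union>(V, h)\<in>a. rational_class X {x \<in> points X. \<phi> x \<in> V} (h \<circ> \<phi>))"

definition subvariety :: "('c, 'x) variety \<Rightarrow> 'x set \<Rightarrow> ('c, 'x) variety" where
  "subvariety X S = X\<lparr>points := points X \<inter> S\<rparr>"

text \<open>\<open>\<phi> : X \<rightarrow> Y\<close> is generically finite of degree \<open>d\<close> onto its image: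
  the extension of function fields induced by \<open>X \<rightarrow> \<phi>(X)\<close> has degree \<open>d\<close>.\<close>

definition has_generic_degree ::
    "('c, 'x) variety \<Rightarrow> ('e, 'y) variety \<Rightarrow> ('x \<Rightarrow> 'y) \<Rightarrow> nat \<Rightarrow> bool" where
  "has_generic_degree X Y \<phi> d \<longleftrightarrow>
     (let B = subvariety Y (\<phi> ` points X) in
        \<phi> ` points X \<subseteq> points Y \<and> irreducible_variety X \<and> morphism X B \<phi> \<and>
        ring.dimension (function_field X) d
          (pullback X \<phi> ` carrier (function_field B)) (carrier (function_field X)))"

section \<open>Forms on subspaces\<close>

locale symplectic_space = vector_space scale
  for scale :: "complex \<Rightarrow> 'v::ab_group_add \<Rightarrow> 'v" +
  fixes \<omega> :: "'v \<Rightarrow> 'v \<Rightarrow> complex" and n :: nat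
  assumes add_left: "\<omega> (u + v) w = \<omega> u w + \<omega> v w"
    and scale_left: "\<omega> (scale a u) w = a * \<omega> u w"
    and add_right: "\<omega> u (v + w) = \<omega> u v + \<omega> u w"
    and scale_right: "\<omega> u (scale a w) = a * \<omega> u w"
    and alternating: "\<omega> u u = 0"
    and nondegenerate: "(\<forall>w. \<omega> u w = 0) \<Longrightarrow> u = 0"
    and dimension: "dim (UNIV :: 'v set) = 2 * n"

text \<open>Forms on a linear subspace \<open>H\<close> of \<open>V\<close> are functions on \<open>V\<close> that
  vanish outside \<open>H\<close>, so that a form on \<open>H\<close> is determined by its values on \<open>H\<close>.\<close>

definition linear_forms ::
    "(complex \<Rightarrow> 'v::ab_group_add \<Rightarrow> 'v) \<Rightarrow> 'v set \<Rightarrow> ('v \<Rightarrow> complex) set" where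
  "linear_forms scale H = {l. (\<forall>x\<in>H. \<forall>y\<in>H. l (x + y) = l x + l y) \<and>
     (\<forall>x\<in>H. \<forall>a. l (scale a x) = a * l x) \<and> (\<forall>x. x \<notin> H \<longrightarrow> l x = 0)}"

text \<open>The \<open>k\<close>-th symmetric power of a space \<open>L\<close> of linear forms, as a space of functions:
  the linear combinations of \<open>k\<close>-fold products.  Over an infinite field this is the abstract
  symmetric power.\<close>

definition Sym :: "nat \<Rightarrow> ('v \<Rightarrow> complex) set \<Rightarrow> ('v \<Rightarrow> complex) set" where
  "Sym k L = {\<lambda>x. \<Sum>i<N. c i * (\<Prod>j<k. a i j x) | (N::nat) (c :: nat \<Rightarrow> complex) a.
     \<forall>i<N. \<forall>j<k. a i j \<in> L}"

definition kernel :: "('v \<Rightarrow> complex) \<Rightarrow> 'v set" where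
  "kernel l = {u. l u = 0}"

definition restr :: "'v set \<Rightarrow> ('v \<Rightarrow> complex) \<Rightarrow> 'v \<Rightarrow> complex" where
  "restr H f = (\<lambda>x. if x \<in> H then f x else 0)"

definition line :: "('v \<Rightarrow> complex) \<Rightarrow> ('v \<Rightarrow> complex) set" where
  "line f = range (\<lambda>c x. c * f x)"

definition projectivization :: "('v \<Rightarrow> complex) set \<Rightarrow> ('v \<Rightarrow> complex) set set" where
  "projectivization L = {line f |f. f \<in> L \<and> f \<noteq> (\<lambda>_. 0)}"

definition hyperplanes :: "(complex \<Rightarrow> 'v::ab_group_add \<Rightarrow> 'v) \<Rightarrow> 'v set set" where
  "hyperplanes scale = {kernel l |l. l \<in> linear_forms scale UNIV \<and> l \<noteq> (\<lambda>_. 0)}"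

definition proj_forms :: "(complex \<Rightarrow> 'v::ab_group_add \<Rightarrow> 'v) \<Rightarrow> nat
    \<Rightarrow> ('v \<Rightarrow> complex, ('v \<Rightarrow> complex) set) variety" where
  "proj_forms scale d =
     \<lparr>ambient = Sym d (linear_forms scale UNIV),
      coords = {\<lambda>f. f u |u. True},
      quot = line,
      points = projectivization (Sym d (linear_forms scale UNIV))\<rparr>"

section \<open>The involutive cone incidence\<close>

definition polar_point ::
    "(complex \<Rightarrow> 'v::ab_group_add \<Rightarrow> 'v) \<Rightarrow> ('v \<Rightarrow> 'v \<Rightarrow> complex) \<Rightarrow> 'v set \<Rightarrow> 'v set" where
  "polar_point scale \<omega> H = (THE p. \<exists>l v. l \<in> linear_forms scale UNIV \<and> l \<noteq> (\<lambda>_. 0) \<and>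
     H = kernel l \<and> (\<forall>u. l u = \<omega> v u) \<and> p = range (\<lambda>c. scale c v))"

definition G_sigma :: "(complex \<Rightarrow> 'v::ab_group_add \<Rightarrow> 'v) \<Rightarrow> ('v \<Rightarrow> 'v \<Rightarrow> complex) \<Rightarrow> 'v set
    \<Rightarrow> ('v \<Rightarrow> complex) set" where
  "G_sigma scale \<omega> H = {l \<in> linear_forms scale H. \<forall>x \<in> polar_point scale \<omega> H. l x = 0}"

definition Y_points :: "(complex \<Rightarrow> 'v::ab_group_add \<Rightarrow> 'v) \<Rightarrow> ('v \<Rightarrow> 'v \<Rightarrow> complex) \<Rightarrow> nat
    \<Rightarrow> ('v set \<times> ('v \<Rightarrow> complex) set) set" where
  "Y_points scale \<omega> m =
     {(H, Q). H \<in> hyperplanes scale \<and> Q \<in> projectivization (Sym m (G_sigma scale \<omega> H))}"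

text \<open>The fiber of \<open>F\<^sup>m\<^sub>d\<close> over \<open>(H, Q)\<close>, where \<open>Q\<close> is a line of forms on \<open>H\<close>.\<close>

definition F_fiber :: "(complex \<Rightarrow> 'v::ab_group_add \<Rightarrow> 'v) \<Rightarrow> nat \<Rightarrow> nat
    \<Rightarrow> 'v set \<Rightarrow> ('v \<Rightarrow> complex) set \<Rightarrow> ('v \<Rightarrow> complex) set" where
  "F_fiber scale m d H Q = {f \<in> Sym d (linear_forms scale UNIV).
     \<exists>q \<in> Q. \<exists>h \<in> Sym (d - m) (linear_forms scale H). \<forall>x\<in>H. f x = q x * h x}"

text \<open>The projective bundle \<open>\<bbbP>(F\<^sup>m\<^sub>d)\<close> for \<open>d \<ge> m \<ge> 2\<close>.  Its points are triples
  \<open>(H, [q], [f])\<close>; its homogeneous coordinates are those of \<open>(l, q, f)\<close>, where \<open>H\<close> is the kernel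
  of \<open>l\<close> and \<open>q\<close> is any degree \<open>m\<close> form on \<open>V\<close> restricting to the given one on \<open>H\<close>.
  The quotient map from these coordinates is Zariski locally trivial over the bundle, so the quotient
  structure is that of the projective bundle.\<close>

definition incidence :: "(complex \<Rightarrow> 'v::ab_group_add \<Rightarrow> 'v) \<Rightarrow> ('v \<Rightarrow> 'v \<Rightarrow> complex) \<Rightarrow> nat \<Rightarrow> nat
    \<Rightarrow> (('v \<Rightarrow> complex) \<times> ('v \<Rightarrow> complex) \<times> ('v \<Rightarrow> complex),
        'v set \<times> ('v \<Rightarrow> complex) set \<times> ('v \<Rightarrow> complex) set) variety" where
  "incidence scale \<omega> m d =
     \<lparr>ambient = linear_forms scale UNIV \<times> Sym m (linear_forms scale UNIV)
        \<times> Sym d (linear_forms scale UNIV),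
      coords = {\<lambda>(l, q, f). l u |u. True} \<union> {\<lambda>(l, q, f). q u |u. True}
        \<union> {\<lambda>(l, q, f). f u |u. True},
      quot = (\<lambda>(l, q, f). (kernel l, line (restr (kernel l) q), line f)),
      points = {(H, Q, F). (H, Q) \<in> Y_points scale \<omega> m \<and>
        F \<in> projectivization (F_fiber scale m d H Q)}\<rparr>"

definition rho :: "'v set \<times> ('v \<Rightarrow> complex) set \<times> ('v \<Rightarrow> complex) set \<Rightarrow> ('v \<Rightarrow> complex) set" where
  "rho = (\<lambda>(H, Q, F). F)"

definition B_image :: "(complex \<Rightarrow> 'v::ab_group_add \<Rightarrow> 'v) \<Rightarrow> ('v \<Rightarrow> 'v \<Rightarrow> complex) \<Rightarrow> nat \<Rightarrow> nat
    \<Rightarrow> ('v \<Rightarrow> complex) set set" where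
  "B_image scale \<omega> m d = rho ` points (incidence scale \<omega> m d)"

end

theory Submission
  imports Defs "HOL-Algebra.Finite_Extensions" "Jordan_Normal_Form.Char_Poly"
begin

text \<open>
  A quadratic form \<open>f\<close> on \<open>V\<close> corresponds to the infinitesimal symplectic endomorphism \<open>A\<close> with
  \<open>\<omega>(A v, y) = b(v, y)\<close>, where \<open>b\<close> is the polar form of \<open>f\<close>.  Let \<open>H\<close> be the hyperplane
  \<open>v\<^sup>\<bottom>\<close>, whose polar point is \<open>[v]\<close>.  If \<open>f\<close> restricts on \<open>H\<close> to a multiple of a cone with vertex
  \<open>[v]\<close>, then \<open>b(v, _)\<close> vanishes on \<open>H\<close>, so it is a multiple of \<open>\<omega>(v, _)\<close>, that is, \<open>v\<close> is an
  eigenvector of \<open>A\<close>.  Conversely, if \<open>v\<close> is an eigenvector, the restriction of \<open>f\<close> to \<open>H\<close> is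
  such a cone or zero, and in the second case every cone on \<open>H\<close> with vertex \<open>[v]\<close> gives a point of
  the incidence.  Since \<open>A\<close> has an eigenvector, the incidence maps onto the space of all quadrics
  (\<open>rho_surj\<close>), and over a general quadric its points are the \<open>2n\<close> eigenlines of \<open>A\<close>.

  The degree of the extension of function fields is that of the minimal polynomial of one generator, the
  eigenvalue.  The incidence is irreducible because the cone over it is the image of an open part of an
  affine space under a polynomial map (\<open>irreducible_X\<close>).  Let \<open>K\<close> be the function field of the space
  of quadrics, pulled back to the incidence, and let \<open>\<theta>\<close> be the eigenvalue, made homogeneous of
  degree zero by normalizing \<open>f\<close> to have value \<open>1\<close> at a fixed vector.

  \<^item> \<open>\<theta>\<close> is a root of the characteristic polynomial of the normalized endomorphism, which is monic
    of degree \<open>2n\<close> over \<open>K\<close> (\<open>char_poly_list\<close>).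
  \<^item> A relation of smaller degree would hold, by irreducibility, at all points of the incidence over
    some nonempty open set of forms.  That set contains a form with \<open>2n\<close> distinct eigenvalues
    (\<open>dense_distinct_eigenvalues\<close>), and each of them is the value of \<open>\<theta>\<close> at a point, which is too many
    roots (\<open>Irr_length_ge\<close>).
  \<^item> \<open>\<theta>\<close> generates the function field (\<open>E_carrier\<close>).  On a dense open set the cone \<open>q\<close> can be replaced
    by \<open>f\<close>, so every rational function is a quotient of polynomials in the normalized coordinates of
    \<open>v\<close> and \<open>f\<close>; and Cramer's rule, applied to the equations of the eigenvector, expresses the
    coordinates of \<open>v\<close> through \<open>\<theta>\<close> and \<open>f\<close>.
\<close>

(* The letter X denotes varieties here, not an indeterminate. *)
no_notation var (\<open>X\<index>\<close>)

section \<open>Zariski topology and regular functions\<close>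

lemma polynomial_function_prod_ne:
  assumes "p \<in> polynomial_functions \<Gamma>" "q \<in> polynomial_functions \<Gamma>"
  shows "\<exists>r\<in>polynomial_functions \<Gamma>. \<forall>c. r c \<noteq> 0 \<longleftrightarrow> p c \<noteq> 0 \<and> q c \<noteq> 0"
  by (rule bexI[of _ "\<lambda>c. p c * q c"]) (use assms in \<open>auto intro: polynomial_functions.mult\<close>)

abbreviation polys :: "('c, 'x) variety \<Rightarrow> ('c \<Rightarrow> complex) set" where
  "polys X \<equiv> polynomial_functions (coords X)"

text \<open>Because \<open>D(p) \<inter> D(q) = D(p q)\<close>, the sets on which a polynomial function does not vanish are a basis
  of the topology that they generate.\<close>

lemma openin_cone_topology_iff:
  fixes X :: "('c, 'x) variety"
  shows "openin (cone_topology X) S \<longleftrightarrow> S \<subseteq> cone_over X UNIV \<and>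
     (\<forall>c\<in>S. \<exists>p\<in>polys X. p c \<noteq> 0 \<and>
        (\<forall>c'\<in>cone_over X UNIV. p c' \<noteq> 0 \<longrightarrow> c' \<in> S))"
    (is "?L \<longleftrightarrow> ?R")
proof
  let ?B = "{{c \<in> cone_over X UNIV. p c \<noteq> 0} |p. p \<in> polys X}"
  assume ?L
  then have "generate_topology_on ?B S"
    unfolding cone_topology_def openin_topology_generated_by_iff .
  then show ?R
  proof induction
    case Empty
    then show ?case by simp
  next
    case (Int a b)
    show ?case
    proof (intro conjI ballI)
      show "a \<inter> b \<subseteq> cone_over X UNIV" using Int.IH(1)[THEN conjunct1] by (rule le_infI1)
      fix c assume "c \<in> a \<inter> b"
      then have "c \<in> a" "c \<in> b" by blast+
      obtain p where p: "p\<in>polys X" "p c \<noteq> 0"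
          "\<forall>c'\<in>cone_over X UNIV. p c' \<noteq> 0 \<longrightarrow> c' \<in> a"
        using Int.IH(1)[THEN conjunct2, rule_format, OF \<open>c \<in> a\<close>] by blast
      obtain q where q: "q\<in>polys X" "q c \<noteq> 0"
          "\<forall>c'\<in>cone_over X UNIV. q c' \<noteq> 0 \<longrightarrow> c' \<in> b"
        using Int.IH(2)[THEN conjunct2, rule_format, OF \<open>c \<in> b\<close>] by blast
      obtain r where "r\<in>polys X" "\<And>c. r c \<noteq> 0 \<longleftrightarrow> p c \<noteq> 0 \<and> q c \<noteq> 0"
        using polynomial_function_prod_ne[OF p(1) q(1)] by blast
      then show "\<exists>p\<in>polys X. p c \<noteq> 0 \<and>
          (\<forall>c'\<in>cone_over X UNIV. p c' \<noteq> 0 \<longrightarrow> c' \<in> a \<inter> b)"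
        using p q by blast
    qed
  next
    case (UN K)
    show ?case
    proof (intro conjI ballI)
      show "\<Union>K \<subseteq> cone_over X UNIV" using UN.IH by blast
      fix c assume "c \<in> \<Union>K"
      then obtain k where k: "k \<in> K" "c \<in> k" by blast
      show "\<exists>p\<in>polys X. p c \<noteq> 0 \<and>
          (\<forall>c'\<in>cone_over X UNIV. p c' \<noteq> 0 \<longrightarrow> c' \<in> \<Union>K)"
        using UN.IH[OF k(1), THEN conjunct2, rule_format, OF k(2)] k(1) by blast
    qed
  next
    case (Basis s)
    then show ?case by auto
  qed
next
  assume R: ?R
  define D where "D p = {c \<in> cone_over X UNIV. p c \<noteq> 0}" for p :: "'c \<Rightarrow> complex"
  have S: "S = \<Union>{D p |p. p \<in> polys X \<and> D p \<subseteq> S}"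
  proof (intro equalityI subsetI)
    fix c assume c: "c \<in> S"
    then obtain p where p: "p\<in>polys X" "p c \<noteq> 0"
       "\<forall>c'\<in>cone_over X UNIV. p c' \<noteq> 0 \<longrightarrow> c' \<in> S" using R by blast
    then have "c \<in> D p" "D p \<subseteq> S" using R c by (auto simp: D_def)
    then show "c \<in> \<Union>{D p |p. p \<in> polys X \<and> D p \<subseteq> S}"
      using p(1) by blast
  qed blast
  have "openin (cone_topology X) (D p)" if "p \<in> polys X" for p
    unfolding cone_topology_def openin_topology_generated_by_iff
    by (rule generate_topology_on.Basis) (use that in \<open>auto simp: D_def\<close>)
  then have "openin (cone_topology X) (\<Union>{D p |p. p \<in> polys X \<and> D p \<subseteq> S})"
    by (intro openin_Union) blast
  then show ?L unfolding S[symmetric] .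
qed

lemma openin_zariski_iff:
  fixes X :: "('c, 'x) variety"
  shows "openin (zariski X) U \<longleftrightarrow> U \<subseteq> points X \<and>
     (\<forall>c\<in>cone_over X U. \<exists>p\<in>polys X. p c \<noteq> 0 \<and>
        (\<forall>c'\<in>cone_over X UNIV. p c' \<noteq> 0 \<longrightarrow> quot X c' \<in> U))"
proof -
  have sub: "cone_over X U \<subseteq> cone_over X UNIV" by (auto simp: cone_over_def)
  have "c \<in> cone_over X U \<longleftrightarrow> quot X c \<in> U" if "c \<in> cone_over X UNIV" for c
    using that by (auto simp: cone_over_def)
  then have "(\<forall>c'\<in>cone_over X UNIV. p c' \<noteq> 0 \<longrightarrow> c' \<in> cone_over X U) \<longleftrightarrow>
      (\<forall>c'\<in>cone_over X UNIV. p c' \<noteq> 0 \<longrightarrow> quot X c' \<in> U)" for p :: "'c \<Rightarrow> complex"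
    by blast
  note iff = this
  show ?thesis
    unfolding openin_zariski openin_cone_topology_iff iff using sub by simp
qed

lemma openin_zariski_points [simp, intro]: "openin (zariski X) (points X)"
  unfolding openin_zariski_iff
  by (auto simp: cone_over_def intro!: bexI[of _ "\<lambda>_. 1"] polynomial_functions.const)

lemma topspace_zariski [simp]: "topspace (zariski X) = points X"
  by (metis openin_subset openin_topspace openin_zariski openin_zariski_points subset_antisym)

lemma openin_zariski_subset: "openin (zariski X) U \<Longrightarrow> U \<subseteq> points X"
  by (simp add: openin_zariski)

text \<open>A set of functions that contains the constants and is closed under sums and products.
  Polynomial functions, the regular functions on a set, and the functions whose classes lie in a
  given subfield are all of this kind; closure under determinants is proved once for all of them.\<close>

definition function_algebra :: "('x \<Rightarrow> 'a::comm_ring_1) set \<Rightarrow> bool" where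
  "function_algebra S \<longleftrightarrow> (\<forall>a. (\<lambda>_. of_int a) \<in> S) \<and>
     (\<forall>f\<in>S. \<forall>g\<in>S. (\<lambda>x. f x + g x) \<in> S \<and> (\<lambda>x. f x * g x) \<in> S)"

lemma function_algebraD:
  assumes "function_algebra S"
  shows "(\<lambda>_. of_int a) \<in> S" and "(\<lambda>_. 0) \<in> S" and "(\<lambda>_. 1) \<in> S"
    and "f \<in> S \<Longrightarrow> g \<in> S \<Longrightarrow> (\<lambda>x. f x + g x) \<in> S"
    and "f \<in> S \<Longrightarrow> g \<in> S \<Longrightarrow> (\<lambda>x. f x * g x) \<in> S"
    and "f \<in> S \<Longrightarrow> (\<lambda>x. - f x) \<in> S"
    and "f \<in> S \<Longrightarrow> g \<in> S \<Longrightarrow> (\<lambda>x. f x - g x) \<in> S"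
proof -
  have c: "(\<lambda>_. of_int a) \<in> S" for a using assms by (auto simp: function_algebra_def)
  have a: "f \<in> S \<Longrightarrow> g \<in> S \<Longrightarrow> (\<lambda>x. f x + g x) \<in> S" for f g
    using assms by (auto simp: function_algebra_def)
  have m: "f \<in> S \<Longrightarrow> g \<in> S \<Longrightarrow> (\<lambda>x. f x * g x) \<in> S" for f g
    using assms by (auto simp: function_algebra_def)
  have n: "f \<in> S \<Longrightarrow> (\<lambda>x. - f x) \<in> S" for f using m[OF c[of "-1"], of f] by simp
  show "(\<lambda>_. of_int a) \<in> S" "(\<lambda>_. 0) \<in> S" "(\<lambda>_. 1) \<in> S"
    "f \<in> S \<Longrightarrow> g \<in> S \<Longrightarrow> (\<lambda>x. f x + g x) \<in> S"
    "f \<in> S \<Longrightarrow> g \<in> S \<Longrightarrow> (\<lambda>x. f x * g x) \<in> S" "f \<in> S \<Longrightarrow> (\<lambda>x. - f x) \<in> S"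
    "f \<in> S \<Longrightarrow> g \<in> S \<Longrightarrow> (\<lambda>x. f x - g x) \<in> S"
    using c c[of 0] c[of 1] a[of f g] a[of f "\<lambda>x. - g x"] m n by auto
qed

lemma function_algebra_sum:
  assumes "function_algebra S" "\<And>i. i \<in> I \<Longrightarrow> f i \<in> S"
  shows "(\<lambda>x. \<Sum>i\<in>I. f i x) \<in> S"
  using assms(2)
  by (induction I rule: infinite_finite_induct) (auto intro!: function_algebraD[OF assms(1)])

lemma function_algebra_prod:
  assumes "function_algebra S" "\<And>i. i \<in> I \<Longrightarrow> f i \<in> S"
  shows "(\<lambda>x. \<Prod>i\<in>I. f i x) \<in> S"
  using assms(2)
  by (induction I rule: infinite_finite_induct) (auto intro!: function_algebraD[OF assms(1)])

lemma function_algebra_polynomial_functions: "function_algebra (polynomial_functions \<Gamma>)"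
  by (auto simp: function_algebra_def intro: polynomial_functions.intros)

lemma regular_onI:
  assumes "\<And>c. c \<in> cone_over X U \<Longrightarrow> \<exists>p\<in>polys X.
    \<exists>q\<in>polys X. q c \<noteq> 0 \<and>
      (\<forall>c'\<in>cone_over X U. q c' \<noteq> 0 \<longrightarrow> g (quot X c') = p c' / q c')"
  shows "regular_on X U g"
  using assms unfolding regular_on_def by blast

lemma regular_onE:
  assumes "regular_on X U g" "c \<in> cone_over X U"
  obtains p q where "p \<in> polys X" "q \<in> polys X"
    "q c \<noteq> 0" "\<And>c'. c' \<in> cone_over X U \<Longrightarrow> q c' \<noteq> 0 \<Longrightarrow> g (quot X c') = p c' / q c'"
  using assms unfolding regular_on_def by blast

lemma regular_on_subset:
  assumes "regular_on X U g" "V \<subseteq> U"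
  shows "regular_on X V g"
proof (rule regular_onI)
  have sub: "cone_over X V \<subseteq> cone_over X U" using assms(2) by (auto simp: cone_over_def)
  fix c assume c: "c \<in> cone_over X V"
  obtain p q where "p \<in> polys X" "q \<in> polys X"
    "q c \<noteq> 0" "\<And>c'. c' \<in> cone_over X U \<Longrightarrow> q c' \<noteq> 0 \<Longrightarrow> g (quot X c') = p c' / q c'"
    using regular_onE[OF assms(1)] c sub by blast
  then show "\<exists>p\<in>polys X. \<exists>q\<in>polys X. q c \<noteq> 0 \<and>
      (\<forall>c'\<in>cone_over X V. q c' \<noteq> 0 \<longrightarrow> g (quot X c') = p c' / q c')"
    using sub by blast
qed

lemma regular_on_const [simp, intro]: "regular_on X U (\<lambda>_. a)"
  by (intro regular_onI bexI[of _ "\<lambda>_. a"] bexI[of _ "\<lambda>_. 1"]) (auto intro: polynomial_functions.const)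

lemma regular_on_Int:
  "regular_on X U g \<Longrightarrow> regular_on X (U \<inter> V) g" "regular_on X U g \<Longrightarrow> regular_on X (V \<inter> U) g"
  by (auto intro: regular_on_subset[of X U])

lemma regular_on_add:
  assumes "regular_on X U g" "regular_on X U h"
  shows "regular_on X U (\<lambda>x. g x + h x)"
proof (rule regular_onI)
  fix c assume c: "c \<in> cone_over X U"
  obtain p q where 1: "p \<in> polys X" "q \<in> polys X"
    "q c \<noteq> 0" "\<And>c'. c' \<in> cone_over X U \<Longrightarrow> q c' \<noteq> 0 \<Longrightarrow> g (quot X c') = p c' / q c'"
    using regular_onE[OF assms(1) c] by blast
  obtain p' q' where 2: "p' \<in> polys X" "q' \<in> polys X"
    "q' c \<noteq> 0" "\<And>c'. c' \<in> cone_over X U \<Longrightarrow> q' c' \<noteq> 0 \<Longrightarrow> h (quot X c') = p' c' / q' c'"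
    using regular_onE[OF assms(2) c] by blast
  show "\<exists>p\<in>polys X. \<exists>q\<in>polys X. q c \<noteq> 0 \<and>
      (\<forall>c'\<in>cone_over X U. q c' \<noteq> 0 \<longrightarrow> g (quot X c') + h (quot X c') = p c' / q c')"
    by (rule bexI[of _ "\<lambda>c. p c * q' c + p' c * q c"], rule bexI[of _ "\<lambda>c. q c * q' c"])
       (use 1 2 in \<open>auto intro!: polynomial_functions.add polynomial_functions.mult simp: field_simps\<close>)
qed

lemma regular_on_mult:
  assumes "regular_on X U g" "regular_on X U h"
  shows "regular_on X U (\<lambda>x. g x * h x)"
proof (rule regular_onI)
  fix c assume c: "c \<in> cone_over X U"
  obtain p q where 1: "p \<in> polys X" "q \<in> polys X"
    "q c \<noteq> 0" "\<And>c'. c' \<in> cone_over X U \<Longrightarrow> q c' \<noteq> 0 \<Longrightarrow> g (quot X c') = p c' / q c'"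
    using regular_onE[OF assms(1) c] by blast
  obtain p' q' where 2: "p' \<in> polys X" "q' \<in> polys X"
    "q' c \<noteq> 0" "\<And>c'. c' \<in> cone_over X U \<Longrightarrow> q' c' \<noteq> 0 \<Longrightarrow> h (quot X c') = p' c' / q' c'"
    using regular_onE[OF assms(2) c] by blast
  show "\<exists>p\<in>polys X. \<exists>q\<in>polys X. q c \<noteq> 0 \<and>
      (\<forall>c'\<in>cone_over X U. q c' \<noteq> 0 \<longrightarrow> g (quot X c') * h (quot X c') = p c' / q c')"
    by (rule bexI[of _ "\<lambda>c. p c * p' c"], rule bexI[of _ "\<lambda>c. q c * q' c"])
       (use 1 2 in \<open>auto intro!: polynomial_functions.add polynomial_functions.mult\<close>)
qed

lemma regular_on_inverse:
  assumes "regular_on X U g" "\<And>x. x \<in> U \<Longrightarrow> g x \<noteq> 0"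
  shows "regular_on X U (\<lambda>x. inverse (g x))"
proof (rule regular_onI)
  fix c assume c: "c \<in> cone_over X U"
  obtain p q where 1: "p \<in> polys X" "q \<in> polys X"
    "q c \<noteq> 0" "\<And>c'. c' \<in> cone_over X U \<Longrightarrow> q c' \<noteq> 0 \<Longrightarrow> g (quot X c') = p c' / q c'"
    using regular_onE[OF assms(1) c] by blast
  have "g (quot X c) \<noteq> 0" using assms(2) c by (auto simp: cone_over_def)
  then have "p c \<noteq> 0" using 1 c by fastforce
  then show "\<exists>p\<in>polys X. \<exists>q\<in>polys X. q c \<noteq> 0 \<and>
      (\<forall>c'\<in>cone_over X U. q c' \<noteq> 0 \<longrightarrow> inverse (g (quot X c')) = p c' / q c')"
    \<comment> \<open>The fraction \<open>q / p\<close> is expanded by \<open>q\<close>, so that the denominator also records where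
      the given presentation of \<open>g\<close> is valid.\<close>
    by (intro bexI[of _ "\<lambda>c. q c * q c"] bexI[of _ "\<lambda>c. p c * q c"])
       (use 1 in \<open>auto intro!: polynomial_functions.add polynomial_functions.mult\<close>)
qed

lemma function_algebra_regular_on: "function_algebra {g. regular_on X U g}"
  by (auto simp: function_algebra_def intro: regular_on_add regular_on_mult)

text \<open>If \<open>g = p / q\<close> near a point at which \<open>g\<close> does not vanish, then \<open>g\<close> vanishes nowhere on \<open>D(p q)\<close>.\<close>

lemma openin_regular_nonzero:
  assumes "openin (zariski X) U" "regular_on X U g"
  shows "openin (zariski X) {x \<in> U. g x \<noteq> 0}"
  unfolding openin_zariski_iff
proof (intro conjI ballI)
  show "{x \<in> U. g x \<noteq> 0} \<subseteq> points X" using openin_zariski_subset[OF assms(1)] by auto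
  fix c assume c: "c \<in> cone_over X {x \<in> U. g x \<noteq> 0}"
  then have cU: "c \<in> cone_over X U" and gc: "g (quot X c) \<noteq> 0" by (auto simp: cone_over_def)
  obtain p q where 1: "p \<in> polys X" "q \<in> polys X"
    "q c \<noteq> 0" "\<And>c'. c' \<in> cone_over X U \<Longrightarrow> q c' \<noteq> 0 \<Longrightarrow> g (quot X c') = p c' / q c'"
    using regular_onE[OF assms(2) cU] by blast
  obtain r where r: "r \<in> polys X" "r c \<noteq> 0"
    "\<forall>c'\<in>cone_over X UNIV. r c' \<noteq> 0 \<longrightarrow> quot X c' \<in> U"
    using assms(1) cU unfolding openin_zariski_iff by blast
  have "p c \<noteq> 0" using 1(3,4) cU gc by force
  moreover have "g (quot X c') \<noteq> 0 \<and> quot X c' \<in> U"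
    if "c' \<in> cone_over X UNIV" "r c' * (p c' * q c') \<noteq> 0" for c'
  proof -
    have "c' \<in> cone_over X U" using that r(3) by (auto simp: cone_over_def)
    then show ?thesis using 1(4)[of c'] that by (auto simp: cone_over_def)
  qed
  ultimately show "\<exists>p\<in>polys X. p c \<noteq> 0 \<and>
      (\<forall>c'\<in>cone_over X UNIV. p c' \<noteq> 0 \<longrightarrow> quot X c' \<in> {x \<in> U. g x \<noteq> 0})"
    by (intro bexI[of _ "\<lambda>c. r c * (p c * q c)"])
       (use 1 r in \<open>auto intro!: polynomial_functions.add polynomial_functions.mult\<close>)
qed

section \<open>The function field of an irreducible variety\<close>

locale irreducible =
  fixes X :: "('c, 'x) variety"
  assumes irr: "irreducible_variety X"
begin

lemma open_meet:
  "openin (zariski X) U \<Longrightarrow> openin (zariski X) V \<Longrightarrow> U \<noteq> {} \<Longrightarrow> V \<noteq> {} \<Longrightarrow> U \<inter> V \<noteq> {}"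
  using irr unfolding irreducible_variety_def by blast

text \<open>The set where two regular functions differ is open; if it were nonempty, irreducibility would make
  it meet the open set on which they agree.\<close>

lemma identity_principle:
  assumes "openin (zariski X) U" "regular_on X U g" "regular_on X U h"
    and "openin (zariski X) W" "W \<noteq> {}" "\<And>x. x \<in> W \<Longrightarrow> x \<in> U \<Longrightarrow> g x = h x" and "x \<in> U"
  shows "g x = h x"
proof (rule ccontr)
  assume "g x \<noteq> h x"
  have "regular_on X U (\<lambda>x. g x - h x)"
    using function_algebraD(7)[OF function_algebra_regular_on, of g X U h] assms by simp
  from openin_regular_nonzero[OF assms(1) this] open_meet[OF _ assms(4)]
  have "{x \<in> U. g x - h x \<noteq> 0} \<inter> W \<noteq> {}" using \<open>g x \<noteq> h x\<close> assms(5,7) by auto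
  then show False using assms(6) by auto
qed

lemma rational_reps_iff:
  "(U, g) \<in> rational_reps X \<longleftrightarrow> openin (zariski X) U \<and> U \<noteq> {} \<and> regular_on X U g"
  by (simp add: rational_reps_def)

lemma rational_reps_one: "(points X, \<lambda>_. a) \<in> rational_reps X"
  using irr by (auto simp: rational_reps_iff irreducible_variety_def)

lemma rational_reps_restrict:
  assumes "(U, g) \<in> rational_reps X" "openin (zariski X) V" "V \<noteq> {}" 
  shows "(U \<inter> V, g) \<in> rational_reps X" "(V \<inter> U, g) \<in> rational_reps X"
  using assms open_meet[of U V] unfolding rational_reps_iff
  by (auto intro: regular_on_Int)

lemma rational_reps_op:
  assumes "(U, g) \<in> rational_reps X" "(V, h) \<in> rational_reps X"
  shows "(U \<inter> V, \<lambda>x. g x + h x) \<in> rational_reps X" "(U \<inter> V, \<lambda>x. g x * h x) \<in> rational_reps X"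
  using rational_reps_restrict(1)[OF assms(1), of V] rational_reps_restrict(2)[OF assms(2), of U] assms
  unfolding rational_reps_iff by (auto intro: regular_on_add regular_on_mult)

text \<open>By the identity principle, the agreement on some open set that defines equality of rational functions
  is agreement on the whole common domain.\<close>

lemma rational_rel_iff:
  "((U, g), (V, h)) \<in> rational_rel X \<longleftrightarrow> (U, g) \<in> rational_reps X \<and> (V, h) \<in> rational_reps X \<and>
     (\<forall>x\<in>U \<inter> V. g x = h x)"
proof
  assume "((U, g), (V, h)) \<in> rational_rel X"
  then obtain W where W: "(U, g) \<in> rational_reps X" "(V, h) \<in> rational_reps X"
    "openin (zariski X) W" "W \<noteq> {}" "\<forall>x\<in>W. g x = h x"
    unfolding rational_rel_def by blast
  have "g x = h x" if "x \<in> U \<inter> V" for x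
    by (rule identity_principle[of "U \<inter> V" g h W])
       (use W that in \<open>auto simp: rational_reps_iff intro: regular_on_Int\<close>)
  then show "(U, g) \<in> rational_reps X \<and> (V, h) \<in> rational_reps X \<and> (\<forall>x\<in>U \<inter> V. g x = h x)"
    using W by blast
next
  assume "(U, g) \<in> rational_reps X \<and> (V, h) \<in> rational_reps X \<and> (\<forall>x\<in>U \<inter> V. g x = h x)"
  then show "((U, g), (V, h)) \<in> rational_rel X"
    unfolding rational_rel_def using open_meet[of U V]
    by (auto simp: rational_reps_iff intro!: exI[of _ "U \<inter> V"])
qed

lemma equiv_rational_rel: "equiv (rational_reps X) (rational_rel X)"
proof (rule equivI)
  show "rational_rel X \<subseteq> rational_reps X \<times> rational_reps X" by (auto simp: rational_rel_def)
  show "refl_on (rational_reps X) (rational_rel X)"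
    by (rule refl_onI) (auto simp: rational_rel_iff split: prod.splits)
  show "sym (rational_rel X)"
    by (rule symI) (auto simp: rational_rel_iff split: prod.splits)
  show "trans (rational_rel X)"
  proof (rule transI)
    fix a b c assume *: "(a, b) \<in> rational_rel X" "(b, c) \<in> rational_rel X"
    obtain U g V h W k where [simp]: "a = (U, g)" "b = (V, h)" "c = (W, k)"
      by (metis surj_pair)
    have reps: "(U, g) \<in> rational_reps X" "(V, h) \<in> rational_reps X" "(W, k) \<in> rational_reps X"
      and eq: "\<forall>x\<in>U \<inter> V. g x = h x" "\<forall>x\<in>V \<inter> W. h x = k x"
      using * by (simp_all add: rational_rel_iff)
    have "g x = k x" if "x \<in> U \<inter> W" for x
      by (rule identity_principle[of "U \<inter> W" g k "U \<inter> V \<inter> W"])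
         (use reps eq that open_meet[of "U \<inter> V" W] open_meet[of U V] in
           \<open>auto simp: rational_reps_iff intro: regular_on_Int\<close>)
    then show "(a, c) \<in> rational_rel X" using reps by (simp add: rational_rel_iff)
  qed
qed

lemma class_eq_iff:
  assumes "(U, g) \<in> rational_reps X" "(V, h) \<in> rational_reps X"
  shows "rational_class X U g = rational_class X V h \<longleftrightarrow> (\<forall>x\<in>U \<inter> V. g x = h x)"
  unfolding rational_class_def
  using eq_equiv_class_iff[OF equiv_rational_rel assms] assms by (simp add: rational_rel_iff)

lemma class_eqI:
  assumes "(U, g) \<in> rational_reps X" "(V, h) \<in> rational_reps X"
    and "openin (zariski X) W" "W \<noteq> {}" "\<And>x. x \<in> W \<Longrightarrow> x \<in> U \<Longrightarrow> x \<in> V \<Longrightarrow> g x = h x"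
  shows "rational_class X U g = rational_class X V h"
  unfolding class_eq_iff[OF assms(1,2)]
proof
  fix x assume x: "x \<in> U \<inter> V"
  show "g x = h x"
    by (rule identity_principle[of "U \<inter> V" g h W])
       (use assms x in \<open>auto simp: rational_reps_iff intro: regular_on_Int\<close>)
qed

lemma class_in_carrier:
  "(U, g) \<in> rational_reps X \<Longrightarrow> rational_class X U g \<in> carrier (function_field X)"
  unfolding function_field_def rational_class_def by (auto intro: quotientI)

lemma carrierE:
  assumes "a \<in> carrier (function_field X)"
  obtains U g where "(U, g) \<in> rational_reps X" "a = rational_class X U g"
proof -
  have "a \<in> rational_reps X // rational_rel X" using assms by (simp add: function_field_def)
  then obtain x where "x \<in> rational_reps X" "a = rational_rel X `` {x}" by (rule quotientE)
  then show ?thesis using that[of "fst x" "snd x"] by (simp add: rational_class_def)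
qed

lemma in_class_iff:
  "(U', g') \<in> rational_class X U g \<longleftrightarrow> (U, g) \<in> rational_reps X \<and> (U', g') \<in> rational_reps X \<and>
     rational_class X U' g' = rational_class X U g"
  unfolding rational_class_def
  unfolding Image_singleton_iff equiv_class_eq_iff[OF equiv_rational_rel] by auto

lemma Union_constant:
  assumes "a \<in> A" "\<And>x. x \<in> A \<Longrightarrow> F x = c"
  shows "(\<Union>x\<in>A. F x) = c"
  using assms by blast

text \<open>The operations of the function field are unions over representatives; they can be computed with
  any representatives as soon as the result does not depend on the choice.\<close>

lemma Union_class2:
  assumes "(U, g) \<in> rational_reps X" "(V, h) \<in> rational_reps X"
    and "\<And>U' g' V' h'. (U', g') \<in> rational_class X U g \<Longrightarrow> (V', h') \<in> rational_class X V h \<Longrightarrow>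
      F U' g' V' h' = F U g V h"
  shows "(\<Union>(U, g)\<in>rational_class X U g. \<Union>(V, h)\<in>rational_class X V h. F U g V h) = F U g V h"
proof -
  have g: "(U, g) \<in> rational_class X U g" and h: "(V, h) \<in> rational_class X V h"
    using assms(1,2) by (simp_all add: in_class_iff)
  have "(\<Union>(V, h)\<in>rational_class X V h. F U' g' V h) = F U g V h"
    if "(U', g') \<in> rational_class X U g" for U' g'
    by (rule Union_constant[OF h]) (clarsimp simp: assms(3)[OF that])
  then show ?thesis by (intro Union_constant[OF g]) clarsimp
qed

lemma class_op:
  assumes F: "\<And>U g V h. (U, g) \<in> rational_reps X \<Longrightarrow> (V, h) \<in> rational_reps X \<Longrightarrow>
      (U \<inter> V, \<lambda>x. F (g x) (h x)) \<in> rational_reps X"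
    and r: "(U, g) \<in> rational_reps X" "(V, h) \<in> rational_reps X"
  shows "(\<Union>(U, g)\<in>rational_class X U g. \<Union>(V, h)\<in>rational_class X V h.
      rational_class X (U \<inter> V) (\<lambda>x. F (g x) (h x))) = rational_class X (U \<inter> V) (\<lambda>x. F (g x) (h x))"
proof (rule Union_class2[OF r])
  fix U' g' V' h' assume "(U', g') \<in> rational_class X U g" "(V', h') \<in> rational_class X V h"
  then have r': "(U', g') \<in> rational_reps X" "(V', h') \<in> rational_reps X"
    and e: "\<forall>x\<in>U' \<inter> U. g' x = g x" "\<forall>x\<in>V' \<inter> V. h' x = h x"
    unfolding in_class_iff by (auto simp: class_eq_iff)
  show "rational_class X (U' \<inter> V') (\<lambda>x. F (g' x) (h' x)) = rational_class X (U \<inter> V) (\<lambda>x. F (g x) (h x))"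
    using class_eq_iff[OF F[OF r'] F[OF r]] e by auto
qed

lemma class_mult:
  assumes "(U, g) \<in> rational_reps X" "(V, h) \<in> rational_reps X"
  shows "rational_class X U g \<otimes>\<^bsub>function_field X\<^esub> rational_class X V h
    = rational_class X (U \<inter> V) (\<lambda>x. g x * h x)"
proof -
  have "rational_class X U g \<otimes>\<^bsub>function_field X\<^esub> rational_class X V h
    = (\<Union>(U, g)\<in>rational_class X U g. \<Union>(V, h)\<in>rational_class X V h.
         rational_class X (U \<inter> V) (\<lambda>x. g x * h x))"
    by (simp add: function_field_def)
  then show ?thesis using class_op[of "(*)", OF rational_reps_op(2) assms] by (rule trans)
qed

lemma class_add:
  assumes "(U, g) \<in> rational_reps X" "(V, h) \<in> rational_reps X"
  shows "rational_class X U g \<oplus>\<^bsub>function_field X\<^esub> rational_class X V h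
    = rational_class X (U \<inter> V) (\<lambda>x. g x + h x)"
proof -
  have "rational_class X U g \<oplus>\<^bsub>function_field X\<^esub> rational_class X V h
    = (\<Union>(U, g)\<in>rational_class X U g. \<Union>(V, h)\<in>rational_class X V h.
         rational_class X (U \<inter> V) (\<lambda>x. g x + h x))"
    by (simp add: function_field_def)
  then show ?thesis using class_op[of "(+)", OF rational_reps_op(1) assms] by (rule trans)
qed

lemma one_function_field: "\<one>\<^bsub>function_field X\<^esub> = rational_class X (points X) (\<lambda>_. 1)"
  and zero_function_field: "\<zero>\<^bsub>function_field X\<^esub> = rational_class X (points X) (\<lambda>_. 0)"
  by (simp_all add: function_field_def)

lemma class_zero_iff:
  assumes "(U, g) \<in> rational_reps X"
  shows "rational_class X U g = \<zero>\<^bsub>function_field X\<^esub> \<longleftrightarrow> (\<forall>x\<in>U. g x = 0)"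
  using class_eq_iff[OF assms rational_reps_one, of 0] assms
  unfolding zero_function_field rational_reps_iff by (metis inf.orderE openin_zariski_subset)

lemma Int_points:
  assumes "(U, g) \<in> rational_reps X"
  shows "U \<inter> points X = U" "points X \<inter> U = U"
  using assms unfolding rational_reps_iff by (auto dest: openin_zariski_subset)

lemma uminus_rep:
  assumes "(U, g) \<in> rational_reps X"
  shows "(U, \<lambda>x. - g x) \<in> rational_reps X"
  using assms function_algebraD(6)[OF function_algebra_regular_on, of g X U]
  unfolding rational_reps_iff by auto

lemma inverse_rep:
  assumes "(U, g) \<in> rational_reps X" "rational_class X U g \<noteq> \<zero>\<^bsub>function_field X\<^esub>"
  shows "({x\<in>U. g x \<noteq> 0}, \<lambda>x. inverse (g x)) \<in> rational_reps X"
  using assms unfolding class_zero_iff[OF assms(1)] rational_reps_iff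
  by (auto intro!: openin_regular_nonzero regular_on_inverse intro: regular_on_subset[of X U])

lemma cring_function_field: "cring (function_field X)"
proof (rule cringI)
  let ?F = "function_field X"
  note ops = class_mult class_add rational_reps_op class_in_carrier rational_reps_one
    one_function_field zero_function_field
  show "abelian_group ?F"
  proof (rule abelian_groupI)
    fix a b c assume "a \<in> carrier ?F" "b \<in> carrier ?F" "c \<in> carrier ?F"
    then obtain U g V h W k where r: "(U, g) \<in> rational_reps X" "(V, h) \<in> rational_reps X"
      "(W, k) \<in> rational_reps X" and e: "a = rational_class X U g" "b = rational_class X V h"
      "c = rational_class X W k" by (metis carrierE)
    show "a \<oplus>\<^bsub>?F\<^esub> b \<in> carrier ?F" using r by (simp add: e ops)
    show "a \<oplus>\<^bsub>?F\<^esub> b \<oplus>\<^bsub>?F\<^esub> c = a \<oplus>\<^bsub>?F\<^esub> (b \<oplus>\<^bsub>?F\<^esub> c)"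
      using r by (simp add: e ops Int_assoc add.assoc)
    show "a \<oplus>\<^bsub>?F\<^esub> b = b \<oplus>\<^bsub>?F\<^esub> a" using r by (simp add: e ops Int_commute add.commute)
    show "\<zero>\<^bsub>?F\<^esub> \<oplus>\<^bsub>?F\<^esub> a = a"
      using r by (simp add: e ops Int_points)
    show "\<exists>y\<in>carrier ?F. y \<oplus>\<^bsub>?F\<^esub> a = \<zero>\<^bsub>?F\<^esub>"
    proof (rule bexI)
      show "rational_class X U (\<lambda>x. - g x) \<oplus>\<^bsub>?F\<^esub> a = \<zero>\<^bsub>?F\<^esub>"
        unfolding e class_add[OF uminus_rep[OF r(1)] r(1)]
        using class_zero_iff[OF rational_reps_op(1)[OF uminus_rep[OF r(1)] r(1)]] by simp
    qed (intro class_in_carrier uminus_rep r)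
  qed (simp add: ops)
  show "comm_monoid ?F"
  proof (rule comm_monoidI)
    fix a b c assume "a \<in> carrier ?F" "b \<in> carrier ?F" "c \<in> carrier ?F"
    then obtain U g V h W k where r: "(U, g) \<in> rational_reps X" "(V, h) \<in> rational_reps X"
      "(W, k) \<in> rational_reps X" and e: "a = rational_class X U g" "b = rational_class X V h"
      "c = rational_class X W k" by (metis carrierE)
    show "a \<otimes>\<^bsub>?F\<^esub> b \<in> carrier ?F" using r by (simp add: e ops)
    show "a \<otimes>\<^bsub>?F\<^esub> b \<otimes>\<^bsub>?F\<^esub> c = a \<otimes>\<^bsub>?F\<^esub> (b \<otimes>\<^bsub>?F\<^esub> c)"
      using r by (simp add: e ops Int_assoc mult.assoc)
    show "a \<otimes>\<^bsub>?F\<^esub> b = b \<otimes>\<^bsub>?F\<^esub> a" using r by (simp add: e ops Int_commute mult.commute)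
    show "\<one>\<^bsub>?F\<^esub> \<otimes>\<^bsub>?F\<^esub> a = a"
      using r by (simp add: e ops Int_points)
  qed (simp add: ops)
  fix a b c assume "a \<in> carrier ?F" "b \<in> carrier ?F" "c \<in> carrier ?F"
  then obtain U g V h W k where r: "(U, g) \<in> rational_reps X" "(V, h) \<in> rational_reps X"
    "(W, k) \<in> rational_reps X" and e: "a = rational_class X U g" "b = rational_class X V h"
    "c = rational_class X W k" by (metis carrierE)
  show "(a \<oplus>\<^bsub>?F\<^esub> b) \<otimes>\<^bsub>?F\<^esub> c = a \<otimes>\<^bsub>?F\<^esub> c \<oplus>\<^bsub>?F\<^esub> b \<otimes>\<^bsub>?F\<^esub> c"
  proof -
    have "U \<inter> V \<inter> W = U \<inter> W \<inter> (V \<inter> W)" by blast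
    then show ?thesis using r by (simp add: e ops distrib_right)
  qed
qed

lemma field_function_field: "field (function_field X)"
proof (rule cring.cring_fieldI2[OF cring_function_field])
  let ?F = "function_field X"
  have "points X \<noteq> {}" using irr by (simp add: irreducible_variety_def)
  then show "\<zero>\<^bsub>?F\<^esub> \<noteq> \<one>\<^bsub>?F\<^esub>"
    using class_zero_iff[OF rational_reps_one, of 1] by (auto simp: one_function_field)
  fix a assume "a \<in> carrier ?F" "a \<noteq> \<zero>\<^bsub>?F\<^esub>"
  then obtain U g where r: "(U, g) \<in> rational_reps X" and e: "a = rational_class X U g"
    by (metis carrierE)
  have i: "({x\<in>U. g x \<noteq> 0}, \<lambda>x. inverse (g x)) \<in> rational_reps X"
    using inverse_rep[OF r] \<open>a \<noteq> \<zero>\<^bsub>?F\<^esub>\<close> by (simp add: e)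
  have "a \<otimes>\<^bsub>?F\<^esub> rational_class X {x\<in>U. g x \<noteq> 0} (\<lambda>x. inverse (g x)) = \<one>\<^bsub>?F\<^esub>"
    unfolding e class_mult[OF r i] one_function_field
    using class_eq_iff[OF rational_reps_op(2)[OF r i] rational_reps_one] by simp
  then show "\<exists>b\<in>carrier ?F. a \<otimes>\<^bsub>?F\<^esub> b = \<one>\<^bsub>?F\<^esub>"
    using class_in_carrier[OF i] by blast
qed

end

text \<open>Irreducibility can be tested on the cone, provided that every point has homogeneous coordinates:
  then a nonempty open set of points contains the image of some nonempty \<open>D(p)\<close>.\<close>

lemma irreducible_varietyI:
  assumes "points X \<noteq> {}" "points X \<subseteq> quot X ` ambient X"
    and "\<And>c0 c1 p0 p1. c0 \<in> cone_over X UNIV \<Longrightarrow> c1 \<in> cone_over X UNIV \<Longrightarrow>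
       p0 \<in> polys X \<Longrightarrow> p1 \<in> polys X \<Longrightarrow>
       p0 c0 \<noteq> 0 \<Longrightarrow> p1 c1 \<noteq> 0 \<Longrightarrow> \<exists>c\<in>cone_over X UNIV. p0 c \<noteq> 0 \<and> p1 c \<noteq> 0"
  shows "irreducible_variety X"
  unfolding irreducible_variety_def
proof (intro conjI allI impI)
  fix U V assume *: "openin (zariski X) U \<and> openin (zariski X) V \<and> U \<noteq> {} \<and> V \<noteq> {}"
  have "\<exists>p. p \<in> polys X \<and> (\<exists>c\<in>cone_over X UNIV. p c \<noteq> 0) \<and>
      (\<forall>c\<in>cone_over X UNIV. p c \<noteq> 0 \<longrightarrow> quot X c \<in> W)"
    if W: "openin (zariski X) W" "W \<noteq> {}" for W
  proof -
    obtain x where "x \<in> W" using W by blast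
    then obtain c where "c \<in> ambient X" "quot X c = x"
      using assms(2) openin_zariski_subset[OF W(1)] by blast
    then have "c \<in> cone_over X W" "c \<in> cone_over X UNIV"
      using openin_zariski_subset[OF W(1)] \<open>x \<in> W\<close> by (auto simp: cone_over_def)
    then show ?thesis using W(1) unfolding openin_zariski_iff by blast
  qed
  note basic = this
  obtain p0 c0 where
    p0: "p0 \<in> polys X" "c0\<in>cone_over X UNIV" "p0 c0 \<noteq> 0"
      "\<forall>c\<in>cone_over X UNIV. p0 c \<noteq> 0 \<longrightarrow> quot X c \<in> U"
    using basic[of U] * by blast
  obtain p1 c1 where
    p1: "p1 \<in> polys X" "c1\<in>cone_over X UNIV" "p1 c1 \<noteq> 0"
      "\<forall>c\<in>cone_over X UNIV. p1 c \<noteq> 0 \<longrightarrow> quot X c \<in> V"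
    using basic[of V] * by blast
  show "U \<inter> V \<noteq> {}" using assms(3)[OF p0(2) p1(2) p0(1) p1(1) p0(3) p1(3)] p0(4) p1(4) by blast
qed fact

text \<open>Evaluation of a list of coefficients, leading coefficient first, by the same recursion as for
  polynomials over a ring with carrier; this makes \<open>class_eval_on\<close> below a direct induction.\<close>

fun peval :: "complex list \<Rightarrow> complex \<Rightarrow> complex" where
  "peval [] t = 0"
| "peval (a # as) t = a * t ^ length as + peval as t"

text \<open>The leading coefficient is split off, so that the polynomial is visibly nonzero and its degree is at
  most the length of the remaining list.\<close>

lemma peval_monic_roots:
  assumes "\<And>t. t \<in> T \<Longrightarrow> peval (1 # as) t = 0"
  shows "card T \<le> length as"
proof -
  have "\<exists>p. (\<forall>t. poly p t = peval as t) \<and> (\<forall>i\<ge>length as. coeff p i = 0)" for as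
  proof (induction as)
    case (Cons a as)
    then obtain p where "\<forall>t. poly p t = peval as t" "\<forall>i\<ge>length as. coeff p i = 0" by blast
    then show ?case
      by (intro exI[of _ "Polynomial.monom a (length as) + p"]) (auto simp: poly_monom)
  qed (auto intro: exI[of _ 0])
  then obtain p where p: "\<And>t. poly p t = peval as t" "\<And>i. i \<ge> length as \<Longrightarrow> coeff p i = 0" by metis
  define r where "r = Polynomial.monom 1 (length as) + p"
  have "coeff r (length as) = 1" by (simp add: r_def p(2))
  then have "r \<noteq> 0" by auto
  have "Polynomial.degree r \<le> length as"
    by (rule degree_le) (auto simp: r_def p(2))
  moreover have "T \<subseteq> {t. poly r t = 0}"
    using assms by (auto simp: r_def poly_monom p(1))
  then have "card T \<le> card {t. poly r t = 0}"
    by (rule card_mono[OF poly_roots_finite[OF \<open>r \<noteq> 0\<close>]])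
  moreover have "card {t. poly r t = 0} \<le> Polynomial.degree r"
    by (rule poly_roots_degree[OF \<open>r \<noteq> 0\<close>])
  ultimately show ?thesis by linarith
qed

lemma peval_sum: "peval (map c (rev [0..<m])) t = (\<Sum>i<m. c i * t ^ i)"
  by (induction m) (simp_all add: add.commute)

context irreducible
begin

lemma class_restrict:
  assumes "(U, g) \<in> rational_reps X" "openin (zariski X) W" "W \<noteq> {}" "W \<subseteq> U"
  shows "rational_class X U g = rational_class X W g"
  by (rule class_eqI[where W = W])
     (use assms in \<open>auto simp: rational_reps_iff intro: regular_on_subset[of X U]\<close>)

text \<open>Rational functions that are regular on a common open set are added, multiplied and
  substituted into polynomials pointwise.\<close>

context
  fixes W assumes W: "openin (zariski X) W" "W \<noteq> {}"
begin

lemma class_add_on: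
  assumes "regular_on X W g" "regular_on X W h"
  shows "rational_class X W g \<oplus>\<^bsub>function_field X\<^esub> rational_class X W h = rational_class X W (\<lambda>x. g x + h x)"
  using class_add[of W g W h] assms W by (simp add: rational_reps_iff)

lemma class_mult_on:
  assumes "regular_on X W g" "regular_on X W h"
  shows "rational_class X W g \<otimes>\<^bsub>function_field X\<^esub> rational_class X W h = rational_class X W (\<lambda>x. g x * h x)"
  using class_mult[of W g W h] assms W by (simp add: rational_reps_iff)

lemma class_const_on: "rational_class X W (\<lambda>_. a) = rational_class X (points X) (\<lambda>_. a)"
  by (rule class_restrict[symmetric]) (use W openin_zariski_subset[OF W(1)] rational_reps_one in auto)

lemma regular_on_power: "regular_on X W g \<Longrightarrow> regular_on X W (\<lambda>x. g x ^ k)"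
  by (induction k) (auto intro: regular_on_mult)

lemma class_power_on:
  fixes k :: nat
  assumes "regular_on X W g"
  shows "rational_class X W g [^]\<^bsub>function_field X\<^esub> k = rational_class X W (\<lambda>x. g x ^ k)"
proof -
  interpret L: field "function_field X" by (rule field_function_field)
  show ?thesis
  proof (induction k)
    case 0
    then show ?case by (simp add: one_function_field class_const_on)
  next
    case (Suc k)
    then show ?case
      using class_mult_on[OF regular_on_power[OF assms, of k] assms] by (simp add: mult.commute)
  qed
qed

lemma regular_on_peval:
  assumes "\<And>g. g \<in> set gs \<Longrightarrow> regular_on X W g" "regular_on X W t"
  shows "regular_on X W (\<lambda>x. peval (map (\<lambda>g. g x) gs) (t x))"
  using assms(1)
  by (induction gs) (auto intro!: regular_on_add regular_on_mult regular_on_power assms(2))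

lemma class_eval_on:
  assumes "\<And>g. g \<in> set gs \<Longrightarrow> regular_on X W g" "regular_on X W t"
  shows "ring.eval (function_field X) (map (rational_class X W) gs) (rational_class X W t)
    = rational_class X W (\<lambda>x. peval (map (\<lambda>g. g x) gs) (t x))"
proof -
  interpret L: field "function_field X" by (rule field_function_field)
  show ?thesis
    using assms(1)
  proof (induction gs)
    case Nil
    then show ?case by (simp add: zero_function_field class_const_on)
  next
    case (Cons g gs)
    then show ?case
      by (simp add: class_power_on[OF assms(2)] class_mult_on regular_on_power[OF assms(2)]
          class_add_on regular_on_mult regular_on_peval[OF _ assms(2)])
  qed
qed

end

end

section \<open>Pullback along a surjective morphism\<close>

locale surjective_morphism = X: irreducible X + Y: irreducible Y
  for X :: "('c, 'x) variety" and Y :: "('e, 'y) variety" +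
  fixes \<phi> :: "'x \<Rightarrow> 'y"
  assumes morph: "morphism X Y \<phi>" and surj: "\<phi> ` points X = points Y"
begin

lemma preimage_rep:
  assumes "(V, h) \<in> rational_reps Y"
  shows "({x \<in> points X. \<phi> x \<in> V}, h \<circ> \<phi>) \<in> rational_reps X"
proof -
  have V: "openin (zariski Y) V" "V \<noteq> {}" "regular_on Y V h"
    using assms by (simp_all add: Y.rational_reps_iff)
  have "openin (zariski X) {x \<in> points X. \<phi> x \<in> V}"
    using morph V unfolding morphism_def continuous_map_def by simp
  moreover obtain y where "y \<in> V" using V(2) by blast
  then have "y \<in> \<phi> ` points X" using surj openin_zariski_subset[OF V(1)] by blast
  then have "{x \<in> points X. \<phi> x \<in> V} \<noteq> {}" using \<open>y \<in> V\<close> by blast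
  moreover have "regular_on X {x \<in> points X. \<phi> x \<in> V} (h \<circ> \<phi>)"
    using morph V unfolding morphism_def by blast
  ultimately show ?thesis by (simp add: X.rational_reps_iff)
qed

lemma pullback_class:
  assumes "(V, h) \<in> rational_reps Y"
  shows "pullback X \<phi> (rational_class Y V h) = rational_class X {x \<in> points X. \<phi> x \<in> V} (h \<circ> \<phi>)"
proof -
  have "rational_class X {x \<in> points X. \<phi> x \<in> V'} (h' \<circ> \<phi>)
      = rational_class X {x \<in> points X. \<phi> x \<in> V} (h \<circ> \<phi>)"
    if "(V', h') \<in> rational_class Y V h" for V' h'
  proof -
    have r: "(V', h') \<in> rational_reps Y" and e: "\<forall>x\<in>V' \<inter> V. h' x = h x"
      using that assms unfolding Y.in_class_iff by (auto simp: Y.class_eq_iff)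
    show ?thesis
      using X.class_eq_iff[OF preimage_rep[OF r] preimage_rep[OF assms]] e by auto
  qed
  note same = this
  show ?thesis
    unfolding pullback_def
  proof (rule X.Union_constant)
    show "(V, h) \<in> rational_class Y V h" using assms by (simp add: Y.in_class_iff)
    fix x assume x: "x \<in> rational_class Y V h"
    obtain V' h' where "x = (V', h')" by (cases x)
    then show "(case x of (V, h) \<Rightarrow> rational_class X {x \<in> points X. \<phi> x \<in> V} (h \<circ> \<phi>)) =
        rational_class X {x \<in> points X. \<phi> x \<in> V} (h \<circ> \<phi>)"
      using same x by simp
  qed
qed

lemma pullback_ring_hom: "ring_hom_ring (function_field Y) (function_field X) (pullback X \<phi>)"
proof (rule ring_hom_ringI)
  show "ring (function_field Y)" "ring (function_field X)"
    using X.cring_function_field Y.cring_function_field cring.axioms(1) by blast+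
  have pre_Int: "{x \<in> points X. \<phi> x \<in> U \<inter> V} = {x \<in> points X. \<phi> x \<in> U} \<inter> {x \<in> points X. \<phi> x \<in> V}"
    for U V by blast
  fix a assume "a \<in> carrier (function_field Y)"
  then obtain U g where a: "(U, g) \<in> rational_reps Y" "a = rational_class Y U g"
    by (metis Y.carrierE)
  show "pullback X \<phi> a \<in> carrier (function_field X)"
    using a by (simp add: pullback_class X.class_in_carrier preimage_rep)
  fix b assume "b \<in> carrier (function_field Y)"
  then obtain V h where b: "(V, h) \<in> rational_reps Y" "b = rational_class Y V h"
    by (metis Y.carrierE)
  show "pullback X \<phi> (a \<otimes>\<^bsub>function_field Y\<^esub> b)
      = pullback X \<phi> a \<otimes>\<^bsub>function_field X\<^esub> pullback X \<phi> b"
    unfolding a(2) b(2) Y.class_mult[OF a(1) b(1)] pullback_class[OF a(1)] pullback_class[OF b(1)]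
      pullback_class[OF Y.rational_reps_op(2)[OF a(1) b(1)]]
      X.class_mult[OF preimage_rep[OF a(1)] preimage_rep[OF b(1)]] pre_Int
    by (simp add: comp_def)
  show "pullback X \<phi> (a \<oplus>\<^bsub>function_field Y\<^esub> b)
      = pullback X \<phi> a \<oplus>\<^bsub>function_field X\<^esub> pullback X \<phi> b"
    unfolding a(2) b(2) Y.class_add[OF a(1) b(1)] pullback_class[OF a(1)] pullback_class[OF b(1)]
      pullback_class[OF Y.rational_reps_op(1)[OF a(1) b(1)]]
      X.class_add[OF preimage_rep[OF a(1)] preimage_rep[OF b(1)]] pre_Int
    by (simp add: comp_def)
next
  have "{x \<in> points X. \<phi> x \<in> points Y} = points X" using surj by blast
  then show "pullback X \<phi> \<one>\<^bsub>function_field Y\<^esub> = \<one>\<^bsub>function_field X\<^esub>"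
    by (simp add: X.one_function_field Y.one_function_field pullback_class Y.rational_reps_one comp_def)
qed

lemma subfield_pullback:
  "subfield (pullback X \<phi> ` carrier (function_field Y)) (function_field X)"
proof -
  interpret FX: field "function_field X" by (rule X.field_function_field)
  interpret FY: field "function_field Y" by (rule Y.field_function_field)
  interpret h: ring_hom_ring "function_field Y" "function_field X" "pullback X \<phi>"
    by (rule pullback_ring_hom)
  show ?thesis
    by (rule h.img_is_subfield(2)[OF FY.carrier_is_subfield]) (use FX.one_not_zero in simp)
qed

end

section \<open>Determinants, and polynomials in one variable\<close>

text \<open>By the Leibniz formula a determinant is a polynomial with integer coefficients in the entries.\<close>

lemma function_algebra_det:
  fixes M :: "'x \<Rightarrow> 'a::comm_ring_1 mat"
  assumes S: "function_algebra S" and M: "\<And>x. M x \<in> carrier_mat k k"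
    and e: "\<And>i j. i < k \<Longrightarrow> j < k \<Longrightarrow> (\<lambda>x. M x $$ (i, j)) \<in> S"
  shows "(\<lambda>x. det (M x)) \<in> S"
  unfolding det_def'[OF M]
proof (rule function_algebra_sum[OF S], rule function_algebraD(5)[OF S])
  fix p assume "p \<in> {p. p permutes {0..<k}}"
  then have "p i < k" if "i < k" for i using that permutes_in_image[of p "{0..<k}" i] by auto
  then show "(\<lambda>x. \<Prod>i = 0..<k. M x $$ (i, p i)) \<in> S"
    by (intro function_algebra_prod[OF S] e) auto
qed (rule function_algebraD(1)[OF S])

lemma function_algebra_char_poly:
  fixes M :: "'x \<Rightarrow> 'a::comm_ring_1 mat"
  assumes S: "function_algebra S" and M: "\<And>x. M x \<in> carrier_mat k k"
    and X: "(\<lambda>_. [:0, 1:]) \<in> S"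
    and e: "\<And>i j. i < k \<Longrightarrow> j < k \<Longrightarrow> (\<lambda>x. [:M x $$ (i, j):]) \<in> S"
  shows "(\<lambda>x. char_poly (M x)) \<in> S"
  unfolding char_poly_def
proof (rule function_algebra_det[OF S])
  show "char_poly_matrix (M x) \<in> carrier_mat k k" for x using M[of x] by simp
  fix i j assume ij: "i < k" "j < k"
  have "(\<lambda>x. char_poly_matrix (M x) $$ (i, j)) = (\<lambda>x. (if i = j then [:0, 1:] else 0) - [:M x $$ (i, j):])"
    using ij by (simp add: char_poly_matrix_def carrier_matD[OF M] fun_eq_iff)
  also have "\<dots> \<in> S"
    by (rule function_algebraD(7)[OF S]) (use X e[OF ij] function_algebraD(2)[OF S] in \<open>cases "i = j"; simp\<close>)+
  finally show "(\<lambda>x. char_poly_matrix (M x) $$ (i, j)) \<in> S" .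
qed

definition polyfuns :: "(complex \<Rightarrow> complex) set" where
  "polyfuns = range poly"

lemma function_algebra_polyfuns: "function_algebra polyfuns"
proof -
  have "(\<lambda>_. of_int a) \<in> polyfuns" for a
    unfolding polyfuns_def by (rule range_eqI[of _ _ "[:of_int a:]"]) (simp add: fun_eq_iff)
  moreover have "(\<lambda>x. poly p x + poly q x) \<in> polyfuns" "(\<lambda>x. poly p x * poly q x) \<in> polyfuns" for p q
    unfolding polyfuns_def by (rule range_eqI[of _ _ "p + q"], simp add: fun_eq_iff)
      (rule range_eqI[of _ _ "p * q"], simp add: fun_eq_iff)
  ultimately show ?thesis unfolding function_algebra_def by (auto simp: polyfuns_def)
qed

lemma polyfuns_const: "(\<lambda>_. a) \<in> polyfuns" and polyfuns_id: "(\<lambda>z. z) \<in> polyfuns"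
  unfolding polyfuns_def
  by (rule range_eqI[of _ _ "[:a:]"], simp add: fun_eq_iff)
     (rule range_eqI[of _ _ "[:0, 1:]"], simp add: fun_eq_iff)

lemmas polyfuns_intros = polyfuns_const polyfuns_id function_algebraD(4-7)[OF function_algebra_polyfuns]
  function_algebra_sum[OF function_algebra_polyfuns]

text \<open>A nonzero polynomial has finitely many roots, so it has none in a punctured neighbourhood of any
  point.\<close>

lemma polyfuns_eventually:
  assumes "h \<in> polyfuns" "h a \<noteq> 0"
  shows "eventually (\<lambda>z. h z \<noteq> 0) (at b)"
proof -
  obtain p where p: "h = poly p" using assms(1) by (auto simp: polyfuns_def)
  then have "p \<noteq> 0" using assms(2) by auto
  then have "finite {z. poly p z = 0}" by (rule poly_roots_finite)
  then have "open (- ({z. poly p z = 0} - {b}))" by (intro open_Compl finite_imp_closed) simp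
  then show ?thesis unfolding eventually_at_topological p by auto
qed

lemma polyfuns_tendsto:
  assumes "h \<in> polyfuns"
  shows "(h \<longlongrightarrow> h b) (at b)"
proof -
  obtain p where p: "h = poly p" using assms(1) by (auto simp: polyfuns_def)
  show ?thesis unfolding p using poly_isCont[of b p] by (simp add: isCont_def)
qed

lemma exists_common_nonroot:
  assumes "\<And>h. h \<in> S \<Longrightarrow> h \<in> polyfuns \<and> (\<exists>a. h a \<noteq> 0)" "finite S"
  shows "\<exists>z. \<forall>h\<in>S. h z \<noteq> 0"
proof -
  have "eventually (\<lambda>z. \<forall>h\<in>S. h z \<noteq> 0) (at (0::complex))"
    unfolding eventually_ball_finite_distrib[OF assms(2)]
    using assms(1) polyfuns_eventually by blast
  then show ?thesis using eventually_happens'[of "at (0::complex)"] by auto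
qed

text \<open>Roots of a monic polynomial depend continuously on its coefficients: at a point close to a
  root the value is small, and it is the product of the distances to the roots.\<close>

lemma char_poly_root_near:
  fixes A :: "complex mat"
  assumes A: "A \<in> carrier_mat k k" and small: "cmod (poly (char_poly A) t) < \<epsilon> ^ k" and "\<epsilon> > 0"
  shows "\<exists>s. poly (char_poly A) s = 0 \<and> cmod (t - s) < \<epsilon>"
proof -
  obtain as where as: "char_poly A = (\<Prod>a\<leftarrow>as. [:- a, 1:])" "length as = k"
    using char_poly_factorized[OF A] by blast
  have val: "poly (char_poly A) t = (\<Prod>a\<leftarrow>as. t - a)" for t
    unfolding as(1) by (induction as) (simp_all add: algebra_simps)
  have "\<exists>a\<in>set as. cmod (t - a) < \<epsilon>"
  proof (rule ccontr)
    assume "\<not> ?thesis"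
    then have "\<forall>a\<in>set as. \<epsilon> \<le> cmod (t - a)" by auto
    then have "\<epsilon> ^ length as \<le> cmod (\<Prod>a\<leftarrow>as. t - a)"
      using \<open>\<epsilon> > 0\<close> by (induction as) (auto simp: norm_mult intro!: mult_mono)
    then show False using small val as(2) by simp
  qed
  then obtain a where a: "a \<in> set as" "cmod (t - a) < \<epsilon>" by blast
  have "poly (char_poly A) a = 0" unfolding val using a(1) by (auto simp: prod_list_zero_iff)
  then show ?thesis using a by blast
qed

section \<open>Symplectic bases\<close>

context symplectic_space
begin

lemma zero_left [simp]: "\<omega> 0 w = 0" and zero_right [simp]: "\<omega> w 0 = 0"
  using scale_left[of 0 0 w] scale_right[of w 0 0] by simp_all

lemma minus_left: "\<omega> (- u) w = - \<omega> u w" and minus_right: "\<omega> w (- u) = - \<omega> w u"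
  using add_left[of u "- u" w] add_right[of w u "- u"] by (simp_all add: eq_neg_iff_add_eq_0 add.commute)

lemma diff_left: "\<omega> (u - v) w = \<omega> u w - \<omega> v w" and diff_right: "\<omega> w (u - v) = \<omega> w u - \<omega> w v"
  using add_left[of u "- v" w] add_right[of w u "- v"] by (simp_all add: minus_left minus_right)

lemma sum_left: "\<omega> (\<Sum>i\<in>I. f i) w = (\<Sum>i\<in>I. \<omega> (f i) w)"
  and sum_right: "\<omega> w (\<Sum>i\<in>I. f i) = (\<Sum>i\<in>I. \<omega> w (f i))"
  by (induction I rule: infinite_finite_induct) (simp_all add: add_left add_right)

lemma skew: "\<omega> u v = - \<omega> v u"
proof -
  have "\<omega> u v + \<omega> v u = 0"
    using alternating[of "u + v"] by (simp add: add_left add_right alternating[of u] alternating[of v] add.commute)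
  then show ?thesis by (simp only: eq_neg_iff_add_eq_0)
qed

lemmas bilinear_simps = add_left add_right scale_left scale_right diff_left diff_right
  minus_left minus_right sum_left sum_right

lemma nondegenerate_right: "(\<And>u. \<omega> u w = 0) \<Longrightarrow> w = 0"
  using nondegenerate[of w] skew[of w] by simp

lemma eqI_left: "(\<And>w. \<omega> u w = \<omega> v w) \<Longrightarrow> u = v"
  using nondegenerate[of "u - v"] by (simp add: diff_left)

lemma eqI_right: "(\<And>w. \<omega> w u = \<omega> w v) \<Longrightarrow> u = v"
  using nondegenerate_right[of "u - v"] by (simp add: diff_right)

lemma pairing_one: "v \<noteq> 0 \<Longrightarrow> \<exists>y. \<omega> v y = 1"
proof -
  assume "v \<noteq> 0"
  then obtain w where "\<omega> v w \<noteq> 0" using nondegenerate by blast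
  then show ?thesis by (intro exI[of _ "scale (1 / \<omega> v w) w"]) (simp add: scale_right)
qed

definition hyperbolic :: "(nat \<Rightarrow> 'v) \<Rightarrow> (nat \<Rightarrow> 'v) \<Rightarrow> nat \<Rightarrow> bool" where
  "hyperbolic u w k \<longleftrightarrow> (\<forall>i<k. \<forall>j<k. \<omega> (u i) (u j) = 0 \<and> \<omega> (w i) (w j) = 0 \<and>
     \<omega> (u i) (w j) = (if i = j then 1 else 0))"

text \<open>The projection onto the span of a hyperbolic family, along its symplectic complement.\<close>

definition projection :: "(nat \<Rightarrow> 'v) \<Rightarrow> (nat \<Rightarrow> 'v) \<Rightarrow> nat \<Rightarrow> 'v \<Rightarrow> 'v" where
  "projection u w k v = (\<Sum>i<k. scale (\<omega> v (w i)) (u i) - scale (\<omega> v (u i)) (w i))"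

lemma projection_residual:
  assumes "hyperbolic u w k" "j < k"
  shows "\<omega> (v - projection u w k v) (u j) = 0" "\<omega> (v - projection u w k v) (w j) = 0"
proof -
  have *: "\<omega> (u i) (u j) = 0" "\<omega> (w i) (w j) = 0" "\<omega> (u i) (w j) = (if i = j then 1 else 0)"
    "\<omega> (w i) (u j) = (if i = j then - 1 else 0)" if "i < k" for i
    using assms that skew[of "w i" "u j"] by (auto simp: hyperbolic_def)
  have "(\<Sum>i<k. \<omega> v (w i) * \<omega> (u i) (u j) - \<omega> v (u i) * \<omega> (w i) (u j))
      = (\<Sum>i<k. if i = j then \<omega> v (u j) else 0)"
    by (rule sum.cong) (auto simp: *)
  then show "\<omega> (v - projection u w k v) (u j) = 0"
    using assms(2) by (simp add: projection_def bilinear_simps)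
  have "(\<Sum>i<k. \<omega> v (w i) * \<omega> (u i) (w j) - \<omega> v (u i) * \<omega> (w i) (w j))
      = (\<Sum>i<k. if i = j then \<omega> v (w j) else 0)"
    by (rule sum.cong) (auto simp: *)
  then show "\<omega> (v - projection u w k v) (w j) = 0"
    using assms(2) by (simp add: projection_def bilinear_simps)
qed

text \<open>The step of the construction of a Darboux basis: a nonzero residual of the projection is orthogonal to
  the family, and subtracting its projection from a vector paired to it gives the second new member.\<close>

lemma hyperbolic_extend:
  assumes h: "hyperbolic u w k" and v: "projection u w k v \<noteq> v"
  shows "\<exists>u' w'. hyperbolic u' w' (Suc k)"
proof -
  define x where "x = v - projection u w k v"
  have "x \<noteq> 0" using v by (simp add: x_def)
  then obtain y0 where y0: "\<omega> x y0 = 1" using pairing_one by blast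
  define y where "y = y0 - projection u w k y0"
  have x: "\<omega> x (u j) = 0" "\<omega> x (w j) = 0" "\<omega> (u j) x = 0" "\<omega> (w j) x = 0" if "j < k" for j
    using projection_residual[OF h that, of v] skew[of "u j" x] skew[of "w j" x] by (simp_all add: x_def)
  have y: "\<omega> y (u j) = 0" "\<omega> y (w j) = 0" "\<omega> (u j) y = 0" "\<omega> (w j) y = 0" if "j < k" for j
    using projection_residual[OF h that, of y0] skew[of "u j" y] skew[of "w j" y] by (simp_all add: y_def)
  have "\<omega> x y = 1" using x y0 by (simp add: y_def projection_def bilinear_simps)
  then have "hyperbolic (u(k := x)) (w(k := y)) (Suc k)"
    using h x y by (auto simp: hyperbolic_def less_Suc_eq alternating)
  then show ?thesis by blast
qed

text \<open>The two halves of a hyperbolic family, indexed consecutively, and the family dual to it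
  under the symplectic form.\<close>

definition frame :: "(nat \<Rightarrow> 'v) \<Rightarrow> (nat \<Rightarrow> 'v) \<Rightarrow> nat \<Rightarrow> nat \<Rightarrow> 'v" where
  "frame u w k i = (if i < k then u i else w (i - k))"

definition coframe :: "(nat \<Rightarrow> 'v) \<Rightarrow> (nat \<Rightarrow> 'v) \<Rightarrow> nat \<Rightarrow> nat \<Rightarrow> 'v" where
  "coframe u w k i = (if i < k then - w i else u (i - k))"

lemma coframe_frame:
  assumes h: "hyperbolic u w k" and "i < 2 * k" "j < 2 * k"
  shows "\<omega> (coframe u w k i) (frame u w k j) = (if i = j then 1 else 0)"
proof -
  have *: "\<omega> (u i) (u j) = 0" "\<omega> (w i) (w j) = 0" "\<omega> (u i) (w j) = (if i = j then 1 else 0)"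
    "\<omega> (w i) (u j) = (if i = j then - 1 else 0)" if "i < k" "j < k" for i j
    using h that skew[of "w i" "u j"] by (auto simp: hyperbolic_def)
  show ?thesis
    using assms(2,3) by (auto simp: coframe_def frame_def * minus_left)
qed

lemma sum_double: "(\<Sum>i<2*k. f i) = (\<Sum>i<k. f i) + (\<Sum>i<k. f (k + i))" for f :: "nat \<Rightarrow> 'b::comm_monoid_add"
proof -
  have "(\<Sum>i<k+m. f i) = (\<Sum>i<k. f i) + (\<Sum>i<m. f (k + i))" for m
    by (induction m) (simp_all add: add.assoc)
  then show ?thesis by (simp add: mult_2)
qed

lemma projection_frame:
  "projection u w k v = (\<Sum>i<2*k. scale (\<omega> (coframe u w k i) v) (frame u w k i))"
proof -
  have "scale (\<omega> v (w i)) (u i) - scale (\<omega> v (u i)) (w i)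
      = scale (\<omega> (- w i) v) (u i) + scale (\<omega> (u i) v) (w i)" for i
    using skew[of v "w i"] skew[of v "u i"] by (simp add: minus_left)
  then show ?thesis
    unfolding sum_double by (simp add: projection_def coframe_def frame_def sum.distrib)
qed

text \<open>The coefficients of a linear relation are recovered by pairing with the dual family.\<close>

lemma frame_independent:
  assumes h: "hyperbolic u w k"
  shows "inj_on (frame u w k) {..<2 * k}" "independent (frame u w k ` {..<2 * k})"
proof -
  show inj: "inj_on (frame u w k) {..<2 * k}"
  proof (rule inj_onI)
    fix i j assume "i \<in> {..<2*k}" "j \<in> {..<2*k}" "frame u w k i = frame u w k j"
    then show "i = j" using coframe_frame[OF h, of i i] coframe_frame[OF h, of i j] by (auto split: if_splits)
  qed
  show "independent (frame u w k ` {..<2 * k})"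
  proof
    assume "dependent (frame u w k ` {..<2 * k})"
    then obtain t a v where t: "finite t" "t \<subseteq> frame u w k ` {..<2 * k}" "v \<in> t" "a v \<noteq> 0"
      "(\<Sum>v\<in>t. scale (a v) v) = 0"
      unfolding dependent_explicit by blast
    then obtain i where i: "i < 2 * k" "v = frame u w k i" by blast
    have "0 = \<omega> (coframe u w k i) (\<Sum>v\<in>t. scale (a v) v)" using t by simp
    also have "\<dots> = (\<Sum>v'\<in>t. a v' * \<omega> (coframe u w k i) v')" by (simp add: bilinear_simps)
    also have "\<dots> = (\<Sum>v'\<in>t. if v' = v then a v else 0)"
    proof (rule sum.cong)
      fix v' assume "v' \<in> t"
      then obtain j where "j < 2 * k" "v' = frame u w k j" using t(2) by blast
      then show "a v' * \<omega> (coframe u w k i) v' = (if v' = v then a v else 0)"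
        using i coframe_frame[OF h i(1), of j] inj by (auto dest: inj_onD)
    qed simp
    also have "\<dots> = a v" using t by simp
    finally show False using t by simp
  qed
qed

text \<open>A hyperbolic family is linearly independent, so its length is bounded by \<open>n\<close>; one of maximal length
  admits no residual and therefore spans.\<close>

lemma symplectic_basis:
  assumes "n > 0"
  shows "\<exists>u w. hyperbolic u w n \<and> (\<forall>v. projection u w n v = v)"
proof -
  obtain B where B: "independent B" "span B = UNIV"
    using maximal_independent_subset[of UNIV] by (metis UNIV_I subsetI subset_antisym top_greatest)
  have "dim UNIV = card B" using B by (metis dim_eq_card span_UNIV)
  then have "card B = 2 * n" using dimension by simp
  then have "finite B" using assms card_ge_0_finite by force
  interpret F: finite_dimensional_vector_space scale B
    by unfold_locales (use B \<open>finite B\<close> in auto)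
  define P where "P k \<longleftrightarrow> (\<exists>u w. hyperbolic u w k)" for k
  have bound: "k \<le> n" if "hyperbolic u w k" for u w k
  proof -
    have "card (frame u w k ` {..<2 * k}) \<le> dim UNIV"
      by (rule F.independent_card_le_dim) (use frame_independent[OF that] in auto)
    then show ?thesis using frame_independent(1)[OF that] dimension by (simp add: card_image)
  qed
  have "P 0" by (simp add: P_def hyperbolic_def)
  moreover have "\<forall>k. P k \<longrightarrow> k \<le> n" using bound by (auto simp: P_def)
  ultimately obtain k where k: "P k" "\<And>k'. P k' \<Longrightarrow> k' \<le> k"
    using GreatestI_nat[of P 0 n] Greatest_le_nat[of P _ n] by blast
  then obtain u w where h: "hyperbolic u w k" by (auto simp: P_def)
  have p: "projection u w k v = v" for v
    using hyperbolic_extend[OF h, of v] k(2)[of "Suc k"] by (auto simp: P_def)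
  have "v \<in> span (frame u w k ` {..<2 * k})" for v
    by (subst p[of v, symmetric], unfold projection_frame)
       (intro span_sum span_scale span_base imageI, simp)
  then have "dim UNIV = card (frame u w k ` {..<2 * k})"
    using dim_eq_card[OF _ frame_independent(2)[OF h], of UNIV] by (metis UNIV_eq_I span_UNIV)
  then have "k = n" using frame_independent(1)[OF h] dimension by (simp add: card_image)
  then show ?thesis using h p by blast
qed

section \<open>Quadratic forms\<close>

text \<open>The polar form, by polarization.  Defined on all functions, it makes \<open>quadratic\<close> expressible as a
  condition on the function alone.\<close>

definition bil :: "('v \<Rightarrow> complex) \<Rightarrow> 'v \<Rightarrow> 'v \<Rightarrow> complex" where
  "bil f x y = (f (x + y) - f x - f y) / 2"

definition quadratic :: "('v \<Rightarrow> complex) \<Rightarrow> bool" where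
  "quadratic f \<longleftrightarrow> (\<forall>x y z. bil f (x + y) z = bil f x z + bil f y z) \<and>
     (\<forall>a x y. bil f (scale a x) y = a * bil f x y) \<and> (\<forall>x. bil f x x = f x)"

lemma bil_sym: "bil f x y = bil f y x"
  by (simp add: bil_def add.commute)

lemma quadraticI:
  assumes "\<And>x y. B x y = B y x" "\<And>x y z. B (x + y) z = B x z + B y z"
    "\<And>a x y. B (scale a x) y = a * B x y" "\<And>x. f x = B x x"
  shows "quadratic f" "bil f x y = B x y"
proof -
  have r: "B x (y + z) = B x y + B x z" for x y z using assms(1,2) by metis
  have *: "bil f x y = B x y" for x y
    unfolding bil_def assms(4) using assms(1)[of y x] by (simp add: r assms(2) field_simps)
  then show "bil f x y = B x y" .
  show "quadratic f" unfolding quadratic_def * by (intro conjI allI) (simp_all only: assms(2-4))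
qed

context
  fixes f assumes f: "quadratic f"
begin

lemma bil_diag: "bil f x x = f x"
  using f by (simp add: quadratic_def)

lemma bil_left: "bil f (x + y) z = bil f x z + bil f y z" "bil f (scale a x) z = a * bil f x z"
  using f by (simp_all add: quadratic_def)

lemma bil_right: "bil f z (x + y) = bil f z x + bil f z y" "bil f z (scale a x) = a * bil f z x"
  unfolding bil_sym[of f z] by (rule bil_left)+

lemma bil_zero [simp]: "bil f 0 x = 0" "bil f x 0 = 0"
  using bil_left(2)[where a = 0] bil_right(2)[where a = 0] by simp_all

lemma bil_minus: "bil f (- x) y = - bil f x y" "bil f y (- x) = - bil f y x"
  using bil_left(2)[where a = "-1"] bil_right(2)[where a = "-1"] by simp_all

lemma bil_diff: "bil f (x - y) z = bil f x z - bil f y z" "bil f z (x - y) = bil f z x - bil f z y"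
  using bil_left(1)[of x "- y"] bil_right(1)[where y = "- y"] by (simp_all add: bil_minus)

lemma bil_sum: "bil f (\<Sum>i\<in>I. g i) z = (\<Sum>i\<in>I. bil f (g i) z)"
    "bil f z (\<Sum>i\<in>I. g i) = (\<Sum>i\<in>I. bil f z (g i))"
  by (induction I rule: infinite_finite_induct) (simp_all add: bil_left bil_right)

lemma quadratic_values:
  "f 0 = 0" "f (scale a x) = a * a * f x" "f (x + y) = f x + 2 * bil f x y + f y"
  "f (x - y) = f x - 2 * bil f x y + f y"
proof -
  show "f 0 = 0" "f (scale a x) = a * a * f x"
    by (simp_all add: bil_diag[symmetric] bil_left bil_right)
  show "f (x + y) = f x + 2 * bil f x y + f y" by (simp add: bil_def field_simps)
  have "f (x - y) = bil f x x - bil f x y - bil f y x + bil f y y"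
    by (simp add: bil_diag[of "x - y", symmetric] bil_diff)
  then show "f (x - y) = f x - 2 * bil f x y + f y" by (simp add: bil_diag bil_sym[of f y x])
qed

end

lemma quadratic_lin:
  assumes "quadratic f" "quadratic g"
  shows "quadratic (\<lambda>x. a * f x + b * g x)"
    and "bil (\<lambda>x. a * f x + b * g x) x y = a * bil f x y + b * bil g x y"
proof -
  let ?B = "\<lambda>x y. a * bil f x y + b * bil g x y"
  have "?B x y = ?B y x" "?B (x + y) z = ?B x z + ?B y z" "?B (scale c x) y = c * ?B x y"
    "a * f x + b * g x = ?B x x" for x y z c
    using assms by (simp_all add: bil_sym[of _ y x] bil_left bil_diag algebra_simps)
  note * = quadraticI[of ?B "\<lambda>x. a * f x + b * g x", OF this]
  show "quadratic (\<lambda>x. a * f x + b * g x)"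
    "bil (\<lambda>x. a * f x + b * g x) x y = a * bil f x y + b * bil g x y" by (rule *)+
qed

lemma quadratic_add: "quadratic f \<Longrightarrow> quadratic g \<Longrightarrow> quadratic (\<lambda>x. f x + g x)"
  using quadratic_lin(1)[of f g 1 1] by simp

lemma quadratic_scale: "quadratic f \<Longrightarrow> quadratic (\<lambda>x. a * f x)"
  and bil_scale: "quadratic f \<Longrightarrow> bil (\<lambda>x. a * f x) x y = a * bil f x y"
  using quadratic_lin[of f f a 0] by simp_all

lemma quadratic_prod:
  fixes p q :: "'v \<Rightarrow> complex"
  assumes "\<And>x y. p (x + y) = p x + p y" "\<And>a x. p (scale a x) = a * p x"
    "\<And>x y. q (x + y) = q x + q y" "\<And>a x. q (scale a x) = a * q x"
  shows "quadratic (\<lambda>x. p x * q x)" "bil (\<lambda>x. p x * q x) x y = (p x * q y + p y * q x) / 2"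
proof -
  let ?B = "\<lambda>x y. (p x * q y + p y * q x) / 2"
  have "?B x y = ?B y x" "?B (x + y) z = ?B x z + ?B y z" "?B (scale c x) y = c * ?B x y"
    "p x * q x = ?B x x" for x y z c
    by (simp_all add: assms field_simps)
  note * = quadraticI[of ?B "\<lambda>x. p x * q x", OF this]
  show "quadratic (\<lambda>x. p x * q x)" "bil (\<lambda>x. p x * q x) x y = (p x * q y + p y * q x) / 2"
    by (rule *)+
qed

lemma quadratic_sum:
  assumes "\<And>i. i \<in> I \<Longrightarrow> quadratic (g i)"
  shows "quadratic (\<lambda>x. \<Sum>i\<in>I. g i x)"
  using assms
proof (induction I rule: infinite_finite_induct)
  case (insert i I)
  then show ?case using quadratic_add[of "g i" "\<lambda>x. \<Sum>i\<in>I. g i x"] by simp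
qed (auto simp: quadratic_def bil_def)

end

section \<open>Symmetric squares and projectivizations\<close>

lemma Sym_zero: "(\<lambda>_. 0) \<in> Sym k L"
  unfolding Sym_def by (intro CollectI exI[of _ 0]) simp

lemma Sym_add:
  assumes "f \<in> Sym k L" "g \<in> Sym k L"
  shows "(\<lambda>x. f x + g x) \<in> Sym k L"
proof -
  obtain N :: nat and c a where f: "f = (\<lambda>x. \<Sum>i<N. c i * (\<Prod>j<k. a i j x))" "\<forall>i<N. \<forall>j<k. a i j \<in> L"
    using assms(1) unfolding Sym_def by blast
  obtain M :: nat and c' a' where g: "g = (\<lambda>x. \<Sum>i<M. c' i * (\<Prod>j<k. a' i j x))" "\<forall>i<M. \<forall>j<k. a' i j \<in> L"
    using assms(2) unfolding Sym_def by blast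
  define c'' where "c'' i = (if i < N then c i else c' (i - N))" for i
  define a'' where "a'' i = (if i < N then a i else a' (i - N))" for i
  have "(\<Sum>i<N+m. F i) = (\<Sum>i<N. F i) + (\<Sum>i<m. F (N + i))" for m and F :: "nat \<Rightarrow> complex"
    by (induction m) (simp_all add: add.assoc)
  then have "(\<lambda>x. f x + g x) = (\<lambda>x. \<Sum>i<N+M. c'' i * (\<Prod>j<k. a'' i j x))"
    by (simp add: f(1) g(1) c''_def a''_def)
  moreover have "\<forall>i<N+M. \<forall>j<k. a'' i j \<in> L" using f(2) g(2) by (simp add: a''_def)
  ultimately show ?thesis unfolding Sym_def by blast
qed

lemma Sym_scale:
  assumes "f \<in> Sym k L"
  shows "(\<lambda>x. s * f x) \<in> Sym k L"
proof -
  obtain N :: nat and c a where f: "f = (\<lambda>x. \<Sum>i<N. c i * (\<Prod>j<k. a i j x))" "\<forall>i<N. \<forall>j<k. a i j \<in> L"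
    using assms(1) unfolding Sym_def by blast
  have "(\<lambda>x. s * f x) = (\<lambda>x. \<Sum>i<N. (s * c i) * (\<Prod>j<k. a i j x))"
    by (simp add: f(1) sum_distrib_left mult.assoc)
  then show ?thesis using f(2) unfolding Sym_def by (intro CollectI exI[of _ N] exI[of _ "\<lambda>i. s * c i"] exI[of _ a]) simp
qed

lemma Sym_sum:
  assumes "\<And>i. i \<in> I \<Longrightarrow> g i \<in> Sym k L"
  shows "(\<lambda>x. \<Sum>i\<in>I. g i x) \<in> Sym k L"
  using assms
proof (induction I rule: infinite_finite_induct)
  case (insert i I)
  then show ?case using Sym_add[of "g i" k L "\<lambda>x. \<Sum>i\<in>I. g i x"] by simp
qed (auto simp: Sym_zero)

lemma Sym2_prod:
  assumes "a \<in> L" "b \<in> L"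
  shows "(\<lambda>x. a x * b x) \<in> Sym 2 L"
  unfolding Sym_def
  by (rule CollectI, rule exI[of _ 1], rule exI[of _ "\<lambda>_. 1"], rule exI[of _ "\<lambda>_ j. if j = 0 then a else b"])
     (use assms in \<open>simp add: numeral_2_eq_2\<close>)

lemma Sym2E:
  assumes "f \<in> Sym 2 L"
  obtains N :: nat and c a b where "f = (\<lambda>x. \<Sum>i<N. c i * (a i x * b i x))" "\<And>i. i < N \<Longrightarrow> a i \<in> L"
    "\<And>i. i < N \<Longrightarrow> b i \<in> L"
proof -
  obtain N :: nat and c a where f: "f = (\<lambda>x. \<Sum>i<N. c i * (\<Prod>j<(2::nat). a i j x))" "\<forall>i<N. \<forall>j<2. a i j \<in> L"
    using assms(1) unfolding Sym_def by blast
  show ?thesis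
  proof (rule that)
    show "f = (\<lambda>x. \<Sum>i<N. c i * (a i 0 x * a i 1 x))" using f(1) by (simp add: numeral_2_eq_2)
    show "a i 0 \<in> L" "a i 1 \<in> L" if "i < N" for i using f(2) that by simp_all
  qed
qed

lemma Sym0_iff: "h \<in> Sym 0 L \<longleftrightarrow> (\<exists>c. h = (\<lambda>_. c))"
proof
  show "\<exists>c. h = (\<lambda>_. c) \<Longrightarrow> h \<in> Sym 0 L"
    unfolding Sym_def by (clarsimp, rule exI[of _ 1]) (auto intro: exI[of _ "\<lambda>_. _"])
qed (auto simp: Sym_def)

lemma line_scale:
  assumes "c \<noteq> 0"
  shows "line (\<lambda>x. c * f x) = line f"
  unfolding line_def
proof (intro equalityI subsetI)
  fix g assume "g \<in> range (\<lambda>a x. a * f x)"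
  then obtain a where "g = (\<lambda>x. a * f x)" by blast
  then have "g = (\<lambda>x. (a / c) * (c * f x))" using assms by auto
  then show "g \<in> range (\<lambda>a x. a * (c * f x))" by blast
next
  fix g assume "g \<in> range (\<lambda>a x. a * (c * f x))"
  then obtain a where "g = (\<lambda>x. (a * c) * f x)" by (auto simp: mult.assoc)
  then show "g \<in> range (\<lambda>a x. a * f x)" by blast
qed

lemma line_eqD:
  assumes "line f = line g" "f \<noteq> (\<lambda>_. 0)"
  shows "\<exists>c. c \<noteq> 0 \<and> f = (\<lambda>x. c * g x)"
proof -
  have "f \<in> line f" unfolding line_def by (rule image_eqI[of _ _ 1]) auto
  then obtain c where c: "f = (\<lambda>x. c * g x)" unfolding assms(1) by (auto simp: line_def)
  then have "c \<noteq> 0" using assms(2) by auto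
  then show ?thesis using c by blast
qed

lemma self_in_line: "f \<in> line f"
  unfolding line_def by (rule image_eqI[of _ _ 1]) auto

text \<open>A point of a projectivization does not single out a representative, so membership of the line is
  transported to any of its generators by rescaling.\<close>

lemma line_in_projectivization_iff:
  assumes "\<And>f c. f \<in> S \<Longrightarrow> (\<lambda>x. c * f x) \<in> S"
  shows "line g \<in> projectivization S \<longleftrightarrow> g \<in> S \<and> g \<noteq> (\<lambda>_. 0)"
proof
  assume "line g \<in> projectivization S"
  then obtain f where f: "f \<in> S" "f \<noteq> (\<lambda>_. 0)" "line f = line g"
    unfolding projectivization_def by force
  obtain c where "c \<noteq> 0" "f = (\<lambda>x. c * g x)" using line_eqD[OF f(3,2)] by blast
  then have "g = (\<lambda>x. inverse c * f x)" "g \<noteq> (\<lambda>_. 0)" using f(2) by auto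
  then show "g \<in> S \<and> g \<noteq> (\<lambda>_. 0)" using assms[OF f(1), of "inverse c"] by simp
qed (auto simp: projectivization_def)

lemma line_in_projectivization_Sym:
  "line g \<in> projectivization (Sym k L) \<longleftrightarrow> g \<in> Sym k L \<and> g \<noteq> (\<lambda>_. 0)"
  by (intro line_in_projectivization_iff Sym_scale)

section \<open>The incidence in symplectic coordinates\<close>

lemma (in symplectic_space) bil_sum_fun:
  "bil (\<lambda>x. \<Sum>i\<in>I. g i x) x y = (\<Sum>i\<in>I. bil (g i) x y)"
  by (simp add: bil_def sum_subtractf flip: sum_divide_distrib)

text \<open>A basis \<open>e\<close> with dual family \<open>d\<close> under the symplectic form, together with a quadratic form \<open>f1\<close> whose
  endomorphism is diagonal in this basis with distinct eigenvalues \<open>\<mu>\<close>, and a vector \<open>y0\<close> at which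
  forms will be normalized.\<close>

locale symplectic_frame = symplectic_space scale \<omega> n
  for scale :: "complex \<Rightarrow> 'v::ab_group_add \<Rightarrow> 'v" and \<omega> n +
  fixes e d :: "nat \<Rightarrow> 'v" and \<mu> :: "nat \<Rightarrow> complex" and f1 :: "'v \<Rightarrow> complex" and y0 :: 'v
  assumes n2: "n \<ge> 2"
    and expand: "(\<Sum>i<2*n. scale (\<omega> (d i) v) (e i)) = v"
    and dual: "i < 2 * n \<Longrightarrow> j < 2 * n \<Longrightarrow> \<omega> (d i) (e j) = (if i = j then 1 else 0)"
    and f1: "quadratic f1"
    and diag: "i < 2 * n \<Longrightarrow> bil f1 (e i) y = \<mu> i * \<omega> (e i) y"
    and inj_\<mu>: "inj_on \<mu> {..<2*n}"
    and y0: "f1 y0 \<noteq> 0"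

text \<open>In a Darboux basis \<open>u\<close>, \<open>w\<close> a combination of the products \<open>\<omega>(u i, _) \<omega>(w i, _)\<close> has the \<open>u i\<close>
  and \<open>w i\<close> as eigenvectors with opposite eigenvalues, which can be chosen to be \<open>\<plusminus>1, \<dots>, \<plusminus>n\<close>.\<close>

lemma (in symplectic_space) frame_exists:
  assumes "n \<ge> 2"
  shows "\<exists>e d \<mu> f1 y0. symplectic_frame scale \<omega> n e d \<mu> f1 y0"
proof -
  obtain u w where h: "hyperbolic u w n" and p: "\<And>v. projection u w n v = v"
    using symplectic_basis assms by fastforce
  define \<mu> :: "nat \<Rightarrow> complex" where "\<mu> i = (if i < n then of_nat (i + 1) else - of_nat (i - n + 1))" for i
  define f where "f x = (\<Sum>i<n. (- 2 * of_nat (i + 1)) * (\<omega> (u i) x * \<omega> (w i) x))" for x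
  have prod: "quadratic (\<lambda>x. \<omega> (u i) x * \<omega> (w i) x)"
    "bil (\<lambda>x. \<omega> (u i) x * \<omega> (w i) x) x y = (\<omega> (u i) x * \<omega> (w i) y + \<omega> (u i) y * \<omega> (w i) x) / 2" for i x y
    by (rule quadratic_prod; simp add: bilinear_simps)+
  have qf: "quadratic f"
    unfolding f_def by (intro quadratic_sum quadratic_scale prod)
  have bf: "bil f x y = (\<Sum>i<n. - of_nat (i + 1) * (\<omega> (u i) x * \<omega> (w i) y + \<omega> (u i) y * \<omega> (w i) x))" for x y
    unfolding f_def bil_sum_fun bil_scale[OF prod(1)] prod(2) by (rule sum.cong) (simp_all add: field_simps)
  have *: "\<omega> (u i) (u j) = 0" "\<omega> (w i) (w j) = 0" "\<omega> (u i) (w j) = (if i = j then 1 else 0)"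
    "\<omega> (w i) (u j) = (if i = j then - 1 else 0)" if "i < n" "j < n" for i j
    using h that skew[of "w i" "u j"] by (auto simp: hyperbolic_def)
  have diag_u: "bil f (u j) y = of_nat (j + 1) * \<omega> (u j) y" if "j < n" for j y
  proof -
    have "bil f (u j) y = (\<Sum>i<n. if i = j then of_nat (j + 1) * \<omega> (u j) y else 0)"
      unfolding bf by (rule sum.cong) (use that in \<open>auto simp: * algebra_simps\<close>)
    then show ?thesis using that by simp
  qed
  have diag_w: "bil f (w j) y = - of_nat (j + 1) * \<omega> (w j) y" if "j < n" for j y
  proof -
    have "bil f (w j) y = (\<Sum>i<n. if i = j then - of_nat (j + 1) * \<omega> (w j) y else 0)"
      unfolding bf by (rule sum.cong) (use that in \<open>auto simp: *\<close>)
    then show ?thesis using that by simp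
  qed
  have "\<exists>y. f y \<noteq> 0"
  proof (rule ccontr)
    assume "\<not> ?thesis"
    then have "bil f (u 0) (w 0) = 0" by (simp add: bil_def)
    then show False using diag_u[of 0] *[of 0 0] assms by simp
  qed
  then obtain y where "f y \<noteq> 0" by blast
  have inj: "inj_on \<mu> {..<2*n}"
  proof (rule inj_onI)
    fix i j assume "i \<in> {..<2*n}" "j \<in> {..<2*n}" "\<mu> i = \<mu> j"
    moreover have "of_nat (a + 1) \<noteq> - complex_of_nat (b + 1)" for a b
    proof
      assume "of_nat (a + 1) = - complex_of_nat (b + 1)"
      then have "of_nat (a + 1) + complex_of_nat (b + 1) = 0" by (simp only: eq_neg_iff_add_eq_0)
      then have "complex_of_nat (a + 1 + (b + 1)) = 0" by (simp only: of_nat_add)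
      then show False by (simp only: of_nat_eq_0_iff)
    qed
    note ne = this this[symmetric]
    have "i = j" if "i < n \<longleftrightarrow> j < n"
      using calculation that by (auto simp: \<mu>_def simp del: of_nat_add of_nat_Suc of_nat_diff split: if_splits)
    moreover have "i < n \<longleftrightarrow> j < n"
      using calculation(3) ne by (auto simp: \<mu>_def simp del: of_nat_add of_nat_Suc of_nat_diff split: if_splits)
    ultimately show "i = j" by blast
  qed
  have "symplectic_frame scale \<omega> n (frame u w n) (coframe u w n) \<mu> f y"
  proof (unfold_locales)
    show "(\<Sum>i<2*n. scale (\<omega> (coframe u w n i) v) (frame u w n i)) = v" for v
      using p[of v] by (simp add: projection_frame)
    show "bil f (frame u w n i) y = \<mu> i * \<omega> (frame u w n i) y" if "i < 2 * n" for i y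
      using that diag_u[of i y] diag_w[of "i - n" y] by (simp add: frame_def \<mu>_def)
  qed (use assms coframe_frame[OF h] qf inj \<open>f y \<noteq> 0\<close> in auto)
  then show ?thesis by blast
qed

context symplectic_frame
begin

lemma expand_right: "(\<Sum>i<2*n. scale (- \<omega> (e i) y) (d i)) = y"
proof (rule eqI_right)
  fix w
  have "\<omega> w y = \<omega> (\<Sum>i<2*n. scale (\<omega> (d i) w) (e i)) y" by (simp add: expand)
  also have "\<dots> = (\<Sum>i<2*n. \<omega> (d i) w * \<omega> (e i) y)" by (simp add: bilinear_simps)
  also have "\<dots> = (\<Sum>i<2*n. - \<omega> (e i) y * \<omega> w (d i))"
    by (rule sum.cong) (simp_all add: skew[of "d _" w])
  finally show "\<omega> w (\<Sum>i<2*n. scale (- \<omega> (e i) y) (d i)) = \<omega> w y" by (simp add: bilinear_simps)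
qed

lemma linear_forms_UNIV: "l \<in> linear_forms scale UNIV \<longleftrightarrow> (\<exists>v. l = \<omega> v)"
proof
  assume "l \<in> linear_forms scale UNIV"
  then have l: "l (x + y) = l x + l y" "l (scale a x) = a * l x" for x y a
    by (simp_all add: linear_forms_def)
  have "l 0 = 0" using l(2)[of 0 0] by simp
  then have s: "l (\<Sum>i\<in>I. g i) = (\<Sum>i\<in>I. l (g i))" for I and g :: "nat \<Rightarrow> 'v"
    by (induction I rule: infinite_finite_induct) (simp_all add: l)
  have "l x = \<omega> (\<Sum>i<2*n. scale (l (e i)) (d i)) x" for x
    by (subst expand[of x, symmetric]) (simp add: s l bilinear_simps mult.commute)
  then show "\<exists>v. l = \<omega> v" by blast
qed (auto simp: linear_forms_def bilinear_simps)

abbreviation hyp :: "'v \<Rightarrow> 'v set" where "hyp v \<equiv> Defs.kernel (\<omega> v)"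

lemma in_hyp [simp]: "x \<in> hyp v \<longleftrightarrow> \<omega> v x = 0"
  by (simp add: Defs.kernel_def)

lemma form_nonzero_iff [simp]: "\<omega> v = (\<lambda>_. 0) \<longleftrightarrow> v = 0"
  using nondegenerate[of v] by (auto simp: fun_eq_iff)

lemma multiple_of_form:
  assumes "v \<noteq> 0" "\<And>x y. l (x + y) = l x + l y" "\<And>a x. l (scale a x) = a * l x"
    and "\<And>x. \<omega> v x = 0 \<Longrightarrow> l x = 0"
  shows "\<exists>c. \<forall>x. l x = c * \<omega> v x"
proof -
  obtain y where y: "\<omega> v y = 1" using pairing_one assms(1) by blast
  have "l x = l y * \<omega> v x" for x
  proof -
    have "l (x + scale (- \<omega> v x) y) = 0" by (rule assms(4)) (simp add: bilinear_simps y)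
    then show ?thesis unfolding assms(2,3) by (simp add: mult.commute)
  qed
  then show ?thesis by blast
qed

lemma hyp_subset:
  assumes "v \<noteq> 0" "hyp v \<subseteq> hyp v'"
  shows "\<exists>c. v' = scale c v"
proof -
  have "\<exists>c. \<forall>x. \<omega> v' x = c * \<omega> v x"
    by (rule multiple_of_form[OF assms(1)]) (use assms(2) in \<open>auto simp: bilinear_simps\<close>)
  then obtain c where "\<And>x. \<omega> v' x = c * \<omega> v x" by blast
  then have "v' = scale c v" by (intro eqI_left) (simp add: bilinear_simps)
  then show ?thesis by blast
qed

lemma hyperplanes_eq: "hyperplanes scale = {hyp v |v. v \<noteq> 0}"
  unfolding hyperplanes_def using linear_forms_UNIV form_nonzero_iff by (auto; metis)

lemma polar_point_hyp:
  assumes "v \<noteq> 0"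
  shows "polar_point scale \<omega> (hyp v) = range (\<lambda>c. scale c v)"
  unfolding polar_point_def
proof (rule the_equality)
  show "\<exists>l v'. l \<in> linear_forms scale UNIV \<and> l \<noteq> (\<lambda>_. 0) \<and> hyp v = Defs.kernel l \<and>
      (\<forall>u. l u = \<omega> v' u) \<and> range (\<lambda>c. scale c v) = range (\<lambda>c. scale c v')"
    using assms by (intro exI[of _ "\<omega> v"] exI[of _ v]) (auto simp: linear_forms_UNIV)
next
  fix p
  assume "\<exists>l v'. l \<in> linear_forms scale UNIV \<and> l \<noteq> (\<lambda>_. 0) \<and> hyp v = Defs.kernel l \<and>
      (\<forall>u. l u = \<omega> v' u) \<and> p = range (\<lambda>c. scale c v')"
  then obtain l v' where *: "l \<noteq> (\<lambda>_. 0)" "hyp v = Defs.kernel l" "\<forall>u. l u = \<omega> v' u"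
    "p = range (\<lambda>c. scale c v')" by blast
  then have "l = \<omega> v'" by auto
  then have v': "v' \<noteq> 0" "hyp v = hyp v'" using * by auto
  obtain c where c: "v' = scale c v" using hyp_subset[OF assms, of v'] v' by blast
  obtain c' where c': "v = scale c' v'" using hyp_subset[OF v'(1), of v] v' by blast
  show "p = range (\<lambda>c. scale c v)"
    unfolding *(4)
  proof (intro equalityI subsetI)
    fix x assume "x \<in> range (\<lambda>c. scale c v')"
    then obtain a where "x = scale a v'" by blast
    then have "x = scale (a * c) v" using c by simp
    then show "x \<in> range (\<lambda>c. scale c v)" by blast
  next
    fix x assume "x \<in> range (\<lambda>c. scale c v)"
    then obtain a where "x = scale a v" by blast
    then have "x = scale (a * c') v'" using c' by simp
    then show "x \<in> range (\<lambda>c. scale c v')" by blast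
  qed
qed

text \<open>The expansion of a quadratic form in the coordinates dual to the basis; it also shows that the
  quadratic functions are the sums of products of two linear forms.\<close>

lemma quadratic_coordinates:
  assumes "quadratic f"
  shows "f x = (\<Sum>i<2*n. \<Sum>j<2*n. bil f (e i) (e j) * (\<omega> (d i) x * \<omega> (d j) x))"
proof -
  have *: "bil f w x = (\<Sum>j<2*n. \<omega> (d j) x * bil f w (e j))" for w
  proof -
    have "bil f w (\<Sum>j<2*n. scale (\<omega> (d j) x) (e j)) = (\<Sum>j<2*n. \<omega> (d j) x * bil f w (e j))"
      by (simp add: bil_sum[OF assms] bil_right[OF assms])
    then show ?thesis unfolding expand .
  qed
  have "f x = (\<Sum>i<2*n. \<omega> (d i) x * bil f (e i) x)"
    using *[of x] by (simp add: bil_diag[OF assms] bil_sym[of f x])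
  also have "\<dots> = (\<Sum>i<2*n. \<omega> (d i) x * (\<Sum>j<2*n. \<omega> (d j) x * bil f (e i) (e j)))"
    by (simp only: *)
  also have "\<dots> = (\<Sum>i<2*n. \<Sum>j<2*n. bil f (e i) (e j) * (\<omega> (d i) x * \<omega> (d j) x))"
    by (simp only: sum_distrib_left mult_ac)
  finally show ?thesis .
qed

lemma Sym2_iff: "f \<in> Sym 2 (linear_forms scale UNIV) \<longleftrightarrow> quadratic f"
proof
  assume "f \<in> Sym 2 (linear_forms scale UNIV)"
  then obtain N c a b where f: "f = (\<lambda>x. \<Sum>i<(N::nat). c i * (a i x * b i x))"
    "\<And>i. i < N \<Longrightarrow> a i \<in> linear_forms scale UNIV" "\<And>i. i < N \<Longrightarrow> b i \<in> linear_forms scale UNIV"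
    by (rule Sym2E) blast
  have "quadratic (\<lambda>x. a i x * b i x)" if "i < N" for i
    by (rule quadratic_prod) (use f(2,3)[OF that] in \<open>simp_all add: linear_forms_def\<close>)
  then show "quadratic f" unfolding f(1) by (intro quadratic_sum quadratic_scale) simp
next
  assume q: "quadratic f"
  have "(\<lambda>x. \<Sum>i<2*n. \<Sum>j<2*n. bil f (e i) (e j) * (\<omega> (d i) x * \<omega> (d j) x))
      \<in> Sym 2 (linear_forms scale UNIV)"
    by (intro Sym_sum Sym_scale Sym2_prod) (auto simp: linear_forms_UNIV)
  then show "f \<in> Sym 2 (linear_forms scale UNIV)" by (simp add: quadratic_coordinates[OF q, symmetric])
qed

lemma G_sigma_hyp:
  assumes "v \<noteq> 0"
  shows "a \<in> G_sigma scale \<omega> (hyp v) \<longleftrightarrow> a \<in> linear_forms scale (hyp v) \<and> a v = 0"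
proof -
  have "(\<forall>x\<in>range (\<lambda>c. scale c v). a x = 0) \<longleftrightarrow> a v = 0" if "a \<in> linear_forms scale (hyp v)"
  proof
    assume "\<forall>x\<in>range (\<lambda>c. scale c v). a x = 0"
    then have "a (scale 1 v) = 0" by blast
    then show "a v = 0" by simp
  next
    assume "a v = 0"
    moreover have "a (scale c v) = c * a v" for c
      using that alternating[of v] by (simp add: linear_forms_def)
    ultimately show "\<forall>x\<in>range (\<lambda>c. scale c v). a x = 0" by auto
  qed
  then show ?thesis unfolding G_sigma_def polar_point_hyp[OF assms] by blast
qed

text \<open>The forms on the hyperplane that are polynomials in the linear forms vanishing at \<open>v\<close> are the ones with
  \<open>v\<close> in the radical.  In one direction such linear forms do not change under translation by \<open>v\<close>; in the
  other, a form with \<open>v\<close> in its radical does not change under projection along \<open>v\<close>.\<close>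

lemma restr_Sym2_G_sigma:
  assumes v: "v \<noteq> 0" and q: "quadratic q"
  shows "restr (hyp v) q \<in> Sym 2 (G_sigma scale \<omega> (hyp v)) \<longleftrightarrow> (\<forall>x. \<omega> v x = 0 \<longrightarrow> bil q v x = 0)"
proof
  assume "restr (hyp v) q \<in> Sym 2 (G_sigma scale \<omega> (hyp v))"
  then obtain N c a b where f: "restr (hyp v) q = (\<lambda>x. \<Sum>i<(N::nat). c i * (a i x * b i x))"
    "\<And>i. i < N \<Longrightarrow> a i \<in> G_sigma scale \<omega> (hyp v)" "\<And>i. i < N \<Longrightarrow> b i \<in> G_sigma scale \<omega> (hyp v)"
    by (rule Sym2E) blast
  show "\<forall>x. \<omega> v x = 0 \<longrightarrow> bil q v x = 0"
  proof (intro allI impI)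
    fix x assume x: "\<omega> v x = 0"
    have r: "q y = (\<Sum>i<N. c i * (a i y * b i y))" if "\<omega> v y = 0" for y
      using fun_cong[OF f(1), of y] that by (simp add: restr_def)
    have lin: "a i (v + x) = a i x" "b i (v + x) = b i x" "a i v = 0" "b i v = 0" if "i < N" for i
      using f(2,3)[OF that] x alternating[of v] by (simp_all add: G_sigma_hyp[OF v] linear_forms_def)
    have "q (v + x) = q x" "q v = 0"
      using x by (simp_all add: r alternating bilinear_simps lin)
    then show "bil q v x = 0" by (simp add: bil_def)
  qed
next
  assume rad: "\<forall>x. \<omega> v x = 0 \<longrightarrow> bil q v x = 0"
  obtain y where y: "\<omega> v y = 1" using pairing_one v by blast
  \<comment> \<open>Projecting along \<open>v\<close> turns coordinates on \<open>V\<close> into linear forms on the hyperplane that vanish at \<open>v\<close>.\<close>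
  define a where "a i = restr (hyp v) (\<lambda>x. \<omega> (d i) (x - scale (\<omega> x y) v))" for i
  have a: "a i \<in> G_sigma scale \<omega> (hyp v)" for i
    unfolding G_sigma_hyp[OF v] a_def linear_forms_def
    using y by (auto simp: restr_def bilinear_simps algebra_simps alternating)
  have eq: "restr (hyp v) q = (\<lambda>x. \<Sum>i<2*n. \<Sum>j<2*n. bil q (e i) (e j) * (a i x * a j x))"
  proof
    fix x
    show "restr (hyp v) q x = (\<Sum>i<2*n. \<Sum>j<2*n. bil q (e i) (e j) * (a i x * a j x))"
    proof (cases "\<omega> v x = 0")
      case True
      have "q v = 0" using rad alternating[of v] bil_diag[OF q, of v] by metis
      moreover have "bil q x v = 0" using rad[rule_format, OF True] bil_sym[of q x v] by (rule trans[rotated])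
      ultimately have "q x = q (x - scale (\<omega> x y) v)"
        by (simp add: quadratic_values[OF q] bil_right[OF q])
      also have "\<dots> = (\<Sum>i<2*n. \<Sum>j<2*n. bil q (e i) (e j) * (a i x * a j x))"
        unfolding quadratic_coordinates[OF q, of "x - scale (\<omega> x y) v"]
        using True by (simp add: a_def restr_def)
      finally show ?thesis using True by (simp add: restr_def)
    qed (simp add: restr_def a_def)
  qed
  show "restr (hyp v) q \<in> Sym 2 (G_sigma scale \<omega> (hyp v))"
    unfolding eq by (intro Sym_sum Sym_scale Sym2_prod a)
qed

text \<open>Linear forms on the hyperplane extend to \<open>V\<close> through a projection onto the hyperplane, so every point of
  the incidence has homogeneous coordinates in which \<open>q\<close> is defined on all of \<open>V\<close>.\<close>

lemma Sym2_extend: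
  assumes v: "v \<noteq> 0" and g: "g \<in> Sym 2 (G_sigma scale \<omega> (hyp v))"
  shows "\<exists>q. quadratic q \<and> g = restr (hyp v) q"
proof -
  obtain N c a b where f: "g = (\<lambda>x. \<Sum>i<(N::nat). c i * (a i x * b i x))"
    "\<And>i. i < N \<Longrightarrow> a i \<in> G_sigma scale \<omega> (hyp v)" "\<And>i. i < N \<Longrightarrow> b i \<in> G_sigma scale \<omega> (hyp v)"
    using g by (rule Sym2E) blast
  obtain y where y: "\<omega> v y = 1" using pairing_one v by blast
  define p where "p x = x - scale (\<omega> v x) y" for x
  have p: "\<omega> v (p x) = 0" for x by (simp add: p_def bilinear_simps y)
  have lin: "l (p (x + z)) = l (p x) + l (p z)" "l (p (scale s x)) = s * l (p x)"
    if "l \<in> G_sigma scale \<omega> (hyp v)" for l x z s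
  proof -
    have "p (x + z) = p x + p z" "p (scale s x) = scale s (p x)"
      by (simp_all add: p_def bilinear_simps scale_left_distrib scale_right_diff_distrib)
    then show "l (p (x + z)) = l (p x) + l (p z)" "l (p (scale s x)) = s * l (p x)"
      using that p by (simp_all add: G_sigma_hyp[OF v] linear_forms_def)
  qed
  have "quadratic (\<lambda>x. a i (p x) * b i (p x))" if "i < N" for i
    by (rule quadratic_prod) (simp_all add: lin f(2,3)[OF that])
  then have "quadratic (\<lambda>x. \<Sum>i<N. c i * (a i (p x) * b i (p x)))"
    by (intro quadratic_sum quadratic_scale) simp
  moreover have "g = restr (hyp v) (\<lambda>x. \<Sum>i<N. c i * (a i (p x) * b i (p x)))"
  proof
    fix x
    have "a i x = 0" if "i < N" "\<omega> v x \<noteq> 0" for i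
      using f(2)[OF that(1)] that(2) by (simp add: G_sigma_hyp[OF v] linear_forms_def)
    then show "g x = restr (hyp v) (\<lambda>x. \<Sum>i<N. c i * (a i (p x) * b i (p x))) x"
      by (simp add: f(1) restr_def p_def)
  qed
  ultimately show ?thesis by blast
qed

text \<open>The cone over the incidence: \<open>q\<close> restricts to a nonzero cone with vertex \<open>[v]\<close> on the
  hyperplane polar to \<open>v\<close>, and \<open>f\<close> restricts to a multiple of \<open>q\<close>.\<close>

definition cone_pt :: "'v \<Rightarrow> ('v \<Rightarrow> complex) \<Rightarrow> ('v \<Rightarrow> complex) \<Rightarrow> bool" where
  "cone_pt v q f \<longleftrightarrow> v \<noteq> 0 \<and> quadratic q \<and> quadratic f \<and> f \<noteq> (\<lambda>_. 0) \<and>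
     (\<exists>x. \<omega> v x = 0 \<and> q x \<noteq> 0) \<and> (\<forall>x. \<omega> v x = 0 \<longrightarrow> bil q v x = 0) \<and>
     (\<exists>c. \<forall>x. \<omega> v x = 0 \<longrightarrow> f x = c * q x)"

abbreviation "X \<equiv> incidence scale \<omega> 2 2"
abbreviation "Y \<equiv> proj_forms scale 2"

lemma F_fiber_iff:
  "f \<in> F_fiber scale 2 2 H Q \<longleftrightarrow> quadratic f \<and> (\<exists>r\<in>Q. \<exists>s. \<forall>x\<in>H. f x = r x * s)"
  unfolding F_fiber_def by (auto simp: Sym2_iff Sym0_iff Bex_def)

lemma points_incidence_iff:
  assumes "v \<noteq> 0" "quadratic q"
  shows "(hyp v, line (restr (hyp v) q), line f) \<in> points X \<longleftrightarrow> cone_pt v q f"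
proof -
  have S: "(\<lambda>x. c * g x) \<in> F_fiber scale 2 2 H Q" if "g \<in> F_fiber scale 2 2 H Q" for c g H Q
  proof -
    from that obtain r s where g: "quadratic g" "r \<in> Q" "\<forall>x\<in>H. g x = r x * s"
      unfolding F_fiber_iff by blast
    have "\<forall>x\<in>H. c * g x = r x * (c * s)" using g(3) by simp
    then show ?thesis
      unfolding F_fiber_iff
      using g(1,2) quadratic_scale[OF g(1), of c] by blast
  qed
  have 1: "(hyp v, line (restr (hyp v) q)) \<in> Y_points scale \<omega> 2 \<longleftrightarrow>
      (\<exists>x. \<omega> v x = 0 \<and> q x \<noteq> 0) \<and> (\<forall>x. \<omega> v x = 0 \<longrightarrow> bil q v x = 0)"
  proof -
    have "hyp v \<in> hyperplanes scale" using assms(1) by (auto simp: hyperplanes_eq)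
    moreover have "restr (hyp v) q \<noteq> (\<lambda>_. 0) \<longleftrightarrow> (\<exists>x. \<omega> v x = 0 \<and> q x \<noteq> 0)"
      by (auto simp: restr_def fun_eq_iff)
    ultimately show ?thesis
      unfolding Y_points_def mem_Collect_eq prod.case line_in_projectivization_Sym restr_Sym2_G_sigma[OF assms]
      by blast
  qed
  have "f \<in> F_fiber scale 2 2 (hyp v) (line (restr (hyp v) q)) \<longleftrightarrow>
      quadratic f \<and> (\<exists>c. \<forall>x. \<omega> v x = 0 \<longrightarrow> f x = c * q x)" (is "?l \<longleftrightarrow> ?r")
  proof
    assume ?l
    then obtain c s where "quadratic f" "\<forall>x\<in>hyp v. f x = c * restr (hyp v) q x * s"
      by (auto simp: F_fiber_iff line_def)
    then show ?r by (auto simp: restr_def intro!: exI[of _ "c * s"])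
  next
    assume ?r
    then obtain c where "quadratic f" "\<forall>x. \<omega> v x = 0 \<longrightarrow> f x = c * q x" by blast
    then show ?l
      by (auto simp: F_fiber_iff restr_def intro!: bexI[OF _ self_in_line] exI[of _ c])
  qed
  then show ?thesis
    using 1 assms by (auto simp: incidence_def line_in_projectivization_iff[OF S] cone_pt_def)
qed

lemma ambient_incidence: "(l, q, f) \<in> ambient X \<longleftrightarrow> (\<exists>v. l = \<omega> v) \<and> quadratic q \<and> quadratic f"
  by (auto simp: incidence_def linear_forms_UNIV Sym2_iff)

lemma quot_incidence: "quot X (l, q, f) = (Defs.kernel l, line (restr (Defs.kernel l) q), line f)"
  by (simp add: incidence_def)

lemma cone_incidence:
  "(l, q, f) \<in> cone_over X U \<longleftrightarrow>
     (\<exists>v. l = \<omega> v \<and> cone_pt v q f) \<and> quot X (l, q, f) \<in> U"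
proof -
  have "v \<noteq> 0" if "quot X (\<omega> v, q, f) \<in> points X" for v
  proof -
    have "hyp v \<in> hyperplanes scale" using that by (auto simp: incidence_def Y_points_def)
    then obtain v' where "v' \<noteq> 0" "hyp v = hyp v'" by (auto simp: hyperplanes_eq)
    moreover from this obtain x where "\<omega> v' x \<noteq> 0" using nondegenerate[of v'] by blast
    ultimately have "\<omega> v x \<noteq> 0" by (metis in_hyp)
    then show "v \<noteq> 0" by auto
  qed
  note nz = this
  show ?thesis
  proof
    assume "(l, q, f) \<in> cone_over X U"
    then obtain v where v: "l = \<omega> v" "quadratic q" "quot X (\<omega> v, q, f) \<in> points X"
      "quot X (l, q, f) \<in> U" by (auto simp: cone_over_def ambient_incidence)
    have "cone_pt v q f"
      using points_incidence_iff[OF nz[OF v(3)] v(2)] v(3) by (simp add: quot_incidence)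
    then show "(\<exists>v. l = \<omega> v \<and> cone_pt v q f) \<and> quot X (l, q, f) \<in> U" using v by blast
  next
    assume "(\<exists>v. l = \<omega> v \<and> cone_pt v q f) \<and> quot X (l, q, f) \<in> U"
    then obtain v where v: "l = \<omega> v" "cone_pt v q f" "quot X (l, q, f) \<in> U" by blast
    then have "quot X (l, q, f) \<in> points X"
      using points_incidence_iff[of v q f] by (simp add: quot_incidence cone_pt_def)
    then show "(l, q, f) \<in> cone_over X U"
      using v unfolding cone_over_def by (auto simp: ambient_incidence cone_pt_def)
  qed
qed

lemma points_incidenceE:
  assumes "x \<in> points X"
  obtains v q f where "x = (hyp v, line (restr (hyp v) q), line f)" "cone_pt v q f"
proof -
  obtain H Q F where x: "x = (H, Q, F)" "H \<in> hyperplanes scale"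
    "Q \<in> projectivization (Sym 2 (G_sigma scale \<omega> H))" "F \<in> projectivization (F_fiber scale 2 2 H Q)"
    using assms by (auto simp: incidence_def Y_points_def)
  obtain v where v: "v \<noteq> 0" "H = hyp v" using x(2) by (auto simp: hyperplanes_eq)
  obtain g where g: "g \<in> Sym 2 (G_sigma scale \<omega> H)" "Q = line g" using x(3) by (auto simp: projectivization_def)
  obtain q where q: "quadratic q" "g = restr (hyp v) q" using Sym2_extend v g by blast
  obtain f where f: "F = line f" using x(4) by (auto simp: projectivization_def)
  show ?thesis
    using that[of v q f] points_incidence_iff[OF v(1) q(1), of f] assms
    by (simp add: x(1) v(2) g(2) q(2) f)
qed

lemma covered_incidence: "points X \<subseteq> quot X ` ambient X"
proof
  fix x assume "x \<in> points X"
  then obtain v q f where "x = (hyp v, line (restr (hyp v) q), line f)" "cone_pt v q f"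
    by (rule points_incidenceE)
  then show "x \<in> quot X ` ambient X"
    by (intro image_eqI[of _ _ "(\<omega> v, q, f)"]) (auto simp: quot_incidence ambient_incidence cone_pt_def)
qed

lemma points_Y: "F \<in> points Y \<longleftrightarrow> (\<exists>f. F = line f \<and> quadratic f \<and> f \<noteq> (\<lambda>_. 0))"
  by (auto simp: proj_forms_def projectivization_def Sym2_iff)

lemma cone_Y: "f \<in> cone_over Y U \<longleftrightarrow> quadratic f \<and> f \<noteq> (\<lambda>_. 0) \<and> line f \<in> U"
  unfolding cone_over_def
  by (auto simp: proj_forms_def line_in_projectivization_Sym Sym2_iff)

lemma covered_Y: "points Y \<subseteq> quot Y ` ambient Y"
  by (auto simp: proj_forms_def projectivization_def)

end

section \<open>Eigenlines and points of the incidence\<close>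

context symplectic_frame
begin

text \<open>\<open>t\<close> is an eigenvalue, with eigenvector \<open>v\<close>, of the infinitesimal symplectic
  endomorphism that corresponds to the quadratic form \<open>f\<close>.\<close>

definition eigen :: "('v \<Rightarrow> complex) \<Rightarrow> 'v \<Rightarrow> complex \<Rightarrow> bool" where
  "eigen f v t \<longleftrightarrow> v \<noteq> 0 \<and> (\<forall>y. bil f v y = t * \<omega> v y)"

text \<open>The matrix of the endomorphism \<open>A\<close> with \<open>\<omega>(A v, y) = bil f v y\<close> in the basis \<open>e\<close>: the coordinates of
  \<open>A (e j)\<close> are \<open>\<omega> (d i) (A (e j)) = - bil f (e j) (d i)\<close>.\<close>

definition endo :: "('v \<Rightarrow> complex) \<Rightarrow> complex mat" where
  "endo f = mat (2*n) (2*n) (\<lambda>(i, j). - bil f (e j) (d i))"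

lemma endo_carrier [simp]: "endo f \<in> carrier_mat (2*n) (2*n)"
  by (simp add: endo_def)

lemma endo_mult:
  assumes "quadratic f"
  shows "endo f *\<^sub>v vec (2*n) (\<lambda>j. \<omega> (d j) v) = vec (2*n) (\<lambda>i. - bil f v (d i))"
proof (rule eq_vecI)
  fix i assume "i < dim_vec (vec (2*n) (\<lambda>i. - bil f v (d i)))"
  then have i: "i < 2 * n" by simp
  have "bil f v (d i) = bil f (\<Sum>j<2*n. scale (\<omega> (d j) v) (e j)) (d i)" by (simp add: expand)
  also have "\<dots> = (\<Sum>j<2*n. \<omega> (d j) v * bil f (e j) (d i))"
    by (simp add: bil_sum[OF assms] bil_left[OF assms])
  finally show "(endo f *\<^sub>v vec (2*n) (\<lambda>j. \<omega> (d j) v)) $ i = vec (2*n) (\<lambda>i. - bil f v (d i)) $ i"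
    using i by (simp add: endo_def scalar_prod_def lessThan_atLeast0 sum_negf mult.commute)
qed (simp add: endo_def)

lemma eigen_mult:
  assumes "quadratic f" "eigen f v t"
  shows "endo f *\<^sub>v vec (2*n) (\<lambda>j. \<omega> (d j) v) = t \<cdot>\<^sub>v vec (2*n) (\<lambda>j. \<omega> (d j) v)"
  unfolding endo_mult[OF assms(1)] using assms(2) skew[of v] by (auto simp: eigen_def)

lemma eigenvalue_endo_iff:
  assumes f: "quadratic f"
  shows "poly (char_poly (endo f)) t = 0 \<longleftrightarrow> (\<exists>v. eigen f v t)"
  unfolding eigenvalue_root_char_poly[OF endo_carrier, symmetric]
proof
  assume "\<exists>v. eigen f v t"
  then obtain v where v: "eigen f v t" by blast
  have "vec (2*n) (\<lambda>j. \<omega> (d j) v) \<noteq> 0\<^sub>v (2*n)"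
  proof
    assume 0: "vec (2*n) (\<lambda>j. \<omega> (d j) v) = 0\<^sub>v (2*n)"
    have "\<omega> (d j) v = 0" if "j < 2 * n" for j using arg_cong[OF 0, of "\<lambda>x. x $ j"] that by simp
    then have "v = 0" using expand[of v] by simp
    then show False using v by (simp add: eigen_def)
  qed
  then show "eigenvalue (endo f) t"
    unfolding eigenvalue_def eigenvector_def using eigen_mult[OF f v]
    by (intro exI[of _ "vec (2*n) (\<lambda>j. \<omega> (d j) v)"]) (simp add: endo_def)
next
  assume "eigenvalue (endo f) t"
  then obtain x where x: "x \<in> carrier_vec (2*n)" "x \<noteq> 0\<^sub>v (2*n)" "endo f *\<^sub>v x = t \<cdot>\<^sub>v x"
    by (auto simp: eigenvalue_def eigenvector_def endo_def)
  define v where "v = (\<Sum>j<2*n. scale (x $ j) (e j))"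
  have xv: "\<omega> (d i) v = x $ i" if "i < 2 * n" for i
  proof -
    have "\<omega> (d i) v = (\<Sum>j<2*n. if j = i then x $ i else 0)"
      unfolding v_def bilinear_simps by (rule sum.cong) (use that in \<open>auto simp: dual\<close>)
    then show ?thesis using that by simp
  qed
  then have xeq: "vec (2*n) (\<lambda>j. \<omega> (d j) v) = x" using x(1) by (auto intro!: eq_vecI)
  have "v \<noteq> 0"
  proof
    assume "v = 0"
    then have "x = 0\<^sub>v (2*n)" using x(1) xv by (auto intro!: eq_vecI)
    then show False using x by simp
  qed
  have b: "bil f v (d i) = t * \<omega> v (d i)" if "i < 2 * n" for i
    using arg_cong[OF x(3)[folded xeq, unfolded endo_mult[OF f]], of "\<lambda>x. x $ i"] that skew[of "d i" v]
    by simp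
  have "bil f v y = t * \<omega> v y" for y
  proof -
    have "bil f v (\<Sum>i<2*n. scale (- \<omega> (e i) y) (d i)) = t * \<omega> v (\<Sum>i<2*n. scale (- \<omega> (e i) y) (d i))"
      unfolding bil_sum[OF f] bil_right[OF f] bilinear_simps sum_distrib_left
      by (rule sum.cong) (simp_all add: b)
    then show ?thesis unfolding expand_right .
  qed
  then show "\<exists>v. eigen f v t" using \<open>v \<noteq> 0\<close> by (auto simp: eigen_def)
qed

lemma eigen_exists:
  assumes "quadratic f"
  shows "\<exists>v t. eigen f v t"
proof -
  have "degree (char_poly (endo f)) \<noteq> 0" using degree_monic_char_poly[OF endo_carrier] n2 by simp
  then have "\<not> constant (poly (char_poly (endo f)))" by (simp add: constant_degree)
  then obtain t where "poly (char_poly (endo f)) t = 0" using fundamental_theorem_of_algebra by blast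
  then show ?thesis using eigenvalue_endo_iff[OF assms] by blast
qed

text \<open>On the hyperplane, \<open>bil f v\<close> is a multiple of \<open>bil q v = 0\<close>; hence it is a multiple of \<open>\<omega> v\<close> on \<open>V\<close>.\<close>

lemma cone_pt_eigen:
  assumes "cone_pt v q f"
  shows "\<exists>t. eigen f v t"
proof -
  obtain c where c: "\<And>x. \<omega> v x = 0 \<Longrightarrow> f x = c * q x" using assms by (auto simp: cone_pt_def)
  have v: "v \<noteq> 0" and f: "quadratic f" and rad: "\<And>x. \<omega> v x = 0 \<Longrightarrow> bil q v x = 0"
    using assms by (auto simp: cone_pt_def)
  have "bil f v x = 0" if "\<omega> v x = 0" for x
  proof -
    have "bil f v x = c * bil q v x"
      unfolding bil_def using that by (simp add: c bilinear_simps alternating algebra_simps)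
    then show ?thesis using rad[OF that] by simp
  qed
  then have "\<exists>t. \<forall>y. bil f v y = t * \<omega> v y"
    by (intro multiple_of_form v bil_right[OF f]) auto
  then show ?thesis using v by (auto simp: eigen_def)
qed

text \<open>In dimension two the line \<open>\<langle>v\<rangle>\<close> would be its own orthogonal complement and there would
  be no nonzero cone on the hyperplane; this is where \<open>n \<ge> 2\<close> enters.\<close>

lemma perp_not_isotropic:
  assumes "v \<noteq> 0"
  shows "\<exists>w x. \<omega> v w = 0 \<and> \<omega> v x = 0 \<and> \<omega> w x \<noteq> 0"
proof (rule ccontr)
  assume no: "\<not> ?thesis"
  obtain y where y: "\<omega> v y = 1" using pairing_one assms by blast
  have "u \<in> span {v, y}" for u
  proof -
    define w where "w = u - scale (\<omega> v u) y"
    have "\<omega> v w = 0" by (simp add: w_def bilinear_simps y)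
    then have "hyp v \<subseteq> hyp w" using no by auto
    then obtain c where "w = scale c v" using hyp_subset[OF assms] by blast
    then have "u = scale c v + scale (\<omega> v u) y" by (simp add: w_def algebra_simps)
    also have "\<dots> \<in> span {v, y}" by (intro span_add span_scale span_base) auto
    finally show ?thesis .
  qed
  then have "dim UNIV \<le> card {v, y}" by (intro dim_le_card) auto
  also have "\<dots> \<le> 2" by (simp add: card_insert_if)
  finally show False using dimension n2 by simp
qed

text \<open>For an eigenvector \<open>v\<close> of \<open>f\<close>, the form \<open>f\<close> itself restricts to a cone, unless it vanishes on the
  hyperplane; then the square of a linear form vanishing at \<open>v\<close> serves as \<open>q\<close>.\<close>

lemma eigen_cone_pt:
  assumes f: "quadratic f" "f \<noteq> (\<lambda>_. 0)" and "eigen f v t"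
  shows "\<exists>q. cone_pt v q f"
proof (cases "\<exists>x. \<omega> v x = 0 \<and> f x \<noteq> 0")
  case True
  then have "cone_pt v f f"
    using assms by (auto simp: cone_pt_def eigen_def intro!: exI[of _ 1])
  then show ?thesis by blast
next
  case False
  have v: "v \<noteq> 0" using assms(3) by (simp add: eigen_def)
  obtain w x where w: "\<omega> v w = 0" "\<omega> v x = 0" "\<omega> w x \<noteq> 0" using perp_not_isotropic[OF v] by blast
  have q: "quadratic (\<lambda>x. \<omega> w x * \<omega> w x)"
    "bil (\<lambda>x. \<omega> w x * \<omega> w x) y z = (\<omega> w y * \<omega> w z + \<omega> w z * \<omega> w y) / 2" for y z
    by (rule quadratic_prod; simp add: bilinear_simps)+
  have "\<omega> w v = 0" using skew[of w v] w(1) by simp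
  then have "cone_pt v (\<lambda>x. \<omega> w x * \<omega> w x) f"
    unfolding cone_pt_def q(2)
    using v f q(1) w(2,3) False by (intro conjI exI[of _ x] exI[of _ 0]) auto
  then show ?thesis by blast
qed

lemma rho_surj: "rho ` points X = points Y"
proof (intro equalityI subsetI)
  fix F assume "F \<in> rho ` points X"
  then obtain x where x: "x \<in> points X" "F = rho x" by blast
  then obtain v q f where "x = (hyp v, line (restr (hyp v) q), line f)" "cone_pt v q f"
    by (metis points_incidenceE)
  then show "F \<in> points Y" using x by (auto simp: rho_def points_Y cone_pt_def)
next
  fix F assume "F \<in> points Y"
  then obtain f where f: "F = line f" "quadratic f" "f \<noteq> (\<lambda>_. 0)" by (auto simp: points_Y)
  obtain v t where "eigen f v t" using eigen_exists[OF f(2)] by blast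
  then obtain q where q: "cone_pt v q f" using eigen_cone_pt[OF f(2,3)] by blast
  then have "(hyp v, line (restr (hyp v) q), line f) \<in> points X"
    using points_incidence_iff[of v q f] by (simp add: cone_pt_def)
  then show "F \<in> rho ` points X" using f(1) by (auto simp: rho_def image_iff intro: bexI[rotated])
qed

section \<open>Irreducibility\<close>

text \<open>Families of vectors depending polynomially on a parameter; pairing with fixed vectors stands in for taking
  coordinates.\<close>

definition polyvec :: "(complex \<Rightarrow> 'v) \<Rightarrow> bool" where
  "polyvec w \<longleftrightarrow> (\<forall>a. (\<lambda>z. \<omega> a (w z)) \<in> polyfuns)"

lemma polyvec_intros:
  fixes u w :: "complex \<Rightarrow> 'v"
  shows "polyvec (\<lambda>_. a)" "polyvec u \<Longrightarrow> polyvec w \<Longrightarrow> polyvec (\<lambda>z. u z + w z)"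
  "polyvec u \<Longrightarrow> polyvec w \<Longrightarrow> polyvec (\<lambda>z. u z - w z)"
  "h \<in> polyfuns \<Longrightarrow> polyvec w \<Longrightarrow> polyvec (\<lambda>z. scale (h z) (w z))"
  by (auto simp: polyvec_def bilinear_simps intro!: polyfuns_intros)

lemma polyvec_pairing:
  assumes "polyvec u" "polyvec w"
  shows "(\<lambda>z. \<omega> (u z) (w z)) \<in> polyfuns"
proof -
  have "\<omega> (u z) (w z) = (\<Sum>i<2*n. \<omega> (d i) (u z) * \<omega> (e i) (w z))" for z
    using sum_left[of "\<lambda>i. scale (\<omega> (d i) (u z)) (e i)" "{..<2*n}" "w z"]
    by (simp add: expand scale_left)
  then show ?thesis using assms by (auto simp: polyvec_def intro!: polyfuns_intros)
qed

text \<open>The forms \<open>q\<close> in a parametrization of the cone over the incidence by an affine space.  The map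
  \<open>x \<mapsto> \<omega>(v,y) x - \<omega>(x,y) v\<close> sends \<open>v\<close> to \<open>0\<close>, so composed with it the quadratic form with matrix \<open>R\<close>
  has \<open>v\<close> in its radical; the last summand vanishes on the hyperplane.\<close>

definition param_q :: "'v \<Rightarrow> 'v \<Rightarrow> (nat \<Rightarrow> nat \<Rightarrow> complex) \<Rightarrow> 'v \<Rightarrow> 'v \<Rightarrow> complex" where
  "param_q v y R m x = (\<Sum>i<2*n. \<Sum>j<2*n. R i j *
      (\<omega> (d i) (scale (\<omega> v y) x - scale (\<omega> x y) v) * \<omega> (d j) (scale (\<omega> v y) x - scale (\<omega> x y) v)))
    + \<omega> v x * \<omega> m x"

lemma quadratic_param_q: "quadratic (param_q v y R m)"
  unfolding param_q_def
  by (intro quadratic_add quadratic_sum quadratic_scale quadratic_prod(1))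
     (simp_all add: bilinear_simps algebra_simps)

lemma param_q_radical:
  assumes "\<omega> v x = 0"
  shows "bil (param_q v y R m) v x = 0"
proof -
  have "scale (\<omega> v y) (v + x) - scale (\<omega> (v + x) y) v = scale (\<omega> v y) x - scale (\<omega> x y) v"
    by (simp add: bilinear_simps scale_left_distrib scale_right_distrib)
  then show ?thesis using assms by (simp add: bil_def param_q_def bilinear_simps alternating)
qed

text \<open>With \<open>\<omega>(v,y) = 1\<close>, write \<open>x\<close> as the sum of a vector of the hyperplane and \<open>\<omega>(v,x) y\<close>: the
  square term of the first vanishes, and the other terms have the factor \<open>\<omega>(v,x)\<close>.\<close>

lemma vanishing_on_hyp:
  assumes v: "v \<noteq> 0" and g: "quadratic g" "\<And>x. \<omega> v x = 0 \<Longrightarrow> g x = 0"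
  shows "\<exists>m. \<forall>x. g x = \<omega> v x * \<omega> m x"
proof -
  obtain y where y: "\<omega> v y = 1" using pairing_one v by blast
  define l where "l x = 2 * bil g x y - g y * \<omega> v x" for x
  have "l \<in> linear_forms scale UNIV"
    by (simp add: l_def linear_forms_def bil_left[OF g(1)] bilinear_simps algebra_simps)
  then obtain m where m: "l = \<omega> m" using linear_forms_UNIV by blast
  have "g x = \<omega> v x * l x" for x
  proof -
    have "g (x - scale (\<omega> v x) y) = 0" by (rule g(2)) (simp add: bilinear_simps y)
    then show ?thesis
      unfolding l_def quadratic_values(4)[OF g(1)] quadratic_values(2)[OF g(1)] bil_right[OF g(1)]
      by (simp add: algebra_simps)
  qed
  then show ?thesis using m by blast
qed

lemma cone_pt_param:
  assumes "v \<noteq> 0" "\<omega> v x \<noteq> 0 \<Longrightarrow> False" "param_q v y R m x \<noteq> 0"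
    "f = (\<lambda>x. c * param_q v y R m x + \<omega> v x * \<omega> m' x)" "f \<noteq> (\<lambda>_. 0)"
  shows "cone_pt v (param_q v y R m) f"
proof -
  have "quadratic (\<lambda>x. \<omega> v x * \<omega> m' x)" by (rule quadratic_prod) (simp_all add: bilinear_simps)
  then have "quadratic f"
    unfolding assms(4) by (intro quadratic_add quadratic_scale quadratic_param_q)
  then show ?thesis
    unfolding cone_pt_def using assms quadratic_param_q param_q_radical
    by (auto intro!: exI[of _ c])
qed

text \<open>The parametrization reaches every point of the cone: choose \<open>y\<close> with \<open>\<omega>(v,y) = 1\<close> and let \<open>R\<close> be the
  matrix of \<open>q\<close>.  The difference of \<open>q\<close> and \<open>q\<close> composed with the projection, and the difference of \<open>f\<close>
  and \<open>c q\<close>, vanish on the hyperplane and are therefore divisible by its equation.\<close>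

lemma cone_ptE:
  assumes "cone_pt v q f"
  obtains y R m c m' x where "v \<noteq> 0" "\<omega> v x = 0" "q x \<noteq> 0" "q = param_q v y R m"
    "f = (\<lambda>x. c * q x + \<omega> v x * \<omega> m' x)" "f \<noteq> (\<lambda>_. 0)"
proof -
  have v: "v \<noteq> 0" and q: "quadratic q" and f: "quadratic f" "f \<noteq> (\<lambda>_. 0)"
    and rad: "\<And>x. \<omega> v x = 0 \<Longrightarrow> bil q v x = 0"
    using assms by (auto simp: cone_pt_def)
  obtain x c where x: "\<omega> v x = 0" "q x \<noteq> 0" and c: "\<And>x. \<omega> v x = 0 \<Longrightarrow> f x = c * q x"
    using assms by (auto simp: cone_pt_def)
  obtain y where y: "\<omega> v y = 1" using pairing_one v by blast
  define R where "R i j = bil q (e i) (e j)" for i j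
  have "q x - param_q v y R 0 x = 0" if "\<omega> v x = 0" for x
  proof -
    have "param_q v y R 0 x = q (x - scale (\<omega> x y) v)"
      unfolding quadratic_coordinates[OF q, of "x - scale (\<omega> x y) v"]
      by (simp add: param_q_def R_def y)
    also have "\<dots> = q x"
      using rad[OF that] rad[of v] bil_sym[of q x v] alternating[of v] bil_diag[OF q, of v]
      by (simp add: quadratic_values[OF q] bil_right[OF q])
    finally show ?thesis by simp
  qed
  moreover have "quadratic (\<lambda>x. q x - param_q v y R 0 x)"
    using quadratic_lin(1)[OF q quadratic_param_q, of 1 "-1"] by simp
  ultimately obtain m where m: "\<And>x. q x - param_q v y R 0 x = \<omega> v x * \<omega> m x"
    using vanishing_on_hyp[OF v] by blast
  have "q x = param_q v y R m x" for x using m[of x] by (simp add: param_q_def algebra_simps)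
  then have 1: "q = param_q v y R m" by blast
  have "\<exists>m'. \<forall>x. f x - c * q x = \<omega> v x * \<omega> m' x"
    using quadratic_lin(1)[OF f(1) q, of 1 "- c"] c by (intro vanishing_on_hyp[OF v]) simp_all
  then obtain m' where "\<And>x. f x - c * q x = \<omega> v x * \<omega> m' x" by blast
  then have "f = (\<lambda>x. c * q x + \<omega> v x * \<omega> m' x)" by (auto simp: algebra_simps fun_eq_iff)
  then show ?thesis using that[OF v x 1 _ f(2)] by blast
qed

lemma polyfuns_param_q:
  assumes "polyvec v" "polyvec y" "\<And>i j. (\<lambda>z. R z i j) \<in> polyfuns" "polyvec m" "polyvec x"
  shows "(\<lambda>z. param_q (v z) (y z) (R z) (m z) (x z)) \<in> polyfuns"
proof -
  have p: "polyvec (\<lambda>z. scale (\<omega> (v z) (y z)) (x z) - scale (\<omega> (x z) (y z)) (v z))"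
    using assms by (intro polyvec_intros polyvec_pairing)
  show ?thesis
    unfolding param_q_def
    by (intro polyfuns_intros assms polyvec_pairing polyvec_intros p)
qed

definition blend :: "complex \<Rightarrow> 'v \<Rightarrow> 'v \<Rightarrow> 'v" where
  "blend z a b = scale (1 - z) a + scale z b"

lemma polyvec_blend: "polyvec (\<lambda>z. blend z a b)"
  unfolding blend_def by (intro polyvec_intros polyfuns_intros)

lemma blend_ends [simp]: "blend 0 a b = a" "blend 1 a b = b"
  by (simp_all add: blend_def)

text \<open>Two points of the cone are joined by the image of a line in the parameter space.  Along this line, the
  two given polynomial functions and the conditions that define the cone are polynomials in one variable
  that are not identically zero, so some point of the line is a root of none of them.\<close>

lemma irreducible_X: "irreducible_variety X"
proof (rule irreducible_varietyI)
  have "line f1 \<in> points Y" using f1 y0 by (auto simp: points_Y)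
  then show "points X \<noteq> {}" using rho_surj by auto
  show "points X \<subseteq> quot X ` ambient X" by (rule covered_incidence)
  fix c0 c1 p0 p1
  assume c: "c0 \<in> cone_over X UNIV" "c1 \<in> cone_over X UNIV"
    and p: "p0 \<in> polys X" "p1 \<in> polys X"
    and ne: "p0 c0 \<noteq> 0" "p1 c1 \<noteq> 0"
  have "\<exists>v q f. c = (\<omega> v, q, f) \<and> cone_pt v q f" if "c \<in> cone_over X UNIV" for c
    using that by (cases c) (auto simp: cone_incidence)
  note split = this
  obtain v0 q0 g0 where c0: "c0 = (\<omega> v0, q0, g0)" "cone_pt v0 q0 g0" using split[OF c(1)] by blast
  obtain v1 q1 g1 where c1: "c1 = (\<omega> v1, q1, g1)" "cone_pt v1 q1 g1" using split[OF c(2)] by blast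
  obtain y R m s m' x where 0: "v0 \<noteq> 0" "\<omega> v0 x = 0" "q0 x \<noteq> 0" "q0 = param_q v0 y R m"
    "g0 = (\<lambda>x. s * q0 x + \<omega> v0 x * \<omega> m' x)" "g0 \<noteq> (\<lambda>_. 0)"
    by (rule cone_ptE[OF c0(2)])
  obtain y1 R1 m1 s1 m1' where 1: "q1 = param_q v1 y1 R1 m1" "g1 = (\<lambda>x. s1 * q1 x + \<omega> v1 x * \<omega> m1' x)"
    using cone_ptE[OF c1(2)] by metis
  define V where "V z = blend z v0 v1" for z
  define q where "q z = param_q (V z) (blend z y y1) (\<lambda>i j. (1 - z) * R i j + z * R1 i j) (blend z m m1)" for z
  define f where "f z u = ((1 - z) * s + z * s1) * q z u + \<omega> (V z) u * \<omega> (blend z m' m1') u" for z u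
  have V: "polyvec V" unfolding V_def by (rule polyvec_blend)
  have q: "(\<lambda>z. q z (x z)) \<in> polyfuns" if "polyvec x" for x
    unfolding q_def by (intro polyfuns_param_q V polyvec_blend that polyfuns_intros)
  have f: "(\<lambda>z. f z u) \<in> polyfuns" for u
    unfolding f_def by (intro polyfuns_intros q polyvec_pairing V polyvec_blend polyvec_intros)
  have ends: "(\<omega> (V 0), q 0, f 0) = c0" "(\<omega> (V 1), q 1, f 1) = c1"
    using 0(4,5) 1 by (simp_all add: c0(1) c1(1) V_def q_def f_def fun_eq_iff)
  have P: "(\<lambda>z. p (\<omega> (V z), q z, f z)) \<in> polyfuns" if "p \<in> polys X" for p
    using that
  proof induction
    case (coord p)
    then show ?case
      by (auto simp: incidence_def intro!: f q polyvec_intros polyvec_pairing V)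
  qed (auto intro!: polyfuns_intros)
  \<comment> \<open>The witness that the restriction of \<open>q\<close> to the hyperplane is nonzero must move with the
    hyperplane.\<close>
  obtain a where a: "\<omega> v0 a = 1" using pairing_one 0(1) by blast
  define xx where "xx z = scale (\<omega> (V z) a) x - scale (\<omega> (V z) x) a" for z
  have xx: "polyvec xx" unfolding xx_def by (intro polyvec_intros polyvec_pairing V)
  have xx0: "xx 0 = x" using a 0(2) by (simp add: xx_def V_def)
  obtain u where u: "g0 u \<noteq> 0" using 0(6) by auto
  let ?S = "{\<lambda>z. p0 (\<omega> (V z), q z, f z), \<lambda>z. p1 (\<omega> (V z), q z, f z), \<lambda>z. \<omega> (V z) a,
    \<lambda>z. q z (xx z), \<lambda>z. f z u}"
  have "\<exists>z. \<forall>h\<in>?S. h z \<noteq> 0"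
  proof (rule exists_common_nonroot)
    have "p0 (\<omega> (V 0), q 0, f 0) \<noteq> 0" "p1 (\<omega> (V 1), q 1, f 1) \<noteq> 0" "\<omega> (V 0) a \<noteq> 0"
      "q 0 (xx 0) \<noteq> 0" "f 0 u \<noteq> 0"
      using ends ne a u 0(3) xx0 c0(1) by (auto simp: V_def)
    moreover have "(\<lambda>z. \<omega> (V z) a) \<in> polyfuns" by (intro polyvec_pairing V polyvec_intros)
    ultimately show "h \<in> polyfuns \<and> (\<exists>a. h a \<noteq> 0)" if "h \<in> ?S" for h
      using that P[OF p(1)] P[OF p(2)] q[OF xx] f[of u] by blast
  qed simp
  then obtain z where z: "p0 (\<omega> (V z), q z, f z) \<noteq> 0" "p1 (\<omega> (V z), q z, f z) \<noteq> 0" "\<omega> (V z) a \<noteq> 0"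
      "q z (xx z) \<noteq> 0" "f z u \<noteq> 0" by auto
  have "\<omega> (V z) (xx z) = 0" by (simp add: xx_def bilinear_simps mult.commute)
  moreover have "f z = (\<lambda>x. ((1 - z) * s + z * s1) * q z x + \<omega> (V z) x * \<omega> (blend z m' m1') x)"
    by (simp add: fun_eq_iff f_def)
  moreover have "V z \<noteq> 0" "f z \<noteq> (\<lambda>_. 0)" using z(3,5) by auto
  ultimately have "cone_pt (V z) (q z) (f z)"
    using cone_pt_param[where v = "V z" and x = "xx z" and y = "blend z y y1" and m = "blend z m m1"
        and R = "\<lambda>i j. (1 - z) * R i j + z * R1 i j" and f = "f z" and m' = "blend z m' m1'",
        folded q_def] z(4) by blast
  then have "(\<omega> (V z), q z, f z) \<in> cone_over X UNIV" by (auto simp: cone_incidence)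
  then show "\<exists>c\<in>cone_over X UNIV. p0 c \<noteq> 0 \<and> p1 c \<noteq> 0" using z by blast
qed

lemma polynomial_function_on_line:
  assumes "p \<in> polys Y"
  shows "(\<lambda>z. p (\<lambda>x. (1 - z) * f x + z * g x)) \<in> polyfuns"
  using assms
proof induction
  case (coord p)
  then show ?case by (auto simp: proj_forms_def intro!: polyfuns_intros)
qed (auto intro!: polyfuns_intros)

text \<open>The same argument, along a line of quadratic forms.\<close>

lemma irreducible_Y: "irreducible_variety Y"
proof (rule irreducible_varietyI)
  have "line f1 \<in> points Y" using f1 y0 by (auto simp: points_Y)
  then show "points Y \<noteq> {}" by blast
  show "points Y \<subseteq> quot Y ` ambient Y" by (rule covered_Y)
  fix f g p0 p1
  assume c: "f \<in> cone_over Y UNIV" "g \<in> cone_over Y UNIV"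
    and p: "p0 \<in> polys Y" "p1 \<in> polys Y"
    and ne: "p0 f \<noteq> 0" "p1 g \<noteq> 0"
  have fg: "quadratic f" "quadratic g" "f \<noteq> (\<lambda>_. 0)" using c by (simp_all add: cone_Y)
  obtain u where u: "f u \<noteq> 0" using fg(3) by auto
  define h where "h z = (\<lambda>x. (1 - z) * f x + z * g x)" for z
  have "\<exists>z. \<forall>k\<in>{\<lambda>z. p0 (h z), \<lambda>z. p1 (h z), \<lambda>z. h z u}. k z \<noteq> 0"
  proof (rule exists_common_nonroot)
    have "p0 (h 0) \<noteq> 0" "p1 (h 1) \<noteq> 0" "h 0 u \<noteq> 0" using ne u by (simp_all add: h_def)
    moreover have "(\<lambda>z. h z u) \<in> polyfuns" unfolding h_def by (intro polyfuns_intros)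
    ultimately show "k \<in> polyfuns \<and> (\<exists>a. k a \<noteq> 0)"
      if "k \<in> {\<lambda>z. p0 (h z), \<lambda>z. p1 (h z), \<lambda>z. h z u}" for k
      using that polynomial_function_on_line[OF p(1), of f g] polynomial_function_on_line[OF p(2), of f g]
      unfolding h_def by blast
  qed simp
  then obtain z where z: "p0 (h z) \<noteq> 0" "p1 (h z) \<noteq> 0" "h z u \<noteq> 0" by auto
  have "quadratic (h z)" unfolding h_def by (rule quadratic_lin(1)[OF fg(1,2)])
  then have "h z \<in> cone_over Y UNIV" using z(3) by (auto simp: cone_Y)
  then show "\<exists>c\<in>cone_over Y UNIV. p0 c \<noteq> 0 \<and> p1 c \<noteq> 0" using z by blast
qed

text \<open>The projection to \<open>f\<close> pulls polynomial functions back to polynomial functions.\<close>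

lemma morphism_rho: "morphism X Y rho"
proof -
  have comp: "(\<lambda>(l, q, f). p f) \<in> polys X" if "p \<in> polys Y" for p
    using that
  proof induction
    case (const a)
    then show ?case using polynomial_functions.const[of a "coords X"] by (simp add: case_prod_unfold)
  next
    case (coord p)
    then obtain u where "p = (\<lambda>f. f u)" by (auto simp: proj_forms_def)
    then show ?case by (intro polynomial_functions.coord) (auto simp: incidence_def)
  next
    case (add p p')
    then show ?case using polynomial_functions.add[OF add.IH] by (simp add: case_prod_unfold)
  next
    case (mult p p')
    then show ?case using polynomial_functions.mult[OF mult.IH] by (simp add: case_prod_unfold)
  qed
  have cone: "f \<in> cone_over Y V" "quot Y f = rho (quot X (l, q, f))"
    if cone_pt: "(l, q, f) \<in> cone_over X {x \<in> points X. rho x \<in> V}" for l q f V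
  proof -
    obtain v where v: "cone_pt v q f" "rho (quot X (l, q, f)) \<in> V"
      using cone_pt unfolding cone_incidence by blast
    then have "quadratic f" "f \<noteq> (\<lambda>_. 0)" "rho (quot X (l, q, f)) = line f"
      by (simp_all add: cone_pt_def quot_incidence rho_def)
    then show "f \<in> cone_over Y V" "quot Y f = rho (quot X (l, q, f))"
      using v(2) by (simp_all add: cone_Y) (simp add: proj_forms_def)
  qed
  have cont: "openin (zariski X) {x \<in> points X. rho x \<in> V}" if V: "openin (zariski Y) V" for V
    unfolding openin_zariski_iff
  proof (intro conjI ballI)
    fix c assume c: "c \<in> cone_over X {x \<in> points X. rho x \<in> V}"
    obtain l q f where [simp]: "c = (l, q, f)" by (cases c)
    obtain p where p: "p \<in> polys Y" "p f \<noteq> 0"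
      "\<forall>f'\<in>cone_over Y UNIV. p f' \<noteq> 0 \<longrightarrow> quot Y f' \<in> V"
      using V cone(1)[of l q f V] c unfolding openin_zariski_iff by auto
    show "\<exists>p\<in>polys X. p c \<noteq> 0 \<and>
        (\<forall>c'\<in>cone_over X UNIV. p c' \<noteq> 0 \<longrightarrow> quot X c' \<in> {x \<in> points X. rho x \<in> V})"
    proof (intro bexI conjI ballI impI)
      show "(\<lambda>(l, q, f). p f) \<in> polys X" by (rule comp[OF p(1)])
      show "(\<lambda>(l, q, f). p f) c \<noteq> 0" using p(2) by simp
      fix c' assume c': "c' \<in> cone_over X UNIV" "(\<lambda>(l, q, f). p f) c' \<noteq> 0"
      obtain l' q' f' where [simp]: "c' = (l', q', f')" by (cases c')
      have pt: "quot X c' \<in> points X" using c'(1) by (simp add: cone_over_def)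
      then have in': "(l', q', f') \<in> cone_over X {x \<in> points X. rho x \<in> UNIV}"
        using c'(1) by (auto simp: cone_over_def)
      have "quot Y f' \<in> V" using p(3) cone(1)[OF in'] c'(2) by simp
      then show "quot X c' \<in> {x \<in> points X. rho x \<in> V}" using cone(2)[OF in'] pt by simp
    qed
  qed auto
  show ?thesis
    unfolding morphism_def
  proof (intro conjI allI impI)
    show "continuous_map (zariski X) (zariski Y) rho"
      unfolding continuous_map_def using cont rho_surj by auto
    fix V h assume V: "openin (zariski Y) V \<and> regular_on Y V h"
    show "regular_on X {x \<in> points X. rho x \<in> V} (h \<circ> rho)"
    proof (rule regular_onI)
      fix c assume c: "c \<in> cone_over X {x \<in> points X. rho x \<in> V}"
      obtain l q f where [simp]: "c = (l, q, f)" by (cases c)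
      obtain p p' where p: "p \<in> polys Y" "p' \<in> polys Y"
        "p' f \<noteq> 0" "\<And>f'. f' \<in> cone_over Y V \<Longrightarrow> p' f' \<noteq> 0 \<Longrightarrow> h (quot Y f') = p f' / p' f'"
        using regular_onE[OF V[THEN conjunct2] cone(1)[of l q f V]] c by auto
      show "\<exists>p\<in>polys X. \<exists>p'\<in>polys X. p' c \<noteq> 0 \<and>
          (\<forall>c'\<in>cone_over X {x \<in> points X. rho x \<in> V}. p' c' \<noteq> 0 \<longrightarrow> (h \<circ> rho) (quot X c') = p c' / p' c')"
      proof (rule bexI[OF _ comp[OF p(1)]], rule bexI[OF _ comp[OF p(2)]], intro conjI ballI impI)
        show "(\<lambda>(l, q, f). p' f) c \<noteq> 0" using p(3) by simp
        fix c' assume c': "c' \<in> cone_over X {x \<in> points X. rho x \<in> V}" "(\<lambda>(l, q, f). p' f) c' \<noteq> 0"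
        obtain l' q' f' where [simp]: "c' = (l', q', f')" by (cases c')
        show "(h \<circ> rho) (quot X c') = (\<lambda>(l, q, f). p f) c' / (\<lambda>(l, q, f). p' f) c'"
          using p(4)[OF cone(1)[of l' q' f' V]] cone(2)[of l' q' f' V] c' by simp
      qed
    qed
  qed
qed

section \<open>Forms with distinct eigenvalues are dense\<close>

text \<open>Join a form \<open>f0\<close> in the open set to \<open>f1\<close> by a line.  Close to \<open>f1\<close> the characteristic polynomial has a root
  near each of the \<open>2n\<close> distinct eigenvalues of \<open>f1\<close>, while all but finitely many forms of the line lie in
  the open set.\<close>

lemma dense_distinct_eigenvalues:
  assumes V: "openin (zariski Y) V" "V \<noteq> {}"
  shows "\<exists>f. quadratic f \<and> line f \<in> V \<and> f y0 \<noteq> 0 \<and> (\<exists>T. card T = 2 * n \<and> (\<forall>t\<in>T. \<exists>v. eigen f v t))"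
proof -
  obtain F where F: "F \<in> V" using V(2) by blast
  then have "F \<in> points Y" using openin_zariski_subset[OF V(1)] by blast
  then obtain f0 where f0: "F = line f0" "quadratic f0" "f0 \<noteq> (\<lambda>_. 0)" by (auto simp: points_Y)
  have "f0 \<in> cone_over Y V" using f0 F by (simp add: cone_Y)
  then obtain p where p: "p \<in> polys Y" "p f0 \<noteq> 0"
    "\<forall>f\<in>cone_over Y UNIV. p f \<noteq> 0 \<longrightarrow> quot Y f \<in> V" using V(1) unfolding openin_zariski_iff by blast
  define h where "h z = (\<lambda>x. (1 - z) * f0 x + z * f1 x)" for z
  have qh: "quadratic (h z)" for z unfolding h_def by (rule quadratic_lin(1)[OF f0(2) f1])
  have ev1: "eventually (\<lambda>z. p (h z) \<noteq> 0) (at 1)"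
    unfolding h_def by (rule polyfuns_eventually[OF polynomial_function_on_line[OF p(1)], where a = 0]) (simp add: p(2))
  have ev2: "eventually (\<lambda>z. h z y0 \<noteq> 0) (at 1)"
    by (rule polyfuns_eventually[where a = 1]) (auto simp: h_def y0 intro!: polyfuns_intros)
  \<comment> \<open>Half the smallest distance between two eigenvalues of \<open>f1\<close>.\<close>
  define D where "D = insert 1 {cmod (\<mu> i - \<mu> j) |i j. i < 2 * n \<and> j < 2 * n \<and> i \<noteq> j}"
  have "finite {cmod (\<mu> i - \<mu> j) |i j. i < 2 * n \<and> j < 2 * n \<and> i \<noteq> j}"
    by (rule finite_subset[of _ "(\<lambda>(i, j). cmod (\<mu> i - \<mu> j)) ` ({..<2*n} \<times> {..<2*n})"]) auto
  then have D: "finite D" "D \<noteq> {}" by (auto simp: D_def)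
  define \<epsilon> where "\<epsilon> = Min D / 2"
  have "\<forall>x\<in>D. 0 < x" using inj_\<mu> by (auto simp: D_def inj_on_def)
  then have \<epsilon>: "\<epsilon> > 0" using D by (simp add: \<epsilon>_def)
  have sep: "2 * \<epsilon> \<le> cmod (\<mu> i - \<mu> j)" if "i < 2 * n" "j < 2 * n" "i \<noteq> j" for i j
    using Min_le[OF D(1)] that by (auto simp: \<epsilon>_def D_def)
  have near: "eventually (\<lambda>z. \<exists>s. poly (char_poly (endo (h z))) s = 0 \<and> cmod (\<mu> i - s) < \<epsilon>) (at 1)"
    if i: "i < 2 * n" for i
  proof -
    let ?S = "{P. (\<lambda>z::complex. poly (P z) (\<mu> i)) \<in> polyfuns}"
    have "function_algebra ?S" by (auto simp: function_algebra_def intro!: polyfuns_intros)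
    moreover have "(\<lambda>z. [:endo (h z) $$ (k, j):]) \<in> ?S" if "k < 2 * n" "j < 2 * n" for k j
    proof -
      have "(\<lambda>z. endo (h z) $$ (k, j)) = (\<lambda>z. - ((h z (e j + d k) - h z (e j) - h z (d k)) * (1 / 2)))"
        using that by (simp add: endo_def bil_def)
      also have "\<dots> \<in> polyfuns" unfolding h_def by (intro polyfuns_intros)
      finally show ?thesis by simp
    qed
    ultimately have "(\<lambda>z. char_poly (endo (h z))) \<in> ?S"
      by (intro function_algebra_char_poly[where k = "2*n"]) (auto intro!: polyfuns_intros)
    then have "((\<lambda>z. poly (char_poly (endo (h z))) (\<mu> i)) \<longlongrightarrow> poly (char_poly (endo (h 1))) (\<mu> i)) (at 1)"
      using polyfuns_tendsto[of _ 1] by auto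
    moreover have "poly (char_poly (endo (h 1))) (\<mu> i) = 0"
    proof -
      have "e i \<noteq> 0" using dual[OF i i] by auto
      then have "eigen f1 (e i) (\<mu> i)" using diag[OF i] by (simp add: eigen_def)
      then show ?thesis using eigenvalue_endo_iff[OF f1] by (auto simp: h_def)
    qed
    ultimately have "((\<lambda>z. poly (char_poly (endo (h z))) (\<mu> i)) \<longlongrightarrow> 0) (at 1)" by simp
    then have "eventually (\<lambda>z. cmod (poly (char_poly (endo (h z))) (\<mu> i)) < \<epsilon> ^ (2 * n)) (at 1)"
      by (auto dest: tendstoD[where e = "\<epsilon> ^ (2*n)"] simp: \<epsilon>)
    then show ?thesis
      by (rule eventually_mono) (rule char_poly_root_near[OF endo_carrier _ \<epsilon>])
  qed
  then have "eventually (\<lambda>z. \<forall>i\<in>{..<2*n}. \<exists>s. poly (char_poly (endo (h z))) s = 0 \<and> cmod (\<mu> i - s) < \<epsilon>) (at 1)"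
    by (intro eventually_ball_finite) auto
  then have "eventually (\<lambda>z. p (h z) \<noteq> 0 \<and> h z y0 \<noteq> 0 \<and>
      (\<forall>i\<in>{..<2*n}. \<exists>s. poly (char_poly (endo (h z))) s = 0 \<and> cmod (\<mu> i - s) < \<epsilon>)) (at 1)"
    by (intro eventually_conj ev1 ev2)
  then obtain z where z: "p (h z) \<noteq> 0" "h z y0 \<noteq> 0"
    "\<forall>i\<in>{..<2*n}. \<exists>s. poly (char_poly (endo (h z))) s = 0 \<and> cmod (\<mu> i - s) < \<epsilon>"
    using eventually_happens'[OF at_neq_bot] by blast
  obtain s where s: "\<And>i. i < 2 * n \<Longrightarrow> poly (char_poly (endo (h z))) (s i) = 0"
    "\<And>i. i < 2 * n \<Longrightarrow> cmod (\<mu> i - s i) < \<epsilon>"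
    using bchoice[OF z(3)] by auto
  have "inj_on s {..<2*n}"
  proof (rule inj_onI, rule ccontr)
    fix i j assume ij: "i \<in> {..<2*n}" "j \<in> {..<2*n}" "s i = s j" "i \<noteq> j"
    have "cmod (\<mu> i - \<mu> j) \<le> cmod (\<mu> i - s i) + cmod (\<mu> j - s j)"
      using norm_triangle_ineq4[of "\<mu> i - s i" "\<mu> j - s j"] ij(3) by simp
    then show False using sep[of i j] s(2)[of i] s(2)[of j] ij by simp
  qed
  then have "card (s ` {..<2*n}) = 2 * n" by (simp add: card_image)
  moreover have "\<forall>t\<in>s ` {..<2*n}. \<exists>v. eigen (h z) v t"
    using s(1) eigenvalue_endo_iff[OF qh] by auto
  moreover have "line (h z) \<in> V"
  proof -
    have "h z \<in> cone_over Y UNIV" using qh[of z] z(2) by (auto simp: cone_Y)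
    then show ?thesis using p(3) z(1) by (auto simp: proj_forms_def)
  qed
  ultimately show ?thesis using qh z(2) by blast
qed

end

section \<open>The extension of function fields\<close>

type_synonym 'v incidence_point = "'v set \<times> ('v \<Rightarrow> complex) set \<times> ('v \<Rightarrow> complex) set"

context symplectic_frame
begin

lemma surjective_morphism_rho: "surjective_morphism X Y rho"
  unfolding surjective_morphism_def surjective_morphism_axioms_def irreducible_def
  using irreducible_X irreducible_Y morphism_rho rho_surj by blast

interpretation XY: surjective_morphism X Y rho
  by (rule surjective_morphism_rho)

interpretation L: field "function_field X"
  by (rule XY.X.field_function_field)

text \<open>Homogeneous coordinates normalized to take the value \<open>1\<close> at \<open>y0\<close> and at \<open>d 0\<close>.  As functions of a point
  they do not depend on the choice of representative, so polynomials in them are functions on the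
  incidence, whether homogeneous or not.\<close>

definition fhat :: "('v \<Rightarrow> complex) set \<Rightarrow> 'v \<Rightarrow> complex" where
  "fhat F u = (SOME f. f \<in> F \<and> f y0 \<noteq> 0) u / (SOME f. f \<in> F \<and> f y0 \<noteq> 0) y0"

definition lhat :: "'v set \<Rightarrow> 'v \<Rightarrow> complex" where
  "lhat H u = \<omega> (SOME v. v \<noteq> 0 \<and> H = hyp v) u / \<omega> (SOME v. v \<noteq> 0 \<and> H = hyp v) (d 0)"

lemma fhat_line:
  assumes "f y0 \<noteq> 0"
  shows "fhat (line f) = (\<lambda>u. f u / f y0)"
proof -
  let ?f = "SOME g. g \<in> line f \<and> g y0 \<noteq> 0"
  have "?f \<in> line f \<and> ?f y0 \<noteq> 0"
    by (rule someI[of _ f]) (use assms self_in_line in auto)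
  then obtain c where "?f = (\<lambda>u. c * f u)" "c \<noteq> 0" by (auto simp: line_def)
  then show ?thesis by (auto simp: fhat_def fun_eq_iff)
qed

lemma hyp_eqD:
  assumes "hyp v = hyp v'" "v \<noteq> 0" "v' \<noteq> 0"
  shows "\<exists>c. c \<noteq> 0 \<and> v' = scale c v"
  using hyp_subset[OF assms(2), of v'] assms by auto

lemma lhat_hyp:
  assumes "v \<noteq> 0"
  shows "lhat (hyp v) u = \<omega> v u / \<omega> v (d 0)"
proof -
  let ?v = "SOME w. w \<noteq> 0 \<and> hyp v = hyp w"
  have "?v \<noteq> 0 \<and> hyp v = hyp ?v"
    by (rule someI[of _ v]) (use assms in auto)
  then obtain c where "c \<noteq> 0" "?v = scale c v" using hyp_eqD[of v ?v] assms by blast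
  then show ?thesis by (simp add: lhat_def bilinear_simps)
qed

text \<open>The eigenvalue of the normalized form on the line \<open>H\<^sup>\<bottom>\<close>.\<close>

definition theta :: "'v incidence_point \<Rightarrow> complex" where
  "theta x = (THE t. \<exists>v. fst x = hyp v \<and> eigen (fhat (rho x)) v t)"

text \<open>The hyperplane determines its polar line, and the eigenvalue is the same for all vectors of the line.\<close>

lemma theta_eq:
  assumes q: "quadratic (fhat F)" and t: "eigen (fhat F) v t"
  shows "theta (hyp v, Q, F) = t"
  unfolding theta_def
proof (rule the_equality)
  show "\<exists>v'. fst (hyp v, Q, F) = hyp v' \<and> eigen (fhat (rho (hyp v, Q, F))) v' t"
    using t by (auto simp: rho_def)
  fix t' assume "\<exists>v'. fst (hyp v, Q, F) = hyp v' \<and> eigen (fhat (rho (hyp v, Q, F))) v' t'"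
  then obtain v' where v': "hyp v = hyp v'" "eigen (fhat F) v' t'" by (auto simp: rho_def)
  then obtain c where c: "v = scale c v'"
    using hyp_eqD[of v' v] t by (auto simp: eigen_def)
  obtain y where y: "\<omega> v y = 1" using pairing_one t by (auto simp: eigen_def)
  have "t * \<omega> v y = bil (fhat F) v y" using t by (simp add: eigen_def)
  also have "\<dots> = c * bil (fhat F) v' y" unfolding c by (rule bil_left[OF q])
  also have "\<dots> = t' * \<omega> v y" using v'(2) by (simp add: eigen_def c bilinear_simps)
  finally show "t' = t" using y by simp
qed

lemma quadratic_fhat:
  assumes "quadratic f" "f y0 \<noteq> 0"
  shows "quadratic (fhat (line f))"
  using quadratic_scale[OF assms(1), of "inverse (f y0)"]
  by (simp add: fhat_line[of f, OF assms(2)] divide_inverse mult.commute)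

lemma bil_divide: "bil (\<lambda>u. f u / s) x y = bil f x y / s"
  by (simp add: bil_def diff_divide_distrib mult.commute)

lemma eigen_fhat:
  assumes "f y0 \<noteq> 0" "eigen f v t"
  shows "eigen (fhat (line f)) v (t / f y0)"
  using assms(2) by (simp add: eigen_def fhat_line[of f, OF assms(1)] bil_divide)

text \<open>The forms that can be normalized, and the part of the incidence over them.\<close>

definition V0 :: "('v \<Rightarrow> complex) set set" where
  "V0 = {F \<in> points Y. \<exists>f\<in>F. f y0 \<noteq> 0}"

definition U0 :: "'v incidence_point set" where
  "U0 = {x \<in> points X. rho x \<in> V0}"

text \<open>The open set on which \<open>q\<close> can be replaced by \<open>f\<close> and all normalizations are possible.\<close>

definition \<Omega> :: "'v incidence_point set" where
  "\<Omega> = {(H, Q, F). (H, Q, F) \<in> points X \<and> d 0 \<notin> H \<and> (\<exists>f\<in>F. f y0 \<noteq> 0) \<and> (\<exists>f\<in>F. \<exists>x\<in>H. f x \<noteq> 0)}"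

lemma bex_line: "(\<exists>g\<in>line f. g y \<noteq> 0) \<longleftrightarrow> f y \<noteq> 0"
  "(\<exists>g\<in>line f. \<exists>x\<in>H. g x \<noteq> 0) \<longleftrightarrow> (\<exists>x\<in>H. f x \<noteq> 0)"
  using self_in_line[of f] by (auto simp: line_def)

lemma cone_V0: "f \<in> cone_over Y V0 \<longleftrightarrow> quadratic f \<and> f y0 \<noteq> 0"
  unfolding cone_Y V0_def mem_Collect_eq points_Y bex_line by auto

lemma cone_U0: "(l, q, f) \<in> cone_over X U0 \<longleftrightarrow> (\<exists>v. l = \<omega> v \<and> cone_pt v q f) \<and> f y0 \<noteq> 0"
proof -
  have "quot X (\<omega> v, q, f) \<in> U0 \<longleftrightarrow> f y0 \<noteq> 0" if "cone_pt v q f" for v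
  proof -
    have "quot X (\<omega> v, q, f) \<in> points X" "line f \<in> points Y"
      using that points_incidence_iff[of v q f] by (auto simp: quot_incidence cone_pt_def points_Y)
    then show ?thesis
      unfolding U0_def V0_def mem_Collect_eq quot_incidence rho_def prod.case bex_line by blast
  qed
  then show ?thesis unfolding cone_incidence by blast
qed

lemma cone_\<Omega>: "(l, q, f) \<in> cone_over X \<Omega> \<longleftrightarrow>
  (\<exists>v. l = \<omega> v \<and> cone_pt v q f) \<and> l (d 0) \<noteq> 0 \<and> f y0 \<noteq> 0 \<and> (\<exists>x. l x = 0 \<and> f x \<noteq> 0)"
proof -
  have "quot X (\<omega> v, q, f) \<in> \<Omega> \<longleftrightarrow> \<omega> v (d 0) \<noteq> 0 \<and> f y0 \<noteq> 0 \<and> (\<exists>x. \<omega> v x = 0 \<and> f x \<noteq> 0)"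
    if "cone_pt v q f" for v
  proof -
    have "quot X (\<omega> v, q, f) \<in> points X"
      using that points_incidence_iff[of v q f] by (auto simp: quot_incidence cone_pt_def)
    then show ?thesis
      unfolding \<Omega>_def mem_Collect_eq quot_incidence prod.case bex_line by auto
  qed
  then show ?thesis unfolding cone_incidence by blast
qed

lemma \<Omega>E:
  assumes "x \<in> \<Omega>"
  obtains v q f where "x = (hyp v, line (restr (hyp v) q), line f)" "cone_pt v q f"
    "(\<omega> v, q, f) \<in> cone_over X \<Omega>" "\<omega> v (d 0) \<noteq> 0" "f y0 \<noteq> 0"
proof -
  have "\<Omega> \<subseteq> points X" by (auto simp: \<Omega>_def)
  then obtain v q f where v: "x = (hyp v, line (restr (hyp v) q), line f)" "cone_pt v q f"
    using assms points_incidenceE by blast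
  then have "(\<omega> v, q, f) \<in> cone_over X \<Omega>" using assms by (auto simp: cone_incidence quot_incidence)
  then show ?thesis using that[OF v] by (auto simp: cone_\<Omega>)
qed

lemma V0_open: "openin (zariski Y) V0" "V0 \<noteq> {}"
proof -
  have "(\<lambda>f. f y0) \<in> polys Y"
    by (rule polynomial_functions.coord) (auto simp: proj_forms_def)
  moreover have "quot Y f \<in> V0" if "f \<in> cone_over Y UNIV" "f y0 \<noteq> 0" for f
  proof -
    have "quadratic f" using that(1) by (simp add: cone_Y)
    then have "f \<in> cone_over Y V0" using that(2) unfolding cone_V0 by blast
    then show ?thesis by (simp add: cone_over_def)
  qed
  ultimately show "openin (zariski Y) V0"
    unfolding openin_zariski_iff
    by (intro conjI ballI bexI[of _ "\<lambda>f. f y0"]) (auto simp only: cone_V0, auto simp: V0_def)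
  have "f1 \<in> cone_over Y V0" using f1 y0 by (simp add: cone_V0)
  then show "V0 \<noteq> {}" by (auto simp: cone_over_def)
qed

lemma preimage_open:
  assumes "openin (zariski Y) V" "V \<noteq> {}"
  shows "openin (zariski X) {x \<in> points X. rho x \<in> V}" "{x \<in> points X. rho x \<in> V} \<noteq> {}"
  using XY.preimage_rep[of V "\<lambda>_. 0"] assms by (auto simp: XY.X.rational_reps_iff XY.Y.rational_reps_iff)

lemma coord_fun: "(\<lambda>(l, q, f). l u) \<in> polys X"
  "(\<lambda>(l, q, f). f u) \<in> polys X"
  by (rule polynomial_functions.coord, auto simp: incidence_def)+

lemmas poly_X = function_algebraD[OF function_algebra_polynomial_functions[of "coords X"]]
  function_algebra_sum[OF function_algebra_polynomial_functions[of "coords X"]]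

lemma \<Omega>_open: "openin (zariski X) \<Omega>"
  unfolding openin_zariski_iff
proof (intro conjI ballI)
  show "\<Omega> \<subseteq> points X" by (auto simp: \<Omega>_def)
  fix c assume c: "c \<in> cone_over X \<Omega>"
  obtain l q f where [simp]: "c = (l, q, f)" by (cases c)
  obtain v where v: "l = \<omega> v" "cone_pt v q f" using c by (auto simp: cone_\<Omega>)
  obtain x0 where x0: "l x0 = 0" "f x0 \<noteq> 0" "l (d 0) \<noteq> 0" "f y0 \<noteq> 0" using c by (auto simp: cone_\<Omega>)
  obtain a where a: "l a = 1" using v pairing_one[of v] by (auto simp: cone_pt_def)
  \<comment> \<open>The value of \<open>f\<close> at \<open>l(a) x0 - l(x0) a\<close>, a vector of the hyperplane that is \<open>x0\<close> at the
    given point.\<close>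
  define G :: "('v \<Rightarrow> complex) \<times> ('v \<Rightarrow> complex) \<times> ('v \<Rightarrow> complex) \<Rightarrow> complex" where
    "G = (\<lambda>(l, q, f). l a * l a * f x0 + l x0 * l x0 * f a
      - l a * l x0 * (f (x0 + a) - f x0 - f a))"
  define P :: "('v \<Rightarrow> complex) \<times> ('v \<Rightarrow> complex) \<times> ('v \<Rightarrow> complex) \<Rightarrow> complex" where
    "P = (\<lambda>c. (\<lambda>(l, q, f). l (d 0)) c * ((\<lambda>(l, q, f). f y0) c * G c))"
  have "G \<in> polys X"
  proof -
    have "G = (\<lambda>c. (\<lambda>(l, q, f). l a) c * (\<lambda>(l, q, f). l a) c * (\<lambda>(l, q, f). f x0) c
        + (\<lambda>(l, q, f). l x0) c * (\<lambda>(l, q, f). l x0) c * (\<lambda>(l, q, f). f a) c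
        - (\<lambda>(l, q, f). l a) c * (\<lambda>(l, q, f). l x0) c
          * ((\<lambda>(l, q, f). f (x0 + a)) c - (\<lambda>(l, q, f). f x0) c - (\<lambda>(l, q, f). f a) c))"
      by (auto simp: G_def fun_eq_iff)
    also have "\<dots> \<in> polys X" by (intro poly_X coord_fun)
    finally show ?thesis .
  qed
  then have P: "P \<in> polys X" unfolding P_def by (intro poly_X coord_fun)
  have "P c \<noteq> 0" using x0 a by (simp add: P_def G_def)
  moreover have "quot X c' \<in> \<Omega>" if c': "c' \<in> cone_over X UNIV" "P c' \<noteq> 0" for c'
  proof -
    obtain l' q' f' where [simp]: "c' = (l', q', f')" by (cases c')
    obtain v' where v': "l' = \<omega> v'" "cone_pt v' q' f'" using c'(1) by (auto simp: cone_incidence)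
    define x where "x = scale (l' a) x0 - scale (l' x0) a"
    have q: "quadratic f'" using v' by (simp add: cone_pt_def)
    have "f' x = l' a * l' a * f' x0 - l' a * l' x0 * (2 * bil f' x0 a) + l' x0 * l' x0 * f' a"
      by (simp add: x_def quadratic_values[OF q] bil_left[OF q] bil_right[OF q])
    also have "2 * bil f' x0 a = f' (x0 + a) - f' x0 - f' a" by (simp add: bil_def)
    also have "l' a * l' a * f' x0 - l' a * l' x0 * (f' (x0 + a) - f' x0 - f' a) + l' x0 * l' x0 * f' a = G c'"
      by (simp add: G_def)
    finally have "f' x = G c'" .
    have "l' x = 0" by (simp add: x_def v' bilinear_simps mult.commute)
    with \<open>f' x = G c'\<close> have "c' \<in> cone_over X \<Omega>" using c'(2) v' by (auto simp: cone_\<Omega> P_def)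
    then show ?thesis by (simp add: cone_over_def)
  qed
  ultimately show "\<exists>p\<in>polys X. p c \<noteq> 0 \<and>
      (\<forall>c'\<in>cone_over X UNIV. p c' \<noteq> 0 \<longrightarrow> quot X c' \<in> \<Omega>)" using P by blast
qed

text \<open>The form \<open>f1\<close> has rank at least three, so it cannot vanish on a hyperplane.\<close>

lemma f1_nonzero_on_hyp:
  assumes "v \<noteq> 0"
  shows "\<exists>x. \<omega> v x = 0 \<and> f1 x \<noteq> 0"
proof (rule ccontr)
  assume "\<not> ?thesis"
  then obtain m where m: "\<And>x. f1 x = \<omega> v x * \<omega> m x" using vanishing_on_hyp[OF assms f1] by auto
  have b: "bil f1 x y = (\<omega> v x * \<omega> m y + \<omega> v y * \<omega> m x) / 2" for x y
    unfolding bil_def m by (simp add: bilinear_simps field_simps)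
  obtain k where k: "\<And>i. i < 2 * n \<Longrightarrow> i \<noteq> k \<Longrightarrow> \<mu> i \<noteq> 0"
  proof (cases "\<exists>k<2*n. \<mu> k = 0")
    case True
    then obtain k where "k < 2 * n" "\<mu> k = 0" by blast
    then show ?thesis using that[of k] inj_\<mu> by (force simp: inj_on_def)
  qed (use that in blast)
  have "e i \<in> span {v, m, e k}" if "i < 2 * n" for i
  proof (cases "i = k")
    case False
    have "e i = scale (\<omega> v (e i) / (2 * \<mu> i)) m + scale (\<omega> m (e i) / (2 * \<mu> i)) v"
      using diag[OF that] k[OF that False] by (intro eqI_left) (simp add: b bilinear_simps field_simps)
    also have "\<dots> \<in> span {v, m, e k}" by (intro span_add span_scale span_base) auto
    finally show ?thesis .
  qed (auto intro: span_base)
  then have "(\<Sum>i<2*n. scale (\<omega> (d i) x) (e i)) \<in> span {v, m, e k}" for x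
    by (intro span_sum span_scale) auto
  then have "dim UNIV \<le> card {v, m, e k}" unfolding expand by (intro dim_le_card) auto
  also have "\<dots> \<le> 3" by (simp add: card_insert_if)
  finally show False using dimension n2 by simp
qed

definition base_point :: "'v incidence_point" where
  "base_point = (hyp (e 0), line (restr (hyp (e 0)) f1), line f1)"

lemma eigen_f1: "i < 2 * n \<Longrightarrow> eigen f1 (e i) (\<mu> i)"
  using dual[of i i] diag[of i] by (auto simp: eigen_def)

lemma base_point_in: "base_point \<in> \<Omega>"
proof -
  have e0: "eigen f1 (e 0) (\<mu> 0)" "\<omega> (e 0) (d 0) \<noteq> 0"
    using eigen_f1[of 0] dual[of 0 0] skew[of "e 0" "d 0"] n2 by auto
  obtain x where x: "\<omega> (e 0) x = 0" "f1 x \<noteq> 0" using f1_nonzero_on_hyp[of "e 0"] e0 by (auto simp: eigen_def)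
  have "cone_pt (e 0) f1 f1"
    unfolding cone_pt_def using e0 f1 x by (auto simp: eigen_def intro!: exI[of _ 1])
  then have "(\<omega> (e 0), f1, f1) \<in> cone_over X \<Omega>" using x y0 e0 by (auto simp: cone_\<Omega>)
  then show ?thesis by (simp add: cone_over_def base_point_def quot_incidence)
qed

lemma \<Omega>_U0: "\<Omega> \<subseteq> U0"
proof
  fix x assume "x \<in> \<Omega>"
  then obtain v q f where x: "x = (hyp v, line (restr (hyp v) q), line f)" "cone_pt v q f" "f y0 \<noteq> 0"
    using \<Omega>E by metis
  then have "(\<omega> v, q, f) \<in> cone_over X U0" by (auto simp: cone_U0)
  then show "x \<in> U0" using x(1) by (simp add: cone_over_def quot_incidence)
qed

lemma \<Omega>_nonempty: "\<Omega> \<noteq> {}"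
  using base_point_in by blast

lemma U0_open: "openin (zariski X) U0" "U0 \<noteq> {}"
  unfolding U0_def by (rule preimage_open[OF V0_open])+

lemma quot_Y: "quot Y f = line f"
  by (simp add: proj_forms_def)

lemma regular_fhat: "regular_on Y V0 (\<lambda>F. fhat F u)"
proof (rule regular_onI)
  have c: "(\<lambda>f. f u) \<in> polys Y" for u
    by (rule polynomial_functions.coord) (auto simp: proj_forms_def)
  fix f assume f: "f \<in> cone_over Y V0"
  have "fhat (quot Y f') u = f' u / f' y0" if "f' \<in> cone_over Y V0" for f'
    using that unfolding cone_V0 quot_Y by (simp add: fhat_line)
  then show "\<exists>p\<in>polys Y. \<exists>q\<in>polys Y. q f \<noteq> 0 \<and>
      (\<forall>c'\<in>cone_over Y V0. q c' \<noteq> 0 \<longrightarrow> fhat (quot Y c') u = p c' / q c')"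
    using f by (intro bexI[OF _ c[of u]] bexI[OF _ c[of y0]]) (auto simp: cone_V0)
qed

text \<open>Near a point with \<open>\<omega>(v,y) \<noteq> 0\<close> the eigenvalue is \<open>bil f v y / \<omega>(v,y)\<close>, where \<open>v\<close> is linear in the
  equation of the hyperplane.\<close>

lemma regular_theta: "regular_on X U0 theta"
proof (rule regular_onI)
  fix c assume c: "c \<in> cone_over X U0"
  obtain l q f where [simp]: "c = (l, q, f)" by (cases c)
  obtain v where v: "l = \<omega> v" "cone_pt v q f" "f y0 \<noteq> 0" using c by (auto simp: cone_U0)
  obtain y where y: "l y = 1" using v pairing_one[of v] by (auto simp: cone_pt_def)
  define P :: "('v \<Rightarrow> complex) \<times> ('v \<Rightarrow> complex) \<times> ('v \<Rightarrow> complex) \<Rightarrow> complex" where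
    "P = (\<lambda>c. \<Sum>i<2*n. - (\<lambda>(l, q, f). l (d i)) c * (((\<lambda>(l, q, f). f (e i + y)) c
      - (\<lambda>(l, q, f). f (e i)) c - (\<lambda>(l, q, f). f y) c) * (1 / 2)))"
  define Q :: "('v \<Rightarrow> complex) \<times> ('v \<Rightarrow> complex) \<times> ('v \<Rightarrow> complex) \<Rightarrow> complex" where
    "Q = (\<lambda>c. (\<lambda>(l, q, f). f y0) c * (\<lambda>(l, q, f). l y) c)"
  have PQ: "P \<in> polys X" "Q \<in> polys X"
    unfolding P_def Q_def by (intro poly_X coord_fun polynomial_functions.const)+
  have val: "theta (quot X c') = P c' / Q c'" if c': "c' \<in> cone_over X U0" "Q c' \<noteq> 0" for c'
  proof -
    obtain l' q' f' where [simp]: "c' = (l', q', f')" by (cases c')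
    obtain v' where v': "l' = \<omega> v'" "cone_pt v' q' f'" "f' y0 \<noteq> 0" using c'(1) by (auto simp: cone_U0)
    obtain t where t: "eigen f' v' t" using cone_pt_eigen v'(2) by blast
    have q: "quadratic f'" using v' by (simp add: cone_pt_def)
    have "t * \<omega> v' y = bil f' (\<Sum>i<2*n. scale (\<omega> (d i) v') (e i)) y"
      using t by (simp add: eigen_def expand)
    also have "\<dots> = (\<Sum>i<2*n. - \<omega> v' (d i) * bil f' (e i) y)"
      unfolding bil_sum[OF q] bil_left[OF q] by (rule sum.cong) (simp_all add: skew[of "d _" v'])
    also have "\<dots> = P c'" by (simp add: P_def v' bil_def)
    finally have "P c' / Q c' = t / f' y0" using c'(2) by (auto simp: Q_def v' field_simps)
    moreover have "theta (quot X c') = t / f' y0"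
      using theta_eq[OF quadratic_fhat[OF q v'(3)] eigen_fhat[OF v'(3) t]] by (simp add: quot_incidence v')
    ultimately show ?thesis by simp
  qed
  have "Q c \<noteq> 0" using v y by (simp add: Q_def)
  then show "\<exists>p\<in>polys X. \<exists>q\<in>polys X. q c \<noteq> 0 \<and>
      (\<forall>c'\<in>cone_over X U0. q c' \<noteq> 0 \<longrightarrow> theta (quot X c') = p c' / q c')"
    using PQ val by blast
qed

lemma regular_lhat: "regular_on X \<Omega> (\<lambda>x. lhat (fst x) u)"
proof (rule regular_onI)
  fix c assume c: "c \<in> cone_over X \<Omega>"
  have "lhat (fst (quot X c')) u = (\<lambda>(l, q, f). l u) c' / (\<lambda>(l, q, f). l (d 0)) c'" if "c' \<in> cone_over X \<Omega>" for c'
    using that by (cases c') (auto simp: cone_\<Omega> quot_incidence lhat_hyp cone_pt_def)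
  then show "\<exists>p\<in>polys X. \<exists>q\<in>polys X. q c \<noteq> 0 \<and>
      (\<forall>c'\<in>cone_over X \<Omega>. q c' \<noteq> 0 \<longrightarrow> lhat (fst (quot X c')) u = p c' / q c')"
    using c by (intro bexI[OF _ coord_fun(1)[of u]] bexI[OF _ coord_fun(1)[of "d 0"]])
      (cases c; auto simp: cone_\<Omega>)
qed

text \<open>On \<open>\<Omega>\<close> every point has a canonical representative in the cone, in which \<open>q = f\<close>.\<close>

lemma normal_form:
  assumes "x \<in> \<Omega>"
  shows "(lhat (fst x), fhat (rho x), fhat (rho x)) \<in> cone_over X \<Omega>"
    and "quot X (lhat (fst x), fhat (rho x), fhat (rho x)) = x"
proof -
  obtain v q f where x: "x = (hyp v, line (restr (hyp v) q), line f)" "cone_pt v q f"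
    "(\<omega> v, q, f) \<in> cone_over X \<Omega>" "\<omega> v (d 0) \<noteq> 0" "f y0 \<noteq> 0" using \<Omega>E[OF assms] by blast
  have v: "v \<noteq> 0" and f: "quadratic f" using x(2) by (auto simp: cone_pt_def)
  obtain x0 where x0: "\<omega> v x0 = 0" "f x0 \<noteq> 0" using x(3) by (auto simp: cone_\<Omega>)
  define s where "s = inverse (f y0)"
  define v' where "v' = scale (inverse (\<omega> v (d 0))) v"
  have s: "s \<noteq> 0" using x(5) by (simp add: s_def)
  have l: "lhat (fst x) = \<omega> v'"
    using v by (auto simp: x(1) lhat_hyp v'_def bilinear_simps divide_inverse fun_eq_iff)
  have fh: "fhat (rho x) = (\<lambda>u. s * f u)"
    by (simp add: x(1) rho_def fhat_line[of f, OF x(5)] s_def divide_inverse mult.commute)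
  have h: "hyp v' = hyp v" using x(4) by (auto simp: v'_def bilinear_simps)
  have v'0: "v' \<noteq> 0" using v x(4) by (simp add: v'_def)
  obtain c where c: "\<And>u. \<omega> v u = 0 \<Longrightarrow> f u = c * q u" using x(2) by (auto simp: cone_pt_def)
  have c0: "c \<noteq> 0" using c[OF x0(1)] x0(2) by auto
  have "restr (hyp v') (\<lambda>u. s * f u) = (\<lambda>u. (s * c) * restr (hyp v) q u)"
    using c by (auto simp: restr_def h fun_eq_iff)
  then have "line (restr (hyp v') (\<lambda>u. s * f u)) = line (restr (hyp v) q)"
    using line_scale[of "s * c"] s c0 by simp
  then show q: "quot X (lhat (fst x), fhat (rho x), fhat (rho x)) = x"
    unfolding l fh quot_incidence h line_scale[OF s, of f] by (simp add: h x(1))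
  have "quot X (lhat (fst x), fhat (rho x), fhat (rho x)) \<in> points X"
    unfolding q using assms by (auto simp: \<Omega>_def)
  then show "(lhat (fst x), fhat (rho x), fhat (rho x)) \<in> cone_over X \<Omega>"
    unfolding cone_over_def mem_Collect_eq q using assms
    by (auto simp: l fh ambient_incidence quadratic_scale[OF f])
qed

text \<open>The function field of the space of quadrics, as a subfield of that of the incidence, and the rational
  function given by the eigenvalue.\<close>

definition K :: "'v incidence_point rational_rep set set" where
  "K = pullback X rho ` carrier (function_field Y)"

definition \<theta> :: "'v incidence_point rational_rep set" where
  "\<theta> = rational_class X U0 theta"

lemma subfield_K: "subfield K (function_field X)"
  unfolding K_def by (rule XY.subfield_pullback)

lemma subring_K: "subring K (function_field X)"
  using subfield_K by (rule subfieldE(1))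

lemma \<theta>_carrier: "\<theta> \<in> carrier (function_field X)"
  unfolding \<theta>_def using U0_open regular_theta
  by (intro XY.X.class_in_carrier) (simp add: XY.X.rational_reps_iff)

lemma class_K:
  assumes "openin (zariski Y) V" "regular_on Y V h" "openin (zariski X) W" "W \<noteq> {}"
    "W \<subseteq> {x \<in> points X. rho x \<in> V}"
  shows "rational_class X W (\<lambda>x. h (rho x)) \<in> K" "regular_on X W (\<lambda>x. h (rho x))"
proof -
  have r: "(V, h) \<in> rational_reps Y" using assms by (auto simp: XY.Y.rational_reps_iff)
  have p: "({x \<in> points X. rho x \<in> V}, h \<circ> rho) \<in> rational_reps X" by (rule XY.preimage_rep[OF r])
  have "rational_class X W (h \<circ> rho) = pullback X rho (rational_class Y V h)"
    unfolding XY.pullback_class[OF r] by (rule XY.X.class_restrict[OF p assms(3-5), symmetric])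
  then show "rational_class X W (\<lambda>x. h (rho x)) \<in> K"
    unfolding K_def using XY.Y.class_in_carrier[OF r] by (auto simp: comp_def)
  show "regular_on X W (\<lambda>x. h (rho x))"
    using p assms(5) by (auto simp: XY.X.rational_reps_iff comp_def intro: regular_on_subset)
qed

lemma \<theta>_on:
  assumes "openin (zariski X) W" "W \<noteq> {}" "W \<subseteq> U0"
  shows "\<theta> = rational_class X W theta" "regular_on X W theta"
proof -
  show "\<theta> = rational_class X W theta"
    unfolding \<theta>_def
    by (rule XY.X.class_restrict) (use assms U0_open regular_theta in \<open>auto simp: XY.X.rational_reps_iff\<close>)
  show "regular_on X W theta" by (rule regular_on_subset[OF regular_theta assms(3)])
qed

lemma eigen_theta:
  assumes "x \<in> U0"
  obtains v where "fst x = hyp v" "quadratic (fhat (rho x))" "eigen (fhat (rho x)) v (theta x)" "rho x \<in> V0"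
proof -
  have "x \<in> points X" using assms by (simp add: U0_def)
  then obtain v q f where x: "x = (hyp v, line (restr (hyp v) q), line f)" "cone_pt v q f"
    by (rule points_incidenceE)
  then have f: "quadratic f" "f y0 \<noteq> 0"
    using assms by (auto simp: U0_def V0_def rho_def bex_line cone_pt_def)
  obtain t where "eigen f v t" using cone_pt_eigen x(2) by blast
  then have t: "eigen (fhat (line f)) v (t / f y0)" by (rule eigen_fhat[of f, OF f(2)])
  have "theta x = t / f y0" unfolding x(1) by (rule theta_eq[OF quadratic_fhat[OF f] t])
  then show ?thesis using that[of v] t quadratic_fhat[OF f] assms by (auto simp: x(1) rho_def U0_def)
qed

lemma regular_char_poly: "regular_on Y V0 (\<lambda>F. coeff (char_poly (endo (fhat F))) i)"
proof -
  let ?R = "{g. regular_on Y V0 g}"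
  note R = function_algebra_regular_on[of Y V0]
  let ?S = "{P. \<forall>i. (\<lambda>F. coeff (P F) i) \<in> ?R}"
  have const: "(\<lambda>_. a) \<in> ?R" for a by simp
  have "function_algebra ?S"
    unfolding function_algebra_def
  proof (intro conjI ballI allI)
    fix a show "(\<lambda>_. of_int a) \<in> ?S" using const by simp
    fix f g assume "f \<in> ?S" "g \<in> ?S"
    then have fg: "\<And>i. (\<lambda>F. coeff (f F) i) \<in> ?R" "\<And>i. (\<lambda>F. coeff (g F) i) \<in> ?R" by auto
    show "(\<lambda>x. f x + g x) \<in> ?S" unfolding mem_Collect_eq[of _ "\<lambda>P. \<forall>i. (\<lambda>F. coeff (P F) i) \<in> ?R"] coeff_add
      by (intro allI function_algebraD[OF R] fg)
    show "(\<lambda>x. f x * g x) \<in> ?S" unfolding mem_Collect_eq[of _ "\<lambda>P. \<forall>i. (\<lambda>F. coeff (P F) i) \<in> ?R"] coeff_mult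
      by (intro allI function_algebra_sum[OF R] function_algebraD[OF R] fg)
  qed
  moreover have "(\<lambda>_. [:0, 1:]) \<in> ?S" using const by simp
  moreover have "(\<lambda>F. [:endo (fhat F) $$ (i, j):]) \<in> ?S" if "i < 2 * n" "j < 2 * n" for i j
  proof -
    have "(\<lambda>F. endo (fhat F) $$ (i, j)) =
        (\<lambda>F. - ((fhat F (e j + d i) - fhat F (e j) - fhat F (d i)) * (1 / 2)))"
      using that by (simp add: endo_def bil_def)
    also have "\<dots> \<in> ?R" by (intro function_algebraD[OF R] const) (simp_all add: regular_fhat)
    finally have "(\<lambda>F. endo (fhat F) $$ (i, j)) \<in> ?R" .
    then have "(\<lambda>F. coeff [:endo (fhat F) $$ (i, j):] k) \<in> ?R" for k by (cases k) auto
    then show ?thesis by blast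
  qed
  ultimately have "(\<lambda>F. char_poly (endo (fhat F))) \<in> ?S"
    by (intro function_algebra_char_poly[where k = "2*n"]) auto
  then show ?thesis by simp
qed

text \<open>The characteristic polynomial of the normalized endomorphism, as a polynomial over \<open>K\<close> in list
  representation.\<close>

definition char_poly_list :: "'v incidence_point rational_rep set list" where
  "char_poly_list = map (rational_class X U0)
     (map (\<lambda>i x. coeff (char_poly (endo (fhat (rho x)))) i) (rev [0..<Suc (2*n)]))"

lemma char_poly_list: "char_poly_list \<in> carrier (K[X]\<^bsub>function_field X\<^esub>)" "length char_poly_list = 2 * n + 1"
  "char_poly_list \<noteq> []" "L.eval char_poly_list \<theta> = \<zero>\<^bsub>function_field X\<^esub>"
proof -
  let ?c = "\<lambda>i x. coeff (char_poly (endo (fhat (rho x)))) i"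
  have K: "rational_class X U0 (?c i) \<in> K" "regular_on X U0 (?c i)" for i
    using class_K[OF V0_open(1) regular_char_poly U0_open, of i] by (auto simp: U0_def)
  have one: "?c (2*n) = (\<lambda>_. 1)" using degree_monic_char_poly[OF endo_carrier] by auto
  show l: "length char_poly_list = 2 * n + 1" by (simp add: char_poly_list_def)
  then show "char_poly_list \<noteq> []" by auto
  have "set char_poly_list \<subseteq> K" using K by (auto simp: char_poly_list_def)
  moreover have "hd char_poly_list = \<one>\<^bsub>function_field X\<^esub>"
    by (simp add: char_poly_list_def one XY.X.class_const_on[OF U0_open] XY.X.one_function_field)
  ultimately show "char_poly_list \<in> carrier (K[X]\<^bsub>function_field X\<^esub>)"
    unfolding univ_poly_carrier[symmetric] polynomial_def using L.one_not_zero by simp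
  define cs where "cs = map ?c (rev [0..<Suc (2*n)])"
  have reg: "regular_on X U0 g" if "g \<in> set cs" for g using that K(2) by (auto simp: cs_def)
  have zero: "peval (map (\<lambda>g. g x) cs) (theta x) = 0" if x: "x \<in> U0" for x
  proof -
    obtain v where v: "quadratic (fhat (rho x))" "eigen (fhat (rho x)) v (theta x)"
      using eigen_theta[OF x] by blast
    have "map (\<lambda>g. g x) cs = map (\<lambda>i. ?c i x) (rev [0..<Suc (2*n)])" by (simp add: cs_def)
    then have "peval (map (\<lambda>g. g x) cs) (theta x) = (\<Sum>i<Suc (2*n). ?c i x * theta x ^ i)"
      by (simp only: peval_sum)
    also have "\<dots> = poly (char_poly (endo (fhat (rho x)))) (theta x)"
      using degree_monic_char_poly[OF endo_carrier, of "fhat (rho x)"]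
      by (simp only: poly_altdef lessThan_Suc_atMost)
    finally show ?thesis using eigenvalue_endo_iff[OF v(1)] v(2) by auto
  qed
  have "(U0, \<lambda>x. peval (map (\<lambda>g. g x) cs) (theta x)) \<in> rational_reps X"
    using XY.X.regular_on_peval[OF U0_open reg regular_theta] U0_open by (simp add: XY.X.rational_reps_iff)
  then have "rational_class X U0 (\<lambda>x. peval (map (\<lambda>g. g x) cs) (theta x)) = \<zero>\<^bsub>function_field X\<^esub>"
    using XY.X.class_zero_iff zero by blast
  then show "L.eval char_poly_list \<theta> = \<zero>\<^bsub>function_field X\<^esub>"
    unfolding char_poly_list_def \<theta>_def cs_def[symmetric]
      XY.X.class_eval_on[OF U0_open reg regular_theta, of cs, simplified] .
qed

lemma \<theta>_algebraic: "(L.algebraic over K) \<theta>"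
  using L.algebraicI[OF char_poly_list(1,3,4)] .

lemma Irr_length_le: "length (L.Irr K \<theta>) \<le> 2 * n + 1"
proof -
  have "length (L.Irr K \<theta>) - 1 \<le> length char_poly_list - 1"
    using L.pdivides_imp_degree_le[OF subring_K L.IrrE(1)[OF subfield_K \<theta>_carrier \<theta>_algebraic]
        char_poly_list(1,3) L.Irr_minimal[OF subfield_K \<theta>_carrier \<theta>_algebraic char_poly_list(1,4)]] .
  then show ?thesis using char_poly_list(2) by simp
qed

text \<open>Finitely many rational functions are regular on a common open set, because open sets meet.\<close>

lemma common_domain:
  assumes "set ks \<subseteq> carrier (function_field Y)"
  shows "\<exists>V hs. openin (zariski Y) V \<and> V \<noteq> {} \<and> V \<subseteq> V0 \<and> (\<forall>h\<in>set hs. regular_on Y V h) \<and>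
    ks = map (rational_class Y V) hs"
  using assms
proof (induction ks)
  case Nil
  then show ?case using V0_open by (intro exI[of _ V0] exI[of _ "[]"]) simp
next
  case (Cons k ks)
  then obtain V hs where V: "openin (zariski Y) V" "V \<noteq> {}" "V \<subseteq> V0" "\<forall>h\<in>set hs. regular_on Y V h"
    "ks = map (rational_class Y V) hs" by auto
  have "k \<in> carrier (function_field Y)" using Cons.prems by simp
  then obtain U g where U: "(U, g) \<in> rational_reps Y" "k = rational_class Y U g" by (rule XY.Y.carrierE)
  have o: "openin (zariski Y) (U \<inter> V)" "U \<inter> V \<noteq> {}"
    using U V XY.Y.open_meet[of U V] by (auto simp: XY.Y.rational_reps_iff)
  have "rational_class Y V h = rational_class Y (U \<inter> V) h" if "h \<in> set hs" for h
    by (rule XY.Y.class_restrict) (use V that o in \<open>auto simp: XY.Y.rational_reps_iff\<close>)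
  moreover have "k = rational_class Y (U \<inter> V) g"
    unfolding U(2) by (rule XY.Y.class_restrict) (use U o in auto)
  ultimately have "k # ks = map (rational_class Y (U \<inter> V)) (g # hs)" by (simp add: V(5))
  moreover have "\<forall>h\<in>set (g # hs). regular_on Y (U \<inter> V) h"
    using U V(4) by (auto simp: XY.Y.rational_reps_iff intro: regular_on_Int)
  ultimately show ?case
    using o V(3) by (intro exI[of _ "U \<inter> V"] exI[of _ "g # hs"] conjI) auto
qed

text \<open>A relation of degree less than \<open>2n\<close> for \<open>\<theta>\<close> would hold at every point over a nonempty open
  set of forms, hence for \<open>2n\<close> distinct eigenvalues of one form.\<close>

lemma Irr_length_ge: "2 * n + 1 \<le> length (L.Irr K \<theta>)"
proof (rule ccontr)
  assume "\<not> ?thesis"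
  then have short: "length (L.Irr K \<theta>) \<le> 2 * n" by simp
  note I = L.IrrE[OF subfield_K \<theta>_carrier \<theta>_algebraic]
  have ne: "L.Irr K \<theta> \<noteq> []" using L.pirreducibleE(1)[OF subring_K I(1,2)] by (simp add: univ_poly_zero)
  have "set (L.Irr K \<theta>) \<subseteq> K"
    using I(1) ne unfolding univ_poly_carrier[symmetric] polynomial_def by blast
  then have "L.Irr K \<theta> \<in> map (pullback X rho) ` lists (carrier (function_field Y))"
    unfolding K_def lists_image[symmetric] by blast
  then obtain ks where ks: "set ks \<subseteq> carrier (function_field Y)" "L.Irr K \<theta> = map (pullback X rho) ks"
    by (auto simp: lists_eq_set)
  obtain V hs where V: "openin (zariski Y) V" "V \<noteq> {}" "V \<subseteq> V0" "\<And>h. h \<in> set hs \<Longrightarrow> regular_on Y V h"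
    "ks = map (rational_class Y V) hs" using common_domain[OF ks(1)] by blast
  define W where "W = {x \<in> points X. rho x \<in> V}"
  have W: "openin (zariski X) W" "W \<noteq> {}" "W \<subseteq> U0"
    using preimage_open[OF V(1,2)] V(3) by (auto simp: W_def U0_def)
  define gs where "gs = map (\<lambda>h x. h (rho x)) hs"
  have reg: "regular_on X W g" if "g \<in> set gs" for g
    using that class_K(2)[OF V(1) V(4) W(1,2)] by (auto simp: gs_def W_def)
  have "pullback X rho (rational_class Y V h) = rational_class X W (\<lambda>x. h (rho x))" if "h \<in> set hs" for h
    using XY.pullback_class[of V h] V that by (simp add: XY.Y.rational_reps_iff W_def comp_def)
  then have Irr: "L.Irr K \<theta> = map (rational_class X W) gs" by (simp add: ks(2) V(5) gs_def)
  obtain g gs' where gs: "gs = g # gs'" using Irr ne by (cases gs) auto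
  obtain h hs' where hs: "hs = h # hs'" using gs by (cases hs) (auto simp: gs_def)
  have gs': "gs' = map (\<lambda>h x. h (rho x)) hs'" using gs by (simp add: gs_def hs)
  have rep: "(W, f) \<in> rational_reps X" if "regular_on X W f" for f
    using that W by (simp add: XY.X.rational_reps_iff)
  have "rational_class X W g = rational_class X W (\<lambda>_. 1)"
    using I(3) by (simp add: Irr gs XY.X.one_function_field XY.X.class_const_on[OF W(1,2)])
  then have g1: "g x = 1" if "x \<in> W" for x
    using XY.X.class_eq_iff[OF rep[OF reg[of g]] rep[of "\<lambda>_. 1"]] gs that by simp
  have "rational_class X W (\<lambda>x. peval (map (\<lambda>g. g x) gs) (theta x)) = \<zero>\<^bsub>function_field X\<^esub>"
    using I(4) XY.X.class_eval_on[OF W(1,2), of gs theta, OF reg \<theta>_on(2)[OF W]]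
    by (simp add: Irr[symmetric] \<theta>_on(1)[OF W, symmetric])
  then have zero: "peval (map (\<lambda>g. g x) gs) (theta x) = 0" if "x \<in> W" for x
    using XY.X.class_zero_iff[OF rep[OF XY.X.regular_on_peval[OF W(1,2) reg \<theta>_on(2)[OF W]]]] that by simp
  obtain f T where f: "quadratic f" "line f \<in> V" "f y0 \<noteq> 0" and T: "card T = 2 * n" "\<forall>t\<in>T. \<exists>v. eigen f v t"
    using dense_distinct_eigenvalues[OF V(1,2)] by blast
  have "f \<noteq> (\<lambda>_. 0)" using f(3) by auto
  have root: "peval (1 # map (\<lambda>h. h (line f)) hs') (t / f y0) = 0" if t: "t \<in> T" for t
  proof -
    obtain v where v: "eigen f v t" using T t by blast
    obtain q where q: "cone_pt v q f" using eigen_cone_pt[OF f(1) \<open>f \<noteq> (\<lambda>_. 0)\<close> v] by blast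
    define x where "x = (hyp v, line (restr (hyp v) q), line f)"
    have "x \<in> points X" using q points_incidence_iff[of v q f] by (simp add: x_def cone_pt_def)
    then have x: "x \<in> W" using f(2) by (simp add: W_def x_def rho_def)
    have "theta x = t / f y0"
      unfolding x_def by (rule theta_eq[OF quadratic_fhat[OF f(1,3)] eigen_fhat[of f, OF f(3) v]])
    moreover have "map (\<lambda>g. g x) gs = 1 # map (\<lambda>h. h (line f)) hs'"
      using g1[OF x] by (simp add: gs gs' x_def rho_def)
    ultimately show ?thesis using zero[OF x] by simp
  qed
  have "card ((\<lambda>t. t / f y0) ` T) \<le> length (map (\<lambda>h. h (line f)) hs')"
    by (rule peval_monic_roots) (use root in auto)
  moreover have "card ((\<lambda>t. t / f y0) ` T) = 2 * n"
    using T(1) f(3) by (subst card_image) (auto simp: inj_on_def)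
  moreover have "length hs' < length (L.Irr K \<theta>)" by (simp add: Irr gs_def hs)
  ultimately show False using short by simp
qed

abbreviation "E \<equiv> L.simple_extension K \<theta>"

lemma subfield_E: "subfield E (function_field X)"
  using L.simple_extension_is_subfield[OF subfield_K \<theta>_carrier] \<theta>_algebraic by simp

text \<open>The regular functions on \<open>\<Omega>\<close> whose class lies in \<open>K(\<theta>)\<close>.  Working with functions instead of classes
  makes the pointwise closure under determinants available.\<close>

definition generated :: "('v incidence_point \<Rightarrow> complex) set" where
  "generated = {g. regular_on X \<Omega> g \<and> rational_class X \<Omega> g \<in> E}"

lemma K_subset_E: "K \<subseteq> E"
  using L.simple_extension_incl[OF subringE(1)[OF subring_K] \<theta>_carrier] .

lemma \<Omega>_points: "\<Omega> \<subseteq> {x \<in> points X. rho x \<in> V0}"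
  using \<Omega>_U0 by (simp add: U0_def)

lemma generated_const: "(\<lambda>_. a) \<in> generated"
  using class_K(1)[OF V0_open(1) regular_on_const \<Omega>_open \<Omega>_nonempty \<Omega>_points, of a] K_subset_E
  by (auto simp: generated_def)

lemma function_algebra_generated: "function_algebra generated"
  unfolding function_algebra_def
proof (intro conjI ballI allI)
  fix f g assume "f \<in> generated" "g \<in> generated"
  then have fg: "regular_on X \<Omega> f" "regular_on X \<Omega> g" "rational_class X \<Omega> f \<in> E" "rational_class X \<Omega> g \<in> E"
    by (simp_all add: generated_def)
  have E: "subring E (function_field X)" using subfield_E by (rule subfieldE(1))
  show "(\<lambda>x. f x + g x) \<in> generated"
    using subringE(7)[OF E fg(3,4)] XY.X.class_add_on[OF \<Omega>_open \<Omega>_nonempty fg(1,2)] regular_on_add[OF fg(1,2)]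
    by (simp add: generated_def)
  show "(\<lambda>x. f x * g x) \<in> generated"
    using subringE(6)[OF E fg(3,4)] XY.X.class_mult_on[OF \<Omega>_open \<Omega>_nonempty fg(1,2)] regular_on_mult[OF fg(1,2)]
    by (simp add: generated_def)
qed (rule generated_const)

lemmas generated_intros = generated_const function_algebraD[OF function_algebra_generated]
  function_algebra_sum[OF function_algebra_generated]

lemma generated_fhat: "(\<lambda>x. fhat (rho x) u) \<in> generated"
  using class_K[OF V0_open(1) regular_fhat \<Omega>_open \<Omega>_nonempty \<Omega>_points, of u] K_subset_E
  by (auto simp: generated_def)

lemma generated_theta: "theta \<in> generated"
  using \<theta>_on[OF \<Omega>_open \<Omega>_nonempty \<Omega>_U0] L.simple_extension_mem[OF subring_K \<theta>_carrier]
  by (simp add: generated_def)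

text \<open>Since \<open>K(\<theta>)\<close> is a field, an identity \<open>g q = p\<close> with \<open>q \<noteq> 0\<close> puts \<open>g\<close> into it as soon as \<open>p\<close> and \<open>q\<close> are
  there.\<close>

lemma generated_fraction:
  assumes p: "p \<in> generated" and q: "q \<in> generated" and nz: "\<exists>x\<in>\<Omega>. q x \<noteq> 0"
    and g: "(U, g) \<in> rational_reps X" and rel: "\<And>x. x \<in> U \<Longrightarrow> x \<in> \<Omega> \<Longrightarrow> q x \<noteq> 0 \<Longrightarrow> g x * q x = p x"
  shows "rational_class X U g \<in> E"
proof -
  have reps: "(\<Omega>, p) \<in> rational_reps X" "(\<Omega>, q) \<in> rational_reps X"
    using p q \<Omega>_open \<Omega>_nonempty by (simp_all add: generated_def XY.X.rational_reps_iff)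
  let ?p = "rational_class X \<Omega> p" and ?q = "rational_class X \<Omega> q" and ?g = "rational_class X U g"
  have E: "?p \<in> E" "?q \<in> E" using p q by (simp_all add: generated_def)
  have q0: "?q \<noteq> \<zero>\<^bsub>function_field X\<^esub>" using XY.X.class_zero_iff[OF reps(2)] nz by blast
  have "?g \<otimes>\<^bsub>function_field X\<^esub> ?q = rational_class X (U \<inter> \<Omega>) (\<lambda>x. g x * q x)"
    by (rule XY.X.class_mult[OF g reps(2)])
  also have "\<dots> = ?p"
  proof (rule XY.X.class_eqI[OF XY.X.rational_reps_op(2)[OF g reps(2)] reps(1)])
    show "openin (zariski X) {x \<in> \<Omega>. q x \<noteq> 0}"
      using openin_regular_nonzero[OF \<Omega>_open] q by (simp add: generated_def)
    show "{x \<in> \<Omega>. q x \<noteq> 0} \<noteq> {}" using nz by blast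
  qed (use rel in auto)
  finally have eq: "?g \<otimes>\<^bsub>function_field X\<^esub> ?q = ?p" .
  have c: "?g \<in> carrier (function_field X)" "?q \<in> carrier (function_field X)"
    using g reps by (simp_all add: XY.X.class_in_carrier)
  have inv: "inv\<^bsub>function_field X\<^esub> ?q \<in> E" "?q \<otimes>\<^bsub>function_field X\<^esub> inv\<^bsub>function_field X\<^esub> ?q = \<one>\<^bsub>function_field X\<^esub>"
    using L.subfield_m_inv(1,2)[OF subfield_E, of ?q] E(2) q0 by auto
  have ic: "inv\<^bsub>function_field X\<^esub> ?q \<in> carrier (function_field X)"
    using inv(1) subfieldE(3)[OF subfield_E] by blast
  have "?g = ?g \<otimes>\<^bsub>function_field X\<^esub> (?q \<otimes>\<^bsub>function_field X\<^esub> inv\<^bsub>function_field X\<^esub> ?q)"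
    unfolding inv(2) using c by simp
  also have "\<dots> = ?p \<otimes>\<^bsub>function_field X\<^esub> inv\<^bsub>function_field X\<^esub> ?q"
    using c ic by (simp add: L.m_assoc[symmetric] eq)
  also have "\<dots> \<in> E" using subringE(6)[OF subfieldE(1)[OF subfield_E] E(1) inv(1)] .
  finally show ?thesis .
qed

text \<open>The eigenvector with first coordinate \<open>1\<close> solves the linear system in which the first
  equation of the eigenvector equations is replaced by this normalization.\<close>

definition eigensystem :: "'v incidence_point \<Rightarrow> complex mat" where
  "eigensystem x = mat (2*n) (2*n) (\<lambda>(i, j). if i = 0 then (if j = 0 then 1 else 0)
     else (if i = j then theta x else 0) - endo (fhat (rho x)) $$ (i, j))"

lemma eigensystem_carrier [simp]: "eigensystem x \<in> carrier_mat (2*n) (2*n)"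
  by (simp add: eigensystem_def)

lemma eigensystem_dim: "dim_row (eigensystem x) = 2 * n" "dim_col (eigensystem x) = 2 * n"
  by (simp_all add: eigensystem_def)

lemma eigensystem_solution:
  assumes "x \<in> \<Omega>"
  shows "eigensystem x *\<^sub>v vec (2*n) (\<lambda>j. lhat (fst x) (d j)) = unit_vec (2*n) 0"
proof -
  obtain v where v: "fst x = hyp v" "quadratic (fhat (rho x))" "eigen (fhat (rho x)) v (theta x)"
    using eigen_theta assms \<Omega>_U0 by blast
  have v0: "v \<noteq> 0" using v(3) by (simp add: eigen_def)
  have nz: "\<omega> v (d 0) \<noteq> 0" using assms v(1) by (auto simp: \<Omega>_def)
  let ?w = "vec (2*n) (\<lambda>j. \<omega> (d j) v)"
  have l: "lhat (fst x) (d j) = - \<omega> (d j) v / \<omega> v (d 0)" for j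
    unfolding v(1) lhat_hyp[OF v0] using skew[of v "d j"] by simp
  have row: "(\<Sum>j<2*n. endo (fhat (rho x)) $$ (i, j) * \<omega> (d j) v) = theta x * \<omega> (d i) v" if "i < 2 * n" for i
    using arg_cong[OF eigen_mult[OF v(2,3)], of "\<lambda>w. w $ i"] that
    by (simp add: endo_def scalar_prod_def lessThan_atLeast0)
  show ?thesis
  proof (rule eq_vecI)
    fix i assume "i < dim_vec (unit_vec (2*n) 0 :: complex vec)"
    then have i: "i < 2 * n" by simp
    have "(eigensystem x *\<^sub>v vec (2*n) (\<lambda>j. lhat (fst x) (d j))) $ i
        = (\<Sum>j<2*n. eigensystem x $$ (i, j) * lhat (fst x) (d j))"
      using i by (simp add: scalar_prod_def lessThan_atLeast0 eigensystem_def)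
    also have "\<dots> = unit_vec (2*n) 0 $ i"
    proof (cases "i = 0")
      case True
      have "(\<Sum>j<2*n. eigensystem x $$ (i, j) * lhat (fst x) (d j)) = (\<Sum>j<2*n. if j = 0 then lhat (fst x) (d 0) else 0)"
        by (rule sum.cong) (use i True in \<open>auto simp: eigensystem_def\<close>)
      also have "\<dots> = 1" using n2 nz by (simp add: v(1) lhat_hyp[OF v0])
      finally show ?thesis using True i by simp
    next
      case False
      have "(\<Sum>j<2*n. eigensystem x $$ (i, j) * lhat (fst x) (d j))
        = (\<Sum>j<2*n. ((if i = j then theta x * \<omega> (d i) v else 0)
            - endo (fhat (rho x)) $$ (i, j) * \<omega> (d j) v) * (- 1 / \<omega> v (d 0)))"
        by (rule sum.cong) (use i False in \<open>auto simp: eigensystem_def l field_simps\<close>)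
      also have "\<dots> = (theta x * \<omega> (d i) v - theta x * \<omega> (d i) v) * (- 1 / \<omega> v (d 0))"
        unfolding sum_distrib_right[symmetric] sum_subtractf row[OF i] using i by simp
      finally show ?thesis using False i by simp
    qed
    finally show "(eigensystem x *\<^sub>v vec (2*n) (\<lambda>j. lhat (fst x) (d j))) $ i = unit_vec (2*n) 0 $ i" .
  qed (simp add: eigensystem_def)
qed

lemma generated_endo:
  assumes "i < 2 * n" "j < 2 * n"
  shows "(\<lambda>x. endo (fhat (rho x)) $$ (i, j)) \<in> generated"
proof -
  have "(\<lambda>x. endo (fhat (rho x)) $$ (i, j)) =
      (\<lambda>x. - ((fhat (rho x) (e j + d i) - fhat (rho x) (e j) - fhat (rho x) (d i)) * (1 / 2)))"
    using assms by (simp add: endo_def bil_def)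
  also have "\<dots> \<in> generated" by (intro generated_intros generated_fhat)
  finally show ?thesis .
qed

lemma generated_eigensystem:
  assumes "i < 2 * n" "j < 2 * n"
  shows "(\<lambda>x. eigensystem x $$ (i, j)) \<in> generated"
proof (cases "i = 0")
  case True
  then show ?thesis using assms by (simp add: eigensystem_def generated_const)
next
  case False
  then have "(\<lambda>x. eigensystem x $$ (i, j)) = (\<lambda>x. (if i = j then theta x else 0) - endo (fhat (rho x)) $$ (i, j))"
    using assms by (simp add: eigensystem_def)
  also have "\<dots> \<in> generated"
    by (cases "i = j") (auto intro!: generated_intros generated_theta generated_endo assms simp del: diff_0)
  finally show ?thesis .
qed

text \<open>The system is regular at the base point, where the endomorphism is diagonal with distinct
  eigenvalues.\<close>

lemma eigensystem_regular: "\<exists>x\<in>\<Omega>. det (eigensystem x) \<noteq> 0"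
proof (rule bexI[OF _ base_point_in])
  have F: "fhat (rho base_point) = (\<lambda>u. f1 u / f1 y0)"
    by (simp add: base_point_def rho_def fhat_line[of f1, OF y0])
  have th: "theta base_point = \<mu> 0 / f1 y0"
    unfolding base_point_def
    by (rule theta_eq[OF quadratic_fhat[OF f1 y0] eigen_fhat[of f1, OF y0 eigen_f1]]) (use n2 in simp)
  have en: "endo (fhat (rho base_point)) $$ (i, j) = (if i = j then \<mu> i / f1 y0 else 0)"
    if "i < 2 * n" "j < 2 * n" for i j
    using that skew[of "e j" "d i"] by (simp add: F endo_def bil_divide diag dual)
  have S: "eigensystem base_point $$ (i, j) = (if i = j then (if i = 0 then 1 else (\<mu> 0 - \<mu> i) / f1 y0) else 0)"
    if "i < 2 * n" "j < 2 * n" for i j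
    using that by (simp add: eigensystem_def en th diff_divide_distrib)
  have "upper_triangular (eigensystem base_point)"
    by (rule upper_triangularI) (simp add: eigensystem_dim S)
  then have "det (eigensystem base_point) = prod_list (diag_mat (eigensystem base_point))"
    by (rule det_upper_triangular[OF _ eigensystem_carrier])
  moreover have "x \<noteq> 0" if x: "x \<in> set (diag_mat (eigensystem base_point))" for x
  proof -
    have "dim_row (eigensystem base_point) = 2 * n" by (simp add: eigensystem_def)
    then obtain i where i: "i < 2 * n" "x = eigensystem base_point $$ (i, i)"
      using x by (auto simp: diag_mat_def)
    then show ?thesis using S[of i i] inj_onD[OF inj_\<mu>, of 0 i] n2 y0 by (auto split: if_splits)
  qed
  ultimately show "det (eigensystem base_point) \<noteq> 0" by (auto simp: prod_list_zero_iff)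
qed

text \<open>Cramer's rule for the coordinates of the normalized eigenvector; the value at any other vector is a linear
  combination of them.\<close>

lemma generated_lhat: "(\<lambda>x. lhat (fst x) u) \<in> generated"
proof -
  have basic: "(\<lambda>x. lhat (fst x) (d k)) \<in> generated" if k: "k < 2 * n" for k
  proof -
    let ?p = "\<lambda>x. det (replace_col (eigensystem x) (unit_vec (2*n) 0) k)" and ?q = "\<lambda>x. det (eigensystem x)"
    have q: "?q \<in> generated"
      by (rule function_algebra_det[OF function_algebra_generated eigensystem_carrier generated_eigensystem])
    have p: "?p \<in> generated"
    proof (rule function_algebra_det[OF function_algebra_generated])
      show "replace_col (eigensystem x) (unit_vec (2*n) 0) k \<in> carrier_mat (2*n) (2*n)" for x
        by (simp add: replace_col_def eigensystem_def)
      fix i j assume ij: "i < 2 * n" "j < 2 * n"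
      have "(\<lambda>x. replace_col (eigensystem x) (unit_vec (2*n) 0) k $$ (i, j))
          = (\<lambda>x. if j = k then (if i = 0 then 1 else 0) else eigensystem x $$ (i, j))"
        using ij by (auto simp: replace_col_def eigensystem_def fun_eq_iff)
      also have "\<dots> \<in> generated"
        using generated_eigensystem[OF ij] generated_const[of 0] generated_const[of 1]
        by (cases "j = k"; cases "i = 0") simp_all
      finally show "(\<lambda>x. replace_col (eigensystem x) (unit_vec (2*n) 0) k $$ (i, j)) \<in> generated" .
    qed
    have "lhat (fst x) (d k) * ?q x = ?p x" if "x \<in> \<Omega>" for x
      using cramer_lemma_mat[OF eigensystem_carrier, of "vec (2*n) (\<lambda>j. lhat (fst x) (d j))" k x] k
      by (simp add: eigensystem_solution[OF that])
    then have "rational_class X \<Omega> (\<lambda>x. lhat (fst x) (d k)) \<in> E"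
      using \<Omega>_open \<Omega>_nonempty regular_lhat
      by (intro generated_fraction[OF p q eigensystem_regular]) (auto simp: XY.X.rational_reps_iff)
    then show ?thesis using regular_lhat by (simp add: generated_def)
  qed
  have "lhat H u = (\<Sum>i<2*n. - \<omega> (e i) u * lhat H (d i))" for H
  proof -
    have "\<omega> w u = (\<Sum>i<2*n. - \<omega> (e i) u * \<omega> w (d i))" for w
      by (subst expand_right[of u, symmetric]) (simp only: bilinear_simps)
    note exp = this
    define w where "w = (SOME v. v \<noteq> 0 \<and> H = hyp v)"
    have l: "lhat H u = \<omega> w u / \<omega> w (d 0)" for u by (simp add: lhat_def w_def)
    show ?thesis unfolding l by (subst exp[of w]) (simp add: sum_divide_distrib)
  qed
  then have "(\<lambda>x. lhat (fst x) u) = (\<lambda>x. \<Sum>i<2*n. - \<omega> (e i) u * lhat (fst x) (d i))" by simp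
  also have "\<dots> \<in> generated" by (intro generated_intros basic) simp
  finally show ?thesis .
qed

lemma generated_polynomial:
  assumes "p \<in> polys X"
  shows "(\<lambda>x. p (lhat (fst x), fhat (rho x), fhat (rho x))) \<in> generated"
  using assms
proof induction
  case (coord p)
  then show ?case by (auto simp: incidence_def generated_lhat generated_fhat)
qed (auto intro: generated_intros)

text \<open>Evaluating a local presentation \<open>p / q\<close> of a rational function at the canonical representatives writes it as
  a fraction of generated functions.\<close>

lemma E_carrier: "E = carrier (function_field X)"
proof
  show "E \<subseteq> carrier (function_field X)" using subfieldE(3)[OF subfield_E] .
  show "carrier (function_field X) \<subseteq> E"
  proof
    fix a assume "a \<in> carrier (function_field X)"
    then obtain U g where g: "(U, g) \<in> rational_reps X" "a = rational_class X U g" by (rule XY.X.carrierE)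
    have U: "openin (zariski X) U" "U \<noteq> {}" "regular_on X U g" using g by (simp_all add: XY.X.rational_reps_iff)
    obtain x0 where x0: "x0 \<in> U" "x0 \<in> \<Omega>" using XY.X.open_meet[OF U(1) \<Omega>_open U(2) \<Omega>_nonempty] by blast
    let ?c = "\<lambda>x. (lhat (fst x), fhat (rho x), fhat (rho x))"
    have c: "?c x \<in> cone_over X U" if "x \<in> U" "x \<in> \<Omega>" for x
      using normal_form[OF that(2)] that(1) by (simp add: cone_over_def)
    obtain p q where pq: "p \<in> polys X" "q \<in> polys X"
      "q (?c x0) \<noteq> 0" "\<And>c'. c' \<in> cone_over X U \<Longrightarrow> q c' \<noteq> 0 \<Longrightarrow> g (quot X c') = p c' / q c'"
      using regular_onE[OF U(3) c[OF x0]] by blast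
    show "a \<in> E"
      unfolding g(2)
    proof (rule generated_fraction[OF generated_polynomial[OF pq(1)] generated_polynomial[OF pq(2)] _ g(1)])
      show "\<exists>x\<in>\<Omega>. q (?c x) \<noteq> 0" using pq(3) x0(2) by blast
      fix x assume x: "x \<in> U" "x \<in> \<Omega>" "q (?c x) \<noteq> 0"
      then show "g x * q (?c x) = p (?c x)" using pq(4)[OF c[OF x(1,2)] x(3)] normal_form(2)[OF x(2)] by simp
    qed
  qed
qed

theorem degree_function_field: "L.dimension (2 * n) K (carrier (function_field X))"
proof -
  have "length (L.Irr K \<theta>) = 2 * n + 1" using Irr_length_le Irr_length_ge by simp
  then show ?thesis
    using L.dimension_simple_extension[OF subfield_K \<theta>_carrier \<theta>_algebraic] by (simp add: E_carrier)
qed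

end

theorem proposition7p3:
  fixes scale :: "complex \<Rightarrow> 'v::ab_group_add \<Rightarrow> 'v"
    and \<omega> :: "'v \<Rightarrow> 'v \<Rightarrow> complex" and n :: nat
  assumes "symplectic_space scale \<omega> n" and "n \<ge> 2"
  shows "B_image scale \<omega> 2 2 = points (proj_forms scale 2)
    \<and> has_generic_degree (incidence scale \<omega> 2 2) (proj_forms scale 2) rho (2 * n)"
proof -
  interpret symplectic_space scale \<omega> n by (rule assms(1))
  obtain e d \<mu> f1 y0 where "symplectic_frame scale \<omega> n e d \<mu> f1 y0"
    using frame_exists[OF assms(2)] by blast
  then interpret symplectic_frame scale \<omega> n e d \<mu> f1 y0 .
  have "subvariety Y (rho ` points X) = Y"
    by (simp add: subvariety_def rho_surj)
  then have "has_generic_degree X Y rho (2 * n)"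
    unfolding has_generic_degree_def Let_def
    using rho_surj irreducible_X morphism_rho degree_function_field
    by (simp add: K_def)
  then show ?thesis
    by (simp add: B_image_def rho_surj)
qed

end
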